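(* Let $X$ be a flexible affine algebraic variety. Then there exists an element $f\in\mathbb{K}[X]\setminus\mathbb{K}$ such that $\operatorname{Susp}(X,f,1,k_2,\dots,k_m)$ is flexible for any $k_i>1$, $i=2,\dots,m$.
   Context: $\mathbb{K}$ is an algebraically closed field of characteristic zero, all varieties are irreducible affine varieties over $\mathbb{K}$ (in particular the suspensions considered are assumed irreducible), and $m$ is a fixed positive integer. For $f\in\mathbb{K}[X]\setminus\mathbb{K}$ and positive integers $k_1,\dots,k_m$, the $m$-suspension over $X$ with weights $k_1,\dots,k_m$ is $\operatorname{Susp}(X,f,k_1,\dots,k_m)=\{y_1^{k_1}\cdots y_m^{k_m}=f(x)\}\subset X\times\mathbb{A}^m$, where $y_1,\dots,y_m$ are the coordinates on $\mathbb{A}^m$. A $\mathbb{G}_a$-subgroup of $\operatorname{Aut}(Z)$ is an algebraic subgroup isomorphic to the additive group of $\mathbb{K}$. A variety $Z$ is flexible if for every smooth point $p$ of $Z$ the tangent space $T_pZ$ is spanned by tangent vectors to orbits through $p$ of $\mathbb{G}_a$-subgroups of $\operatorname{Aut}(Z)$.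
   Formalization: The flexible variety X is additionally assumed not to be a single point; for a point, K[X] = K, so no f in K[X] \ K exists and the claim as stated fails. *)

theory Defs
  imports
    "HOL-Analysis.Analysis"
    "HOL-Library.Poly_Mapping"
    "HOL-Algebra.Bij"
begin

section \<open>Polynomials in a type of variables\<close>

text \<open>
  A polynomial with variables indexed by \<open>'i\<close> is a finitely supported map from
  exponent vectors to coefficients; the ring structure is the one of \<open>HOL-Library.Poly_Mapping\<close>.
\<close>

type_synonym ('i, 'k) mpol = "('i \<Rightarrow>\<^sub>0 nat) \<Rightarrow>\<^sub>0 'k"

definition mpol_eval :: "('i \<Rightarrow> 'k::comm_ring_1) \<Rightarrow> ('i, 'k) mpol \<Rightarrow> 'k" where
  "mpol_eval a P =
     (\<Sum>m\<in>Poly_Mapping.keys P. Poly_Mapping.lookup P m *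
        (\<Prod>i\<in>Poly_Mapping.keys m. a i ^ Poly_Mapping.lookup m i))"

definition mpol_vars :: "('i, 'k::zero) mpol \<Rightarrow> 'i set" where
  "mpol_vars P = (\<Union>m\<in>Poly_Mapping.keys P. Poly_Mapping.keys m)"

text \<open>
  The subtraction of exponents below is truncated, but a monomial not containing the
  variable \<open>i\<close> gets the coefficient 0.
\<close>

definition mpol_deriv :: "'i \<Rightarrow> ('i, 'k::comm_ring_1) mpol \<Rightarrow> ('i, 'k) mpol" where
  "mpol_deriv i P =
     (\<Sum>m\<in>Poly_Mapping.keys P.
        Poly_Mapping.single (m - Poly_Mapping.single i 1)
          (of_nat (Poly_Mapping.lookup m i) * Poly_Mapping.lookup P m))"

section \<open>Affine varieties\<close>

text \<open>
  Affine \<open>n\<close>-space is \<open>'k ^ 'n\<close>. An affine variety is presented as an irreducible Zariski closed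
  subset of some affine space.
\<close>

definition zariski_closed :: "('k::field ^ 'n) set \<Rightarrow> bool" where
  "zariski_closed Z \<longleftrightarrow> (\<exists>S. Z = {x. \<forall>P\<in>S. mpol_eval (($) x) P = 0})"

definition affine_variety :: "('k::field ^ 'n) set \<Rightarrow> bool" where
  "affine_variety Z \<longleftrightarrow> zariski_closed Z \<and> Z \<noteq> {} \<and>
     (\<forall>A B. zariski_closed A \<longrightarrow> zariski_closed B \<longrightarrow> Z = A \<union> B \<longrightarrow> Z = A \<or> Z = B)"

text \<open>
  Elements of the coordinate ring of \<open>Z\<close> are represented by functions on the ambient space;
  only their values on \<open>Z\<close> matter.
\<close>

definition regular_fun :: "('k::field ^ 'n) set \<Rightarrow> ('k ^ 'n \<Rightarrow> 'k) \<Rightarrow> bool" where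
  "regular_fun Z f \<longleftrightarrow> (\<exists>P. \<forall>x\<in>Z. f x = mpol_eval (($) x) P)"

definition morphism ::
  "('k::field ^ 'n) set \<Rightarrow> ('k ^ 'l) set \<Rightarrow> ('k ^ 'n \<Rightarrow> 'k ^ 'l) \<Rightarrow> bool" where
  "morphism Z W \<phi> \<longleftrightarrow> \<phi> \<in> Z \<rightarrow> W \<and> (\<forall>i. regular_fun Z (\<lambda>x. \<phi> x $ i))"

definition vec_join :: "'k ^ 'n \<Rightarrow> 'k ^ 'm \<Rightarrow> 'k ^ ('n::finite + 'm::finite)" where
  "vec_join x y = (\<chi> i. case i of Inl a \<Rightarrow> x $ a | Inr b \<Rightarrow> y $ b)"

definition vec_left :: "'k ^ ('n::finite + 'm::finite) \<Rightarrow> 'k ^ 'n" where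
  "vec_left w = (\<chi> a. w $ Inl a)"

definition vec_right :: "'k ^ ('n::finite + 'm::finite) \<Rightarrow> 'k ^ 'm" where
  "vec_right w = (\<chi> b. w $ Inr b)"

definition variety_prod :: "('k ^ 'n) set \<Rightarrow> ('k ^ 'm) set \<Rightarrow> ('k ^ ('n::finite + 'm::finite)) set" where
  "variety_prod Z W = {vec_join x y | x y. x \<in> Z \<and> y \<in> W}"

section \<open>Dimension, tangent spaces, smooth points\<close>

definition alg_independent ::
  "('k::field ^ 'n) set \<Rightarrow> nat \<Rightarrow> (nat \<Rightarrow> 'k ^ 'n \<Rightarrow> 'k) \<Rightarrow> bool" where
  "alg_independent Z r f \<longleftrightarrow>
     (\<forall>P. mpol_vars P \<subseteq> {..<r} \<longrightarrow> (\<forall>x\<in>Z. mpol_eval (\<lambda>i. f i x) P = 0) \<longrightarrow> P = 0)"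

text \<open>
  The dimension of a variety is the transcendence degree of its coordinate ring, which is
  also that of its function field. The maximum exists, being bounded by the dimension of
  the ambient space.
\<close>

definition variety_dim :: "('k::field ^ 'n) set \<Rightarrow> nat" where
  "variety_dim Z =
     (GREATEST r. \<exists>f. (\<forall>i<r. regular_fun Z (f i)) \<and> alg_independent Z r f)"

text \<open>
  The Zariski tangent space, as a subspace of the ambient vector space. For an arbitrary
  subset \<open>Z\<close> containing \<open>p\<close> it is the one of the Zariski closure of \<open>Z\<close>.
\<close>

definition tangent_space :: "('k::field ^ 'n) set \<Rightarrow> 'k ^ 'n \<Rightarrow> ('k ^ 'n) set" where
  "tangent_space Z p =
     {v. \<forall>P. (\<forall>x\<in>Z. mpol_eval (($) x) P = 0) \<longrightarrow>
           (\<Sum>i\<in>UNIV. mpol_eval (($) p) (mpol_deriv i P) * v $ i) = 0}"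

definition smooth_point :: "('k::field ^ 'n) set \<Rightarrow> 'k ^ 'n \<Rightarrow> bool" where
  "smooth_point Z p \<longleftrightarrow> p \<in> Z \<and> vec.dim (tangent_space Z p) = variety_dim Z"

section \<open>One-parameter unipotent subgroups and flexibility\<close>

definition aut_group :: "('k::field ^ 'n) set \<Rightarrow> ('k ^ 'n \<Rightarrow> 'k ^ 'n) monoid" where
  "aut_group Z = (BijGroup Z)
     \<lparr>carrier := {\<phi> \<in> Bij Z. morphism Z Z \<phi> \<and> morphism Z Z (inv_into Z \<phi>)}\<rparr>"

definition additive_grp :: "'k::field monoid" where
  "additive_grp = \<lparr>carrier = UNIV, mult = (+), one = 0\<rparr>"

text \<open>
  An algebraic subgroup \<open>H\<close> of the automorphism group of \<open>Z\<close> is a subgroup with a structure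
  of an algebraic group such that the action map \<open>H \<times> Z \<rightarrow> Z\<close> is a morphism. When \<open>H\<close> is
  isomorphic to the additive group, this structure is transported along an isomorphism \<open>\<phi>\<close>.
\<close>

definition Ga_subgroup :: "('k::field ^ 'n) set \<Rightarrow> ('k ^ 'n \<Rightarrow> 'k ^ 'n) set \<Rightarrow> bool" where
  "Ga_subgroup Z H \<longleftrightarrow> subgroup H (aut_group Z) \<and>
     (\<exists>\<phi>. \<phi> \<in> iso additive_grp ((aut_group Z)\<lparr>carrier := H\<rparr>) \<and>
        morphism (variety_prod (UNIV :: ('k ^ 1) set) Z) Z
          (\<lambda>w. \<phi> (vec_left w $ 1) (vec_right w)))"

definition orbit_of :: "('k ^ 'n \<Rightarrow> 'k ^ 'n) set \<Rightarrow> 'k ^ 'n \<Rightarrow> ('k ^ 'n) set" where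
  "orbit_of H p = (\<lambda>\<phi>. \<phi> p) ` H"

definition flexible :: "('k::field ^ 'n) set \<Rightarrow> bool" where
  "flexible Z \<longleftrightarrow>
     (\<forall>p. smooth_point Z p \<longrightarrow>
        vec.span (\<Union>H\<in>{H. Ga_subgroup Z H}. tangent_space (orbit_of H p) p) = tangent_space Z p)"

section \<open>Suspensions\<close>

definition suspension ::
  "('k::field ^ 'n) set \<Rightarrow> ('k ^ 'n \<Rightarrow> 'k) \<Rightarrow> ('m \<Rightarrow> nat) \<Rightarrow> ('k ^ ('n::finite + 'm::finite)) set" where
  "suspension X f k = {vec_join x y | x y. x \<in> X \<and> (\<Prod>j\<in>UNIV. (y $ j) ^ k j) = f x}"

end

theory Submission
  imports Defs
begin

text \<open>
  A nontrivial action \<open>\<phi>\<close> of the additive group on \<open>X\<close> has a local slice: a regular function \<open>r\<close> with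
  \<open>r(\<phi>\<^sub>t(x)) = r(x) + t s(x)\<close>, where \<open>s\<close> is invariant and not zero (\<open>flow_slice\<close>). The required function
  is \<open>f = s\<^sup>2 r\<close>. It satisfies \<open>f(\<phi>\<^sub>t(x)) = f(x) + t s(x)\<^sup>3\<close>, and \<open>f\<close> and its differential vanish where
  \<open>s\<close> does.

  Write the equation of the suspension as \<open>y\<^sub>j\<^sub>1 Y = f(x)\<close>, where \<open>Y\<close> is the product of the powers of the
  other coordinates. There are two kinds of \<open>G\<^sub>a\<close>-actions on the suspension. Every action on \<open>X\<close> lifts when
  it is slowed down by the factor \<open>Y\<close>, and \<open>y\<^sub>j\<^sub>1\<close> is corrected accordingly (\<open>lifted_flow\<close>). Moreover, for each
  coordinate \<open>j\<close>, adding \<open>t s\<^sup>3\<close> to \<open>y\<^sub>j\<close> changes the left-hand side by a multiple of \<open>s\<^sup>3\<close>, and this is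
  compensated by moving \<open>x\<close> along \<open>\<phi>\<close> for a suitable time (\<open>slice_flow\<close>). At a smooth point with \<open>Y \<noteq> 0\<close>
  and \<open>s(x) \<noteq> 0\<close> the velocities of these actions span the tangent space (\<open>flexible_at_S\<close>).

  Flexibility at a point is inherited along orbits (\<open>reach_flexible_at\<close>), so that it remains to move every
  smooth point to such a good point. If \<open>Y = 0\<close>, then \<open>s(x) \<noteq> 0\<close>: otherwise the differential of the
  equation is zero and the tangent space is too large for a smooth point (\<open>not_smooth\<close>). The actions of
  the second kind then make the coordinates nonzero one after the other (\<open>reach_Y_nonzero\<close>). If \<open>Y \<noteq> 0\<close>,
  then \<open>x\<close> is a smooth point of \<open>X\<close>. Since \<open>X\<close> is flexible, the orbit of \<open>x\<close> under all \<open>G\<^sub>a\<close>-actions is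
  Zariski dense (\<open>orbit_dense\<close>), so that lifted actions move \<open>x\<close> to a point with \<open>s \<noteq> 0\<close> (\<open>reach_lift\<close>).

  This uses two bodies of facts. The first one is dimension theory: the transcendence degree is the dimension
  of the general tangent space (\<open>generic_dim\<close>) and at most that of every tangent space
  (\<open>variety_dim_le_tangent_dim\<close>), and a dense orbit is recognized by its tangent spaces
  (\<open>vanish_of_equal_dim\<close>). The second one describes the ideal of the suspension (\<open>ideal_of_S\<close>): it is
  generated by the ideal of \<open>X\<close> and the equation, which gives the tangent spaces of the suspension, its
  dimension and its irreducibility. Throughout, \<open>G\<^sub>a\<close>-subgroups are replaced by polynomial flows and tangent
  spaces of orbits by velocities (\<open>flexible_iff\<close>).
\<close>

section \<open>Polynomials and directional derivatives\<close>

text \<open>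
  Evaluation with coefficients mapped by a ring homomorphism: values, substitution of polynomials and
  restriction to a polynomial curve are three instances, so that each is multiplicative by one proof.
\<close>

definition hom_eval :: "('k::comm_ring_1 \<Rightarrow> 'r::comm_ring_1) \<Rightarrow> ('i \<Rightarrow> 'r) \<Rightarrow> ('i, 'k) mpol \<Rightarrow> 'r" where
  "hom_eval h a P = (\<Sum>m\<in>Poly_Mapping.keys P. h (Poly_Mapping.lookup P m) *
     (\<Prod>i\<in>Poly_Mapping.keys m. a i ^ Poly_Mapping.lookup m i))"

definition ring_hom_map :: "('k::comm_ring_1 \<Rightarrow> 'r::comm_ring_1) \<Rightarrow> bool" where
  "ring_hom_map h \<longleftrightarrow> h 1 = 1 \<and> (\<forall>x y. h (x + y) = h x + h y) \<and> (\<forall>x y. h (x * y) = h x * h y)"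

lemma ring_hom_map_0: "ring_hom_map h \<Longrightarrow> h 0 = 0"
  unfolding ring_hom_map_def by (metis add_cancel_left_left)

abbreviation mconst :: "'k::comm_ring_1 \<Rightarrow> ('i, 'k) mpol" where
  "mconst c \<equiv> Poly_Mapping.single 0 c"

definition mvar :: "'i \<Rightarrow> ('i, 'k::comm_ring_1) mpol" where
  "mvar i = Poly_Mapping.single (Poly_Mapping.single i 1) 1"

lemma mpol_eval_hom_eval: "mpol_eval = hom_eval (\<lambda>c. c)"
  by (intro ext) (simp add: mpol_eval_def hom_eval_def)

lemma hom_eval_superset:
  assumes "ring_hom_map h" "finite A" "Poly_Mapping.keys P \<subseteq> A"
  shows "hom_eval h a P = (\<Sum>m\<in>A. h (Poly_Mapping.lookup P m) *
     (\<Prod>i\<in>Poly_Mapping.keys m. a i ^ Poly_Mapping.lookup m i))"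
  unfolding hom_eval_def
  by (rule sum.mono_neutral_left) (use assms in \<open>auto simp: in_keys_iff ring_hom_map_0\<close>)

lemma hom_eval_add:
  assumes h: "ring_hom_map h"
  shows "hom_eval h a (P + Q) = hom_eval h a P + hom_eval h a Q"
proof -
  let ?A = "Poly_Mapping.keys P \<union> Poly_Mapping.keys Q"
  have k: "Poly_Mapping.keys (P + Q) \<subseteq> ?A" by (rule Poly_Mapping.keys_add)
  have a: "h (x + y) = h x + h y" for x y using h by (simp add: ring_hom_map_def)
  show ?thesis
    by (simp add: hom_eval_superset[OF h _ k] hom_eval_superset[OF h, of ?A P] hom_eval_superset[OF h, of ?A Q]
       lookup_add a distrib_right sum.distrib)
qed

lemma hom_eval_0 [simp]: "hom_eval h a 0 = 0"
  by (simp add: hom_eval_def)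

lemma hom_eval_single:
  assumes h: "ring_hom_map h"
  shows "hom_eval h a (Poly_Mapping.single m c) =
     h c * (\<Prod>i\<in>Poly_Mapping.keys m. a i ^ Poly_Mapping.lookup m i)"
  by (subst hom_eval_superset[OF h, of "{m}"]) auto

lemma hom_eval_sum:
  assumes h: "ring_hom_map h"
  shows "hom_eval h a (sum f A) = (\<Sum>x\<in>A. hom_eval h a (f x))"
  by (induction A rule: infinite_finite_induct) (auto simp: hom_eval_add[OF h])

lemma mpol_sum_monomials:
  "P = (\<Sum>m\<in>Poly_Mapping.keys P. Poly_Mapping.single m (Poly_Mapping.lookup P m))"
proof (rule poly_mapping_eqI)
  fix k
  show "Poly_Mapping.lookup P k = Poly_Mapping.lookup (\<Sum>m\<in>Poly_Mapping.keys P. Poly_Mapping.single m (Poly_Mapping.lookup P m)) k"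
  proof (cases "k \<in> Poly_Mapping.keys P")
    case True
    have "(\<Sum>x\<in>Poly_Mapping.keys P. Poly_Mapping.lookup P x when x = k) = Poly_Mapping.lookup P k"
      using True by (simp add: when_def)
    then show ?thesis by (simp add: lookup_sum lookup_single)
  next
    case False
    have "(\<Sum>x\<in>Poly_Mapping.keys P. Poly_Mapping.lookup P x when x = k) = 0"
      using False by (intro sum.neutral) (auto simp: when_def)
    then show ?thesis using False by (simp add: lookup_sum lookup_single in_keys_iff)
  qed
qed

lemma monomial_prod_superset:
  assumes "finite A" "Poly_Mapping.keys m \<subseteq> A"
  shows "(\<Prod>i\<in>Poly_Mapping.keys m. a i ^ Poly_Mapping.lookup m i) = (\<Prod>i\<in>A. (a i :: 'r::comm_ring_1) ^ Poly_Mapping.lookup m i)"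
  by (rule prod.mono_neutral_left) (use assms in \<open>auto simp: in_keys_iff\<close>)

lemma monomial_prod_add:
  "(\<Prod>i\<in>Poly_Mapping.keys (m + m'). (a i :: 'r::comm_ring_1) ^ Poly_Mapping.lookup (m + m') i) =
   (\<Prod>i\<in>Poly_Mapping.keys m. a i ^ Poly_Mapping.lookup m i) *
   (\<Prod>i\<in>Poly_Mapping.keys m'. a i ^ Poly_Mapping.lookup m' i)"
proof -
  let ?A = "Poly_Mapping.keys m \<union> Poly_Mapping.keys m'"
  show ?thesis
    by (subst (1 2 3) monomial_prod_superset[of ?A])
       (use Poly_Mapping.keys_add[of m m'] in \<open>auto simp: lookup_add power_add prod.distrib\<close>)
qed

lemma hom_eval_mult:
  assumes h: "ring_hom_map h"
  shows "hom_eval h a (P * Q) = hom_eval h a P * hom_eval h a Q"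
proof -
  let ?s = "\<lambda>P m. Poly_Mapping.single m (Poly_Mapping.lookup P m)"
  have m: "h (x * y) = h x * h y" for x y using h by (simp add: ring_hom_map_def)
  have 1: "hom_eval h a (Poly_Mapping.single m c * Poly_Mapping.single m' c') =
     hom_eval h a (Poly_Mapping.single m c) * hom_eval h a (Poly_Mapping.single m' c')" for m m' c c'
    by (simp add: mult_single hom_eval_single[OF h] monomial_prod_add m ac_simps)
  have "P * Q = (\<Sum>m\<in>Poly_Mapping.keys P. \<Sum>m'\<in>Poly_Mapping.keys Q. ?s P m * ?s Q m')"
    by (subst (1) mpol_sum_monomials[of P], subst (1) mpol_sum_monomials[of Q])
       (simp add: sum_product)
  also have "hom_eval h a \<dots> = (\<Sum>m\<in>Poly_Mapping.keys P. \<Sum>m'\<in>Poly_Mapping.keys Q. hom_eval h a (?s P m) * hom_eval h a (?s Q m'))"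
    by (simp add: hom_eval_sum[OF h] 1)
  also have "\<dots> = hom_eval h a (\<Sum>m\<in>Poly_Mapping.keys P. ?s P m) * hom_eval h a (\<Sum>m\<in>Poly_Mapping.keys Q. ?s Q m)"
    by (simp add: hom_eval_sum[OF h] sum_product)
  finally show ?thesis by (simp flip: mpol_sum_monomials)
qed

lemma hom_eval_const: "ring_hom_map h \<Longrightarrow> hom_eval h a (mconst c) = h c"
  by (simp add: hom_eval_single)

lemma hom_eval_var: "ring_hom_map h \<Longrightarrow> hom_eval h a (mvar i) = a i"
  by (simp add: hom_eval_single mvar_def) (simp add: ring_hom_map_def)

lemma monomial_eq:
  "Poly_Mapping.single m c = mconst c * (\<Prod>i\<in>Poly_Mapping.keys m. mvar i ^ Poly_Mapping.lookup m i)"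
proof -
  have p: "mvar i ^ n = Poly_Mapping.single (Poly_Mapping.single i n) (1::'b)" for i :: 'a and n
    by (induction n) (auto simp: mvar_def mult_single simp flip: single_add)
  have 1: "(\<Prod>i\<in>A. mvar i ^ Poly_Mapping.lookup m i) =
     Poly_Mapping.single (\<Sum>i\<in>A. Poly_Mapping.single i (Poly_Mapping.lookup m i)) (1::'b)" for A
    by (induction A rule: infinite_finite_induct) (auto simp: p mult_single)
  have 2: "(\<Sum>i\<in>Poly_Mapping.keys m. Poly_Mapping.single i (Poly_Mapping.lookup m i)) = m"
    by (rule poly_mapping_eqI)
       (auto simp: lookup_sum lookup_single when_def in_keys_iff)
  show ?thesis by (simp add: 1 2 mult_single)
qed

text \<open>
  Polynomials are generated as a ring by constants and variables; every identity below between
  ring homomorphisms or derivations on polynomials is checked on generators by this rule.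
\<close>

lemma mpol_induct [case_names const var add mult]:
  fixes P :: "('i, 'k::comm_ring_1) mpol"
  assumes c: "\<And>c. R (mconst c)" and v: "\<And>i. R (mvar i)"
    and a: "\<And>P Q. R P \<Longrightarrow> R Q \<Longrightarrow> R (P + Q)" and m: "\<And>P Q. R P \<Longrightarrow> R Q \<Longrightarrow> R (P * Q)"
  shows "R P"
proof -
  have pw: "R (P ^ n)" if "R P" for P n
  proof (induction n)
    case 0 then show ?case using c[of 1] by simp
  next
    case (Suc n) then show ?case using m[OF that] by simp
  qed
  have pr: "R (\<Prod>i\<in>A. f i)" if "\<And>i. R (f i)" for A and f :: "'i \<Rightarrow> ('i, 'k) mpol"
    using that c[of 1] by (induction A rule: infinite_finite_induct) (auto intro: m)
  have sg: "R (Poly_Mapping.single k x)" for k x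
    by (subst monomial_eq) (intro m c pr pw v)
  have "R (\<Sum>k\<in>A. Poly_Mapping.single k (Poly_Mapping.lookup P k))" for A
    using c[of 0] by (induction A rule: infinite_finite_induct) (auto intro: a sg)
  from this[of "Poly_Mapping.keys P"] show ?thesis by (simp flip: mpol_sum_monomials)
qed

lemma ring_hom_map_id [simp]: "ring_hom_map (\<lambda>c. c)" by (simp add: ring_hom_map_def)
lemma ring_hom_map_pconst [simp]: "ring_hom_map (\<lambda>c. [:c:])" by (simp add: ring_hom_map_def one_pCons)
lemma ring_hom_map_mconst [simp]: "ring_hom_map (\<lambda>c. mconst c)"
  by (simp add: ring_hom_map_def single_add mult_single)

lemma eval_add [simp]: "mpol_eval a (P + Q) = mpol_eval a P + mpol_eval a Q"
  and eval_mult [simp]: "mpol_eval a (P * Q) = mpol_eval a P * mpol_eval a Q"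
  and eval_const [simp]: "mpol_eval a (mconst c) = c"
  and eval_var [simp]: "mpol_eval a (mvar i) = a i"
  and eval_0 [simp]: "mpol_eval a 0 = 0"
  by (simp_all add: mpol_eval_hom_eval hom_eval_add hom_eval_mult hom_eval_const hom_eval_var)

lemma eval_1 [simp]: "mpol_eval a 1 = 1"
  using eval_const[of a 1] by simp
lemma eval_uminus [simp]: "mpol_eval a (- P) = - mpol_eval a P"
  using eval_add[of a P "- P"] by (simp add: eq_neg_iff_add_eq_0 add.commute)
lemma eval_diff [simp]: "mpol_eval a (P - Q) = mpol_eval a P - mpol_eval a Q"
  using eval_add[of a P "- Q"] by simp
lemma eval_sum [simp]: "mpol_eval a (sum f A) = (\<Sum>x\<in>A. mpol_eval a (f x))"
  by (induction A rule: infinite_finite_induct) auto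
lemma eval_prod [simp]: "mpol_eval a (prod f A) = (\<Prod>x\<in>A. mpol_eval a (f x))"
  by (induction A rule: infinite_finite_induct) auto
lemma eval_power [simp]: "mpol_eval a (P ^ n) = mpol_eval a P ^ n"
  by (induction n) auto

definition subst :: "('i \<Rightarrow> ('j, 'k::comm_ring_1) mpol) \<Rightarrow> ('i, 'k) mpol \<Rightarrow> ('j, 'k) mpol" where
  "subst = hom_eval (\<lambda>c. mconst c)"

text \<open>
  Restriction to the curve \<open>t \<mapsto> (\<gamma>\<^sub>i(t))\<^sub>i\<close>, as a univariate polynomial in \<open>t\<close>.
\<close>

definition along :: "('i \<Rightarrow> 'k::comm_ring_1 poly) \<Rightarrow> ('i, 'k) mpol \<Rightarrow> 'k poly" where
  "along = hom_eval (\<lambda>c. [:c:])"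

lemma subst_add [simp]: "subst s (P + Q) = subst s P + subst s Q"
  and subst_mult [simp]: "subst s (P * Q) = subst s P * subst s Q"
  and subst_const [simp]: "subst s (mconst c) = mconst c"
  and subst_var [simp]: "subst s (mvar i) = s i"
  and subst_0 [simp]: "subst s 0 = 0"
  by (simp_all add: subst_def hom_eval_add hom_eval_mult hom_eval_const hom_eval_var)

lemma along_add [simp]: "along s (P + Q) = along s P + along s Q"
  and along_mult [simp]: "along s (P * Q) = along s P * along s Q"
  and along_const [simp]: "along s (mconst c) = [:c:]"
  and along_var [simp]: "along s (mvar i) = s i"
  by (simp_all add: along_def hom_eval_add hom_eval_mult hom_eval_const hom_eval_var)

lemma eval_subst: "mpol_eval a (subst s P) = mpol_eval (\<lambda>i. mpol_eval a (s i)) P"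
  by (induction P rule: mpol_induct) auto

lemma poly_along: "poly (along \<gamma> P) t = mpol_eval (\<lambda>i. poly (\<gamma> i) t) P"
  by (induction P rule: mpol_induct) auto

text \<open>
  The derivative at \<open>a\<close> in the direction \<open>v\<close>, read off as the linear coefficient along the line
  \<open>a + t v\<close>. The Leibniz and chain rules then come from the multiplicativity of restriction to a curve,
  and the index set of the variables may be infinite.
\<close>

definition dirderiv :: "('i, 'k::comm_ring_1) mpol \<Rightarrow> ('i \<Rightarrow> 'k) \<Rightarrow> ('i \<Rightarrow> 'k) \<Rightarrow> 'k" where
  "dirderiv P a v = coeff (along (\<lambda>i. [:a i, v i:]) P) 1"

lemma coeff_mult_1: "coeff (p * q) (Suc 0) = coeff p 0 * coeff q (Suc 0) + coeff p (Suc 0) * coeff q 0"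
  by (simp add: coeff_mult)

lemma coeff_0_along: "coeff (along \<gamma> P) 0 = mpol_eval (\<lambda>i. coeff (\<gamma> i) 0) P"
  using poly_along[of \<gamma> P 0] by (simp add: poly_0_coeff_0)

lemma dirderiv_const [simp]: "dirderiv (mconst c) a v = 0"
  and dirderiv_var [simp]: "dirderiv (mvar i) a v = v i"
  and dirderiv_add [simp]: "dirderiv (P + Q) a v = dirderiv P a v + dirderiv Q a v"
  by (simp_all add: dirderiv_def)
lemma dirderiv_mult [simp]: "dirderiv (P * Q) a v = mpol_eval a P * dirderiv Q a v + dirderiv P a v * mpol_eval a Q"
  by (simp add: dirderiv_def coeff_mult_1 coeff_0_along)
lemma dirderiv_0 [simp]: "dirderiv 0 a v = 0"
  using dirderiv_const[of 0 a v] by simp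
lemma dirderiv_uminus [simp]: "dirderiv (- P) a v = - dirderiv P a v"
  using dirderiv_add[of P "- P" a v] by (simp add: eq_neg_iff_add_eq_0 add.commute)
lemma dirderiv_diff [simp]: "dirderiv (P - Q) a v = dirderiv P a v - dirderiv Q a v"
  using dirderiv_add[of P "- Q" a v] by simp
lemma dirderiv_sum [simp]: "dirderiv (sum f A) a v = (\<Sum>x\<in>A. dirderiv (f x) a v)"
  by (induction A rule: infinite_finite_induct) auto

lemma coeff_1_along: "coeff (along \<gamma> P) 1 = dirderiv P (\<lambda>i. coeff (\<gamma> i) 0) (\<lambda>i. coeff (\<gamma> i) 1)"
  by (induction P rule: mpol_induct) (auto simp: coeff_mult_1 coeff_0_along)

lemma dirderiv_subst: "dirderiv (subst s P) a v = dirderiv P (\<lambda>i. mpol_eval a (s i)) (\<lambda>i. dirderiv (s i) a v)"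
  by (induction P rule: mpol_induct) (auto simp: eval_subst)

lemma dirderiv_add_dir: "dirderiv P a (\<lambda>i. v i + w i) = dirderiv P a v + dirderiv P a w"
  by (induction P rule: mpol_induct) (auto simp: algebra_simps)
lemma dirderiv_scale_dir: "dirderiv P a (\<lambda>i. c * v i) = c * dirderiv P a v"
  by (induction P rule: mpol_induct) (auto simp: algebra_simps)
lemma dirderiv_zero_dir: "dirderiv P a (\<lambda>i. 0) = 0"
  using dirderiv_scale_dir[of P a 0] by simp
lemma dirderiv_sum_dir: "dirderiv P a (\<lambda>i. \<Sum>x\<in>A. v x i) = (\<Sum>x\<in>A. dirderiv P a (v x))"
  by (induction A rule: infinite_finite_induct) (auto simp: dirderiv_zero_dir dirderiv_add_dir)

lemma poly_eqI_infinite: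
  fixes p q :: "'k::field_char_0 poly"
  assumes "\<And>t. poly p t = poly q t" shows "p = q"
  using assms by (simp add: poly_eq_poly_eq_iff[symmetric] fun_eq_iff)

lemma mpol_deriv_superset:
  assumes "finite A" "Poly_Mapping.keys P \<subseteq> A"
  shows "mpol_deriv i P = (\<Sum>m\<in>A. Poly_Mapping.single (m - Poly_Mapping.single i 1)
          (of_nat (Poly_Mapping.lookup m i) * Poly_Mapping.lookup P m))"
  unfolding mpol_deriv_def
  by (rule sum.mono_neutral_left) (use assms in \<open>auto simp: in_keys_iff\<close>)

lemma mpol_deriv_add: "mpol_deriv i (P + Q) = mpol_deriv i P + mpol_deriv i Q"
proof -
  let ?A = "Poly_Mapping.keys P \<union> Poly_Mapping.keys Q"
  show ?thesis
    by (subst (1 2 3) mpol_deriv_superset[of ?A])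
      (use Poly_Mapping.keys_add[of P Q] in \<open>auto simp: lookup_add distrib_left single_add sum.distrib\<close>)
qed

lemma mpol_deriv_0: "mpol_deriv i 0 = 0" by (simp add: mpol_deriv_def)

lemma mpol_deriv_sum: "mpol_deriv i (sum f A) = (\<Sum>x\<in>A. mpol_deriv i (f x))"
  by (induction A rule: infinite_finite_induct) (auto simp: mpol_deriv_0 mpol_deriv_add)

lemma mpol_deriv_single: "mpol_deriv i (Poly_Mapping.single m c) =
  Poly_Mapping.single (m - Poly_Mapping.single i 1) (of_nat (Poly_Mapping.lookup m i) * c)"
  by (subst mpol_deriv_superset[of "{m}"]) auto

lemma eval_single: "mpol_eval a (Poly_Mapping.single m c) = c * (\<Prod>i\<in>UNIV. a (i::'i::finite) ^ Poly_Mapping.lookup m i)"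
  by (simp add: mpol_eval_hom_eval hom_eval_single monomial_prod_superset[of UNIV])

lemma sum_mpol_deriv_eq_dirderiv:
  fixes P :: "('i::finite, 'k::field) mpol"
  shows "(\<Sum>i\<in>UNIV. mpol_eval a (mpol_deriv i P) * v i) = dirderiv P a v"
proof -
  have pd: "coeff p 1 = poly (pderiv p) 0" for p :: "'k poly"
    by (simp add: poly_0_coeff_0 coeff_pderiv)
  have sg: "(\<Sum>i\<in>UNIV. mpol_eval a (mpol_deriv i (Poly_Mapping.single m c)) * v i) = dirderiv (Poly_Mapping.single m c) a v" for m c
  proof -
    let ?l = "Poly_Mapping.lookup m"
    have al: "along (\<lambda>i. [:a i, v i:]) (Poly_Mapping.single m c) = [:c:] * (\<Prod>i\<in>UNIV. [:a i, v i:] ^ ?l i)"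
      by (simp add: along_def hom_eval_single monomial_prod_superset[of UNIV])
    have "dirderiv (Poly_Mapping.single m c) a v = c * (\<Sum>i\<in>UNIV. (\<Prod>j\<in>UNIV-{i}. a j ^ ?l j) * (of_nat (?l i) * a i ^ (?l i - 1) * v i))"
      unfolding dirderiv_def al pd
      by (simp add: pderiv_mult pderiv_smult pderiv_prod pderiv_power pderiv_pCons poly_prod poly_sum poly_mult ac_simps)
    also have "\<dots> = (\<Sum>i\<in>UNIV. mpol_eval a (mpol_deriv i (Poly_Mapping.single m c)) * v i)"
      unfolding sum_distrib_left
    proof (rule sum.cong[OF refl])
      fix i
      have 1: "Poly_Mapping.lookup (m - Poly_Mapping.single i 1) j = (if j = i then ?l i - 1 else ?l j)" for j
        by (simp add: lookup_minus lookup_single when_def)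
      have 2: "(\<Prod>j\<in>UNIV. a j ^ Poly_Mapping.lookup (m - Poly_Mapping.single i 1) j) = a i ^ (?l i - 1) * (\<Prod>j\<in>UNIV-{i}. a j ^ ?l j)"
        unfolding 1 by (subst prod.remove[of _ i]) auto
      show "c * ((\<Prod>j\<in>UNIV - {i}. a j ^ ?l j) * (of_nat (?l i) * a i ^ (?l i - 1) * v i)) =
         mpol_eval a (mpol_deriv i (Poly_Mapping.single m c)) * v i"
        unfolding mpol_deriv_single eval_single 2 by (simp add: ac_simps)
    qed
    finally show ?thesis by simp
  qed
  have "dirderiv (\<Sum>m\<in>A. Poly_Mapping.single m (Poly_Mapping.lookup P m)) a v =
     (\<Sum>i\<in>UNIV. mpol_eval a (mpol_deriv i (\<Sum>m\<in>A. Poly_Mapping.single m (Poly_Mapping.lookup P m))) * v i)" for A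
    by (simp add: mpol_deriv_sum sum_distrib_right sg[symmetric]) (rule sum.swap)
  from this[of "Poly_Mapping.keys P"] show ?thesis by (simp flip: mpol_sum_monomials)
qed

section \<open>Tangent vectors along a tower of coordinates\<close>

abbreviation val :: "'k::comm_ring_1 ^ 'n \<Rightarrow> ('n, 'k) mpol \<Rightarrow> 'k" where
  "val x \<equiv> mpol_eval (($) x)"

definition vanish_at :: "('z \<Rightarrow> 'i \<Rightarrow> 'k::comm_ring_1) \<Rightarrow> 'z set \<Rightarrow> ('i, 'k) mpol \<Rightarrow> bool" where
  "vanish_at g Z P \<longleftrightarrow> (\<forall>z\<in>Z. mpol_eval (g z) P = 0)"

text \<open>
  The polynomials whose variables lie in \<open>J\<close>, as the subring generated by these variables. This form
  gives an induction rule, and the expansion in one variable in \<open>polys_in_insert\<close>.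
\<close>

inductive_set polys_in :: "'i set \<Rightarrow> ('i, 'k::comm_ring_1) mpol set" for J where
  const: "mconst c \<in> polys_in J"
| var: "i \<in> J \<Longrightarrow> mvar i \<in> polys_in J"
| add: "P \<in> polys_in J \<Longrightarrow> Q \<in> polys_in J \<Longrightarrow> P + Q \<in> polys_in J"
| mult: "P \<in> polys_in J \<Longrightarrow> Q \<in> polys_in J \<Longrightarrow> P * Q \<in> polys_in J"

lemma polys_in_0: "0 \<in> polys_in J" and polys_in_1: "1 \<in> polys_in J"
  using polys_in.const[of 0 J] polys_in.const[of 1 J] by auto

lemma polys_in_uminus: "P \<in> polys_in J \<Longrightarrow> - P \<in> polys_in J"
  using polys_in.mult[OF polys_in.const[of "-1" J], of P] by (simp add: single_uminus)

lemma polys_in_diff: "P \<in> polys_in J \<Longrightarrow> Q \<in> polys_in J \<Longrightarrow> P - Q \<in> polys_in J"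
  using polys_in.add[of P J "- Q"] polys_in_uminus[of Q J] by simp

lemma polys_in_power: "P \<in> polys_in J \<Longrightarrow> P ^ n \<in> polys_in J"
  by (induction n) (auto intro: polys_in.mult polys_in_1)

lemma polys_in_sum: "(\<And>x. x \<in> A \<Longrightarrow> f x \<in> polys_in J) \<Longrightarrow> sum f A \<in> polys_in J"
  by (induction A rule: infinite_finite_induct) (auto intro: polys_in.add polys_in_0)

lemma polys_in_prod: "(\<And>x. x \<in> A \<Longrightarrow> f x \<in> polys_in J) \<Longrightarrow> prod f A \<in> polys_in J"
  by (induction A rule: infinite_finite_induct) (auto intro: polys_in.mult polys_in_1)

lemma polys_in_mono: "P \<in> polys_in J \<Longrightarrow> J \<subseteq> J' \<Longrightarrow> P \<in> polys_in J'"
  by (induction rule: polys_in.induct) (auto intro: polys_in.intros)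

lemma polys_in_empty: "P \<in> polys_in {} \<Longrightarrow> \<exists>c. P = mconst c"
proof (induction rule: polys_in.induct)
  case (add P Q)
  then obtain a b where "P = mconst a" "Q = mconst b" by blast
  then have "P + Q = mconst (a + b)" by (simp add: single_add)
  then show ?case by blast
next
  case (mult P Q)
  then obtain a b where "P = mconst a" "Q = mconst b" by blast
  then have "P * Q = mconst (a * b)" by (simp add: mult_single)
  then show ?case by blast
qed auto

lemma polys_in_subst:
  "P \<in> polys_in J \<Longrightarrow> (\<And>i. i \<in> J \<Longrightarrow> s i \<in> polys_in J') \<Longrightarrow> subst s P \<in> polys_in J'"
  by (induction rule: polys_in.induct) (auto intro: polys_in.intros)

lemma polys_in_UNIV: "P \<in> polys_in UNIV"
  by (induction P rule: mpol_induct) (auto intro: polys_in.intros)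

lemma vars_polys_in:
  assumes "mpol_vars P \<subseteq> J" shows "P \<in> polys_in J"
proof -
  have "Poly_Mapping.single m (Poly_Mapping.lookup P m) \<in> polys_in J" if "m \<in> Poly_Mapping.keys P" for m
    by (subst monomial_eq)
       (use assms that in \<open>auto simp: mpol_vars_def intro!: polys_in.intros polys_in_prod polys_in_power\<close>)
  then have "(\<Sum>m\<in>Poly_Mapping.keys P. Poly_Mapping.single m (Poly_Mapping.lookup P m)) \<in> polys_in J"
    by (rule polys_in_sum)
  then show ?thesis by (simp flip: mpol_sum_monomials)
qed

lemma polys_in_vars:
  fixes P :: "('i, 'k::comm_ring_1) mpol"
  shows "P \<in> polys_in J \<Longrightarrow> mpol_vars P \<subseteq> J"
proof (induction rule: polys_in.induct)
  case (const c) then show ?case by (auto simp: mpol_vars_def)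
next
  case (var i)
  have "mpol_vars (mvar i :: ('i, 'k) mpol) \<subseteq> {i}" by (simp add: mpol_vars_def mvar_def)
  then show ?case using var by blast
next
  case (add P Q)
  then show ?case using Poly_Mapping.keys_add[of P Q] unfolding mpol_vars_def by blast
next
  case (mult P Q)
  show ?case unfolding mpol_vars_def
  proof
    fix x assume "x \<in> (\<Union>m\<in>Poly_Mapping.keys (P * Q). Poly_Mapping.keys m)"
    then obtain m where m: "m \<in> Poly_Mapping.keys (P * Q)" "x \<in> Poly_Mapping.keys m" by auto
    then obtain a b where "a \<in> Poly_Mapping.keys P" "b \<in> Poly_Mapping.keys Q" "m = a + b"
      using keys_mult[of P Q] by auto
    then have "x \<in> Poly_Mapping.keys a \<or> x \<in> Poly_Mapping.keys b" "Poly_Mapping.keys a \<subseteq> J" "Poly_Mapping.keys b \<subseteq> J"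
      using m mult.IH Poly_Mapping.keys_add[of a b] unfolding mpol_vars_def by blast+
    then show "x \<in> J" by blast
  qed
qed

lemma eval_polys_in_cong:
  "P \<in> polys_in J \<Longrightarrow> (\<And>i. i \<in> J \<Longrightarrow> a i = b i) \<Longrightarrow> mpol_eval a P = mpol_eval b P"
  by (induction rule: polys_in.induct) auto

lemma dirderiv_polys_in_cong:
  "P \<in> polys_in J \<Longrightarrow> (\<And>i. i \<in> J \<Longrightarrow> v i = w i) \<Longrightarrow> dirderiv P a v = dirderiv P a w"
  by (induction rule: polys_in.induct) auto

lemma eval_poly: "mpol_eval a (poly q x) = poly (map_poly (mpol_eval a) q) (mpol_eval a x)"
  by (induction q) (auto simp: map_poly_pCons)

lemma subst_poly: "subst s (poly q x) = poly (map_poly (subst s) q) (subst s x)"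
  by (induction q) (auto simp: map_poly_pCons)

lemma dirderiv_poly: "dirderiv (poly q x) a v =
    poly (map_poly (\<lambda>c. dirderiv c a v) q) (mpol_eval a x) + mpol_eval a (poly (pderiv q) x) * dirderiv x a v"
  by (induction q) (auto simp: map_poly_pCons pderiv_pCons algebra_simps)

lemma poly_polys_in: "(\<And>l. coeff q l \<in> polys_in J) \<Longrightarrow> x \<in> polys_in J \<Longrightarrow> poly q x \<in> polys_in J"
  unfolding poly_altdef by (intro polys_in_sum polys_in.mult polys_in_power)

lemma polys_in_insert:
  "P \<in> polys_in (insert i J) \<Longrightarrow> \<exists>q. (\<forall>l. coeff q l \<in> polys_in J) \<and> P = poly q (mvar i)"
proof (induction rule: polys_in.induct)
  case (const c)
  show ?case by (rule exI[of _ "[:mconst c:]"]) (auto simp: coeff_pCons polys_in_0 split: nat.split intro: polys_in.const)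
next
  case (var j)
  show ?case
  proof (cases "j = i")
    case True
    then show ?thesis by (intro exI[of _ "[:0, 1:]"]) (auto simp: coeff_pCons polys_in_0 polys_in_1 split: nat.split)
  next
    case False
    then show ?thesis using var
      by (intro exI[of _ "[:mvar j:]"]) (auto simp: coeff_pCons polys_in_0 split: nat.split intro: polys_in.var)
  qed
next
  case (add P Q)
  then obtain p q where "\<forall>l. coeff p l \<in> polys_in J" "P = poly p (mvar i)" "\<forall>l. coeff q l \<in> polys_in J" "Q = poly q (mvar i)"
    by auto
  then show ?case by (intro exI[of _ "p + q"]) (auto intro: polys_in.add)
next
  case (mult P Q)
  then obtain p q where "\<forall>l. coeff p l \<in> polys_in J" "P = poly p (mvar i)" "\<forall>l. coeff q l \<in> polys_in J" "Q = poly q (mvar i)"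
    by auto
  then show ?case by (intro exI[of _ "p * q"]) (auto simp: coeff_mult intro: polys_in_sum polys_in.mult)
qed

text \<open>
  Points \<open>z\<close> are evaluated through the coordinate functions \<open>g z\<close>. A vector \<open>v\<close> is tangent at stage
  \<open>J\<close> if it is compatible with the relations that involve the coordinates in \<open>J\<close> only; equivalently it is
  a derivation at \<open>z\<close> of the ring generated by these coordinates.
\<close>

definition tangent_at :: "('z \<Rightarrow> 'i \<Rightarrow> 'k::comm_ring_1) \<Rightarrow> 'z set \<Rightarrow> 'i set \<Rightarrow> 'z \<Rightarrow> ('i \<Rightarrow> 'k) \<Rightarrow> bool" where
  "tangent_at g Z J z v \<longleftrightarrow> (\<forall>P\<in>polys_in J. vanish_at g Z P \<longrightarrow> dirderiv P (g z) v = 0)"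

definition transcendental_over :: "('z \<Rightarrow> 'i \<Rightarrow> 'k::comm_ring_1) \<Rightarrow> 'z set \<Rightarrow> 'i set \<Rightarrow> 'i \<Rightarrow> bool" where
  "transcendental_over g Z J i \<longleftrightarrow>
     (\<forall>q. (\<forall>l. coeff q l \<in> polys_in J) \<longrightarrow> vanish_at g Z (poly q (mvar i)) \<longrightarrow> (\<forall>l. vanish_at g Z (coeff q l)))"

lemma coeff_map_poly_zero: "(\<And>l. f (coeff q l) = 0) \<Longrightarrow> f 0 = 0 \<Longrightarrow> map_poly f q = 0"
  by (rule poly_eqI) (simp add: coeff_map_poly)

lemma dirderiv_poly_vanishing_coeffs:
  fixes g :: "'z \<Rightarrow> 'i::linorder \<Rightarrow> 'k::field"
  assumes "tangent_at g Z J z v" "z \<in> Z" "\<forall>l. coeff q l \<in> polys_in J" "\<forall>l. vanish_at g Z (coeff q l)"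
  shows "dirderiv (poly q x) (g z) v = 0"
proof -
  have "dirderiv (coeff q l) (g z) v = 0" for l using assms by (auto simp: tangent_at_def)
  moreover have "mpol_eval (g z) (coeff q l) = 0" for l using assms by (auto simp: vanish_at_def)
  moreover have "mpol_eval (g z) (of_nat n) = of_nat n" for n
    by (induction n) auto
  ultimately show ?thesis
    by (simp add: dirderiv_poly eval_poly coeff_map_poly_zero coeff_pderiv)
qed

text \<open>
  A relation over \<open>J \<union> {i}\<close> has coefficients that are themselves relations over \<open>J\<close>, so that the
  new component \<open>v i\<close> is unconstrained.
\<close>

lemma tangent_at_transcendental:
  fixes g :: "'z \<Rightarrow> 'i::linorder \<Rightarrow> 'k::field"
  assumes "transcendental_over g Z J i" "tangent_at g Z J z v" "z \<in> Z"
  shows "tangent_at g Z (insert i J) z v"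
  unfolding tangent_at_def
proof (intro ballI impI)
  fix P assume "P \<in> polys_in (insert i J)" and v: "vanish_at g Z P"
  then obtain q where q: "\<forall>l. coeff q l \<in> polys_in J" "P = poly q (mvar i)"
    using polys_in_insert[of P i J] by blast
  have "\<forall>l. vanish_at g Z (coeff q l)"
    using assms(1) q v unfolding transcendental_over_def by simp
  then show "dirderiv P (g z) v = 0"
    using dirderiv_poly_vanishing_coeffs[OF assms(2,3) q(1)] q(2) by simp
qed

text \<open>
  A relation \<open>p\<close> of minimal degree for the coordinate \<open>i\<close> is separable in characteristic zero. Where its
  leading coefficient and its derivative do not vanish, the relation \<open>p\<close> forces the component \<open>v i\<close>, and every
  other relation is a consequence of \<open>p\<close> by division with remainder. This is the unique extension of
  derivations to a separable algebraic extension, done at a point.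
\<close>

lemma tangent_at_algebraic:
  fixes g :: "'z \<Rightarrow> 'i::linorder \<Rightarrow> 'k::field_char_0"
  assumes prime: "\<forall>P Q. vanish_at g Z (P * Q) \<longrightarrow> vanish_at g Z P \<or> vanish_at g Z Q"
    and alg: "\<not> transcendental_over g Z J i" and iJ: "i \<notin> J"
  obtains h where "\<not> vanish_at g Z h"
    and "\<And>z v. z \<in> Z \<Longrightarrow> mpol_eval (g z) h \<noteq> 0 \<Longrightarrow> tangent_at g Z J z v \<Longrightarrow>
           \<exists>c. tangent_at g Z (insert i J) z (v(i := c))"
    and "\<And>z v. z \<in> Z \<Longrightarrow> mpol_eval (g z) h \<noteq> 0 \<Longrightarrow> tangent_at g Z (insert i J) z v \<Longrightarrow>
           (\<forall>j\<in>J. v j = 0) \<Longrightarrow> v i = 0"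
proof -
  let ?x = "mvar i :: ('i, 'k) mpol"
  define rel where "rel q \<longleftrightarrow> (\<forall>l. coeff q l \<in> polys_in J) \<and> vanish_at g Z (poly q ?x) \<and> \<not> (\<forall>l. vanish_at g Z (coeff q l))" for q
  obtain p where p: "rel p" and min: "\<And>q. degree q < degree p \<Longrightarrow> \<not> rel q"
  proof -
    have "\<exists>q. rel q" using alg by (auto simp: rel_def transcendental_over_def)
    then show ?thesis using that[of "arg_min degree rel"] arg_min_nat_lemma[of rel _ degree]
      by (meson not_le)
  qed
  \<comment> \<open>Minimality makes the leading coefficient and the derivative of the relation nonzero on \<open>Z\<close>.\<close>
  have pc: "coeff p l \<in> polys_in J" for l using p by (simp add: rel_def)
  have pv: "vanish_at g Z (poly p ?x)" using p by (simp add: rel_def)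
  have pos: "degree p > 0"
  proof (rule ccontr)
    assume "\<not> degree p > 0"
    then obtain c where "p = [:c:]" by (metis degree_eq_zeroE gr0I)
    then show False using p by (auto simp: rel_def coeff_pCons vanish_at_def split: nat.splits)
  qed
  define c where "c = lead_coeff p"
  have cJ: "c \<in> polys_in J" by (simp add: c_def pc)
  have cv: "\<not> vanish_at g Z c"
  proof
    assume v: "vanish_at g Z c"
    let ?q = "p - monom c (degree p)"
    have "degree ?q \<le> degree p" by (intro degree_diff_le degree_monom_le) auto
    moreover have "coeff ?q (degree p) = 0" by (simp add: c_def)
    ultimately have d: "?q = 0 \<or> degree ?q < degree p" using eq_zero_or_degree_less by blast
    have k: "vanish_at g Z (coeff p l)" if "vanish_at g Z (coeff ?q l)" for l
      using that v by (auto simp: vanish_at_def split: if_splits)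
    have "rel ?q"
      unfolding rel_def
    proof (intro conjI)
      show "\<forall>l. coeff ?q l \<in> polys_in J" by (auto intro: polys_in_diff pc cJ)
      show "vanish_at g Z (poly ?q ?x)" using pv v by (simp add: vanish_at_def poly_monom)
      show "\<not> (\<forall>l. vanish_at g Z (coeff ?q l))" using p k unfolding rel_def by blast
    qed
    moreover have "\<not> rel 0" by (simp add: rel_def vanish_at_def)
    then have "?q \<noteq> 0" using \<open>rel ?q\<close> by metis
    ultimately show False using d min by blast
  qed
  define D where "D = poly (pderiv p) ?x"
  have en: "mpol_eval a (of_nat n) = (of_nat n :: 'k)" for a :: "'i \<Rightarrow> 'k" and n
    by (induction n) auto
  have ofnat: "of_nat n \<in> polys_in J" for n :: nat
    by (induction n) (auto intro: polys_in_0 polys_in_1 polys_in.add)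
  have Dv: "\<not> vanish_at g Z D"
  proof
    assume v: "vanish_at g Z D"
    have "degree (pderiv p) \<le> degree p - 1" 
      by (intro degree_le) (auto simp: coeff_pderiv intro!: mult_not_zero coeff_eq_0)
    then have "\<not> rel (pderiv p)" using pos min by auto
    moreover have "\<forall>l. coeff (pderiv p) l \<in> polys_in J"
      unfolding coeff_pderiv by (intro allI polys_in.mult pc ofnat)
    ultimately have "vanish_at g Z (coeff (pderiv p) (degree p - 1))" using v by (auto simp: rel_def D_def)
    then have "vanish_at g Z (of_nat (degree p) * c)"
      using pos by (simp add: coeff_pderiv c_def)
    then show False using cv pos by (auto simp: vanish_at_def en)
  qed
  show ?thesis
  proof (rule that[of "c * D"])
    show "\<not> vanish_at g Z (c * D)" using prime[rule_format, of c D] cv Dv by blast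
  next
    fix z v assume z: "z \<in> Z" and h: "mpol_eval (g z) (c * D) \<noteq> 0" and t: "tangent_at g Z (insert i J) z v"
      and v0: "\<forall>j\<in>J. v j = 0"
    have "dirderiv (coeff p l) (g z) v = 0" for l
      using dirderiv_polys_in_cong[OF pc[of l], of v "\<lambda>_. 0"] v0 by (simp add: dirderiv_zero_dir)
    then have "dirderiv (poly p ?x) (g z) v = mpol_eval (g z) D * v i"
      by (simp add: dirderiv_poly coeff_map_poly_zero D_def)
    moreover have "poly p ?x \<in> polys_in (insert i J)"
      by (rule poly_polys_in) (auto intro: polys_in_mono[OF pc] polys_in.var)
    then have "dirderiv (poly p ?x) (g z) v = 0" using t pv by (auto simp: tangent_at_def)
    ultimately show "v i = 0" using h by auto
  next
    fix z v assume z: "z \<in> Z" and h: "mpol_eval (g z) (c * D) \<noteq> 0" and t: "tangent_at g Z J z v"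
    \<comment> \<open>The only value for which the derivative of the relation \<open>p\<close> is zero.\<close>
    define b where "b = - poly (map_poly (\<lambda>c. dirderiv c (g z) v) p) (g z i) / mpol_eval (g z) D"
    define w where "w = v(i := b)"
    have cong: "dirderiv P (g z) w = dirderiv P (g z) v" if "P \<in> polys_in J" for P
      by (rule dirderiv_polys_in_cong[OF that]) (use iJ in \<open>auto simp: w_def\<close>)
    have tw: "tangent_at g Z J z w" using t cong by (auto simp: tangent_at_def)
    have "map_poly (\<lambda>c. dirderiv c (g z) w) p = map_poly (\<lambda>c. dirderiv c (g z) v) p"
      by (rule poly_eqI) (simp add: coeff_map_poly cong pc)
    then have dp: "dirderiv (poly p ?x) (g z) w = 0"
      using h by (simp add: dirderiv_poly b_def w_def D_def)
    have step: "dirderiv (poly q ?x) (g z) w = 0"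
      if "\<forall>l. coeff q l \<in> polys_in J" "vanish_at g Z (poly q ?x)" for q
      using that
    proof (induction "degree q" arbitrary: q rule: less_induct)
      case less
      show ?case
      proof (cases "\<forall>l. vanish_at g Z (coeff q l)")
        case True
        then show ?thesis using dirderiv_poly_vanishing_coeffs[OF tw z] less.prems by blast
      next
        case False
        then have "rel q" using less.prems by (auto simp: rel_def)
        then have deg: "degree p \<le> degree q" using min not_le by blast
        define e where "e = lead_coeff q"
        \<comment> \<open>One step of division by \<open>p\<close>; the factor \<open>c\<close> is nonzero at \<open>z\<close>.\<close>
        define q2 where "q2 = smult c q - monom e (degree q - degree p) * p"
        have le: "degree q2 \<le> degree q" unfolding q2_def
        proof (rule degree_diff_le)
          show "degree (smult c q) \<le> degree q" by (rule degree_smult_le)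
          have "degree (monom e (degree q - degree p) * p) \<le> degree (monom e (degree q - degree p)) + degree p"
            by (rule degree_mult_le)
          also have "\<dots> \<le> degree q" using deg degree_monom_le[of e "degree q - degree p"] by linarith
          finally show "degree (monom e (degree q - degree p) * p) \<le> degree q" .
        qed
        moreover have "coeff q2 (degree q) = 0"
          unfolding q2_def coeff_diff coeff_smult coeff_monom_mult
          using deg by (simp add: c_def e_def)
        ultimately have d: "q2 = 0 \<or> degree q2 < degree q" using eq_zero_or_degree_less by blast
        have ev: "poly q2 ?x = c * poly q ?x - e * ?x ^ (degree q - degree p) * poly p ?x"
          by (simp add: q2_def poly_monom)
        have eJ: "e \<in> polys_in J" using less.prems by (simp add: e_def)
        have "\<forall>l. coeff q2 l \<in> polys_in J"
          using less.prems by (auto simp: q2_def coeff_monom_mult intro!: polys_in_diff polys_in.mult cJ eJ pc polys_in_0)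
        moreover have "vanish_at g Z (poly q2 ?x)"
          using less.prems(2) pv by (simp add: ev vanish_at_def)
        ultimately have "dirderiv (poly q2 ?x) (g z) w = 0" using d less.hyps by auto
        then have "mpol_eval (g z) c * dirderiv (poly q ?x) (g z) w = 0"
          using less.prems(2) pv z by (simp add: ev dp vanish_at_def)
        then show ?thesis using h by auto
      qed
    qed
    have "tangent_at g Z (insert i J) z w" unfolding tangent_at_def
    proof (intro ballI impI)
      fix P assume "P \<in> polys_in (insert i J)" and v: "vanish_at g Z P"
      then obtain q where q: "\<forall>l. coeff q l \<in> polys_in J" "P = poly q (mvar i)"
        using polys_in_insert[of P i J] by blast
      then show "dirderiv P (g z) w = 0" using step v by blast
    qed
    then show "\<exists>c. tangent_at g Z (insert i J) z (v(i := c))" unfolding w_def by blast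
  qed
qed

text \<open>
  The two extension steps are iterated along the coordinates: a coordinate that is transcendental over the
  preceding ones adds a free component, an algebraic one adds none.
\<close>

lemma tangent_tower:
  fixes g :: "'z \<Rightarrow> nat \<Rightarrow> 'k::field_char_0"
  assumes prime: "\<forall>P Q. vanish_at g Z (P * Q) \<longrightarrow> vanish_at g Z P \<or> vanish_at g Z Q"
    and ne: "Z \<noteq> {}"
  defines "J N \<equiv> {i. i < N \<and> transcendental_over g Z {..<i} i}"
  shows "\<exists>h. \<not> vanish_at g Z h \<and> (\<forall>z\<in>Z. mpol_eval (g z) h \<noteq> 0 \<longrightarrow>
      (\<forall>c. \<exists>v. tangent_at g Z {..<N} z v \<and> (\<forall>j\<in>J N. v j = c j)) \<and>
      (\<forall>v. tangent_at g Z {..<N} z v \<longrightarrow> (\<forall>j\<in>J N. v j = 0) \<longrightarrow> (\<forall>j<N. v j = 0)))"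
proof (induction N)
  case 0
  have z0: "dirderiv P a v = 0" if "P \<in> polys_in {}" for P :: "(nat, 'k) mpol" and a v
    using dirderiv_polys_in_cong[OF that, of v "\<lambda>_. 0" a] by (simp add: dirderiv_zero_dir)
  show ?case
  proof (intro exI[of _ 1] conjI ballI impI allI)
    show "\<not> vanish_at g Z 1" using ne by (auto simp: vanish_at_def)
  qed (auto simp: z0 tangent_at_def J_def)
next
  case (Suc N)
  then obtain h where h: "\<not> vanish_at g Z h"
    and ex: "\<And>z c. z \<in> Z \<Longrightarrow> mpol_eval (g z) h \<noteq> 0 \<Longrightarrow> \<exists>v. tangent_at g Z {..<N} z v \<and> (\<forall>j\<in>J N. v j = c j)"
    and un: "\<And>z v. z \<in> Z \<Longrightarrow> mpol_eval (g z) h \<noteq> 0 \<Longrightarrow> tangent_at g Z {..<N} z v \<Longrightarrow> (\<forall>j\<in>J N. v j = 0) \<Longrightarrow> (\<forall>j<N. v j = 0)"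
    by blast
  have ins: "{..<Suc N} = insert N {..<N}" by auto
  have restr: "tangent_at g Z {..<N} z v" if "tangent_at g Z {..<Suc N} z v" for z v
    using that polys_in_mono[of _ "{..<N}" "{..<Suc N}"] by (auto simp: tangent_at_def)
  show ?case
  proof (cases "transcendental_over g Z {..<N} N")
    case True
    then have JS: "J (Suc N) = insert N (J N)" by (auto simp: J_def less_Suc_eq)
    show ?thesis
    proof (intro exI[of _ h] conjI h ballI impI allI)
      fix z c assume z: "z \<in> Z" "mpol_eval (g z) h \<noteq> 0"
      obtain v where v: "tangent_at g Z {..<N} z v" "\<forall>j\<in>J N. v j = c j" using ex[OF z] by blast
      let ?w = "v(N := c N)"
      have "dirderiv P (g z) ?w = dirderiv P (g z) v" if "P \<in> polys_in {..<N}" for P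
        by (rule dirderiv_polys_in_cong[OF that]) auto
      then have "tangent_at g Z {..<N} z ?w" using v(1) by (auto simp: tangent_at_def)
      then have "tangent_at g Z {..<Suc N} z ?w"
        unfolding ins using tangent_at_transcendental[OF True] z by blast
      then show "\<exists>v. tangent_at g Z {..<Suc N} z v \<and> (\<forall>j\<in>J (Suc N). v j = c j)"
        using v(2) by (intro exI[of _ ?w]) (auto simp: JS J_def)
    next
      fix z v j assume z: "z \<in> Z" "mpol_eval (g z) h \<noteq> 0" and t: "tangent_at g Z {..<Suc N} z v"
        and v0: "\<forall>j\<in>J (Suc N). v j = 0" and j: "j < Suc N"
      have "\<forall>j<N. v j = 0" using un[OF z restr[OF t]] v0 JS by auto
      then show "v j = 0" using j v0 JS by (auto simp: less_Suc_eq)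
    qed
  next
    case False
    then have JS: "J (Suc N) = J N" by (auto simp: J_def less_Suc_eq)
    obtain h2 where h2: "\<not> vanish_at g Z h2"
      and ex2: "\<And>z v. z \<in> Z \<Longrightarrow> mpol_eval (g z) h2 \<noteq> 0 \<Longrightarrow> tangent_at g Z {..<N} z v \<Longrightarrow>
             \<exists>c. tangent_at g Z (insert N {..<N}) z (v(N := c))"
      and un2: "\<And>z v. z \<in> Z \<Longrightarrow> mpol_eval (g z) h2 \<noteq> 0 \<Longrightarrow> tangent_at g Z (insert N {..<N}) z v \<Longrightarrow>
             (\<forall>j\<in>{..<N}. v j = 0) \<Longrightarrow> v N = 0"
      by (rule tangent_at_algebraic[OF prime False]) auto
    show ?thesis
    proof (intro exI[of _ "h * h2"] conjI ballI impI allI)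
      show "\<not> vanish_at g Z (h * h2)" using prime[rule_format, of h h2] h h2 by blast
    next
      fix z c assume z: "z \<in> Z" "mpol_eval (g z) (h * h2) \<noteq> 0"
      then have z': "mpol_eval (g z) h \<noteq> 0" "mpol_eval (g z) h2 \<noteq> 0" by auto
      obtain v where v: "tangent_at g Z {..<N} z v" "\<forall>j\<in>J N. v j = c j" using ex[OF z(1) z'(1)] by blast
      obtain b where "tangent_at g Z {..<Suc N} z (v(N := b))" unfolding ins using ex2[OF z(1) z'(2) v(1)] by blast
      then show "\<exists>v. tangent_at g Z {..<Suc N} z v \<and> (\<forall>j\<in>J (Suc N). v j = c j)"
        using v(2) False by (intro exI[of _ "v(N := b)"]) (auto simp: JS J_def)
    next
      fix z v j assume z: "z \<in> Z" "mpol_eval (g z) (h * h2) \<noteq> 0" and t: "tangent_at g Z {..<Suc N} z v"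
        and v0: "\<forall>j\<in>J (Suc N). v j = 0" and j: "j < Suc N"
      then have z': "mpol_eval (g z) h \<noteq> 0" "mpol_eval (g z) h2 \<noteq> 0" by auto
      have 0: "\<forall>j<N. v j = 0" using un[OF z(1) z'(1) restr[OF t]] v0 JS by auto
      then have "v N = 0" using un2[OF z(1) z'(2), of v] t by (auto simp: ins)
      then show "v j = 0" using j 0 by (auto simp: less_Suc_eq)
    qed
  qed
qed

text \<open>
  In a relation between transcendental coordinates, the coefficients with respect to the last one are
  again relations, so that induction makes them zero. The alternative \<open>vanish_at g Z 1\<close> covers the empty set \<open>Z\<close>.
\<close>

lemma transcendental_independent:
  fixes Z :: "'z set" and g :: "'z \<Rightarrow> nat \<Rightarrow> 'k::field_char_0"
  defines "J N \<equiv> {i. i < N \<and> transcendental_over g Z {..<i} i}"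
  shows "\<exists>\<sigma>. (\<forall>l<card (J N). \<sigma> l < N) \<and>
     (\<forall>P\<in>polys_in {..<card (J N)}. vanish_at g Z (subst (\<lambda>l. mvar (\<sigma> l)) P) \<longrightarrow> vanish_at g Z 1 \<or> P = 0)"
proof (induction N)
  case 0
  have "vanish_at g Z 1 \<or> P = 0" if P: "P \<in> polys_in {}" and v: "vanish_at g Z (subst s P)" for P :: "(nat, 'k) mpol" and s
  proof -
    obtain c where "P = mconst c" using polys_in_empty[OF P] by blast
    then show ?thesis using v by (cases "Z = {}") (auto simp: vanish_at_def)
  qed
  then show ?case by (simp add: J_def)
next
  case (Suc N)
  from Suc.IH obtain \<sigma> where s1: "\<forall>l<card (J N). \<sigma> l < N"
    and s2: "\<And>P. P\<in>polys_in {..<card (J N)} \<Longrightarrow> vanish_at g Z (subst (\<lambda>l. mvar (\<sigma> l)) P) \<Longrightarrow> vanish_at g Z 1 \<or> P = 0"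
    using that by metis
  show ?case
  proof (cases "transcendental_over g Z {..<N} N")
    case False
    then have "J (Suc N) = J N" by (auto simp: J_def less_Suc_eq)
    then show ?thesis
    proof (simp only:, intro exI[of _ \<sigma>] conjI ballI impI allI)
      fix l assume "l < card (J N)" then show "\<sigma> l < Suc N" using s1 by (metis less_SucI)
    next
      fix P :: "(nat, 'k) mpol" assume "P \<in> polys_in {..<card (J N)}" "vanish_at g Z (subst (\<lambda>l. mvar (\<sigma> l)) P)"
      then show "vanish_at g Z 1 \<or> P = 0" by (rule s2)
    qed
  next
    case True
    then have JS: "J (Suc N) = insert N (J N)" by (auto simp: J_def less_Suc_eq)
    have "finite (J N)" "N \<notin> J N" by (auto simp: J_def)
    then have c: "card (J (Suc N)) = Suc (card (J N))" by (simp add: JS)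
    let ?d = "card (J N)"
    let ?s = "\<sigma>(?d := N)"
    show ?thesis
    proof (intro exI[of _ ?s] conjI allI impI ballI)
      fix l assume "l < card (J (Suc N))" then show "?s l < Suc N" using s1 unfolding c by (cases "l = ?d") (simp_all add: less_Suc_eq)
    next
      fix P :: "(nat, 'k) mpol" assume P: "P \<in> polys_in {..<card (J (Suc N))}" and v: "vanish_at g Z (subst (\<lambda>l. mvar (?s l)) P)"
      have "{..<card (J (Suc N))} = insert ?d {..<?d}" unfolding c by auto
      then obtain q where q: "\<forall>l. coeff q l \<in> polys_in {..<?d}" "P = poly q (mvar ?d)"
        using polys_in_insert[of P ?d "{..<?d}"] P by metis
      let ?q = "map_poly (subst (\<lambda>l. mvar (?s l))) q"
      have sub: "subst (\<lambda>l. mvar (?s l)) Q = subst (\<lambda>l. mvar (\<sigma> l)) Q" if "Q \<in> polys_in {..<?d}" for Q :: "(nat,'k) mpol"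
        using that by (induction rule: polys_in.induct) simp_all
      have in_N: "subst (\<lambda>l. mvar (?s l)) Q \<in> polys_in {..<N}" if "Q \<in> polys_in {..<?d}" for Q :: "(nat,'k) mpol"
        by (rule polys_in_subst[OF that]) (use s1 in \<open>auto intro: polys_in.var\<close>)
      have "subst (\<lambda>l. mvar (?s l)) P = poly ?q (mvar N)" by (simp add: q subst_poly)
      moreover have "\<forall>l. coeff ?q l \<in> polys_in {..<N}"
        using q(1) in_N by (simp add: coeff_map_poly)
      ultimately have vq: "vanish_at g Z (coeff ?q l)" for l
        using True v unfolding transcendental_over_def by simp
      have c0: "vanish_at g Z 1 \<or> coeff q l = 0" for l
      proof (rule s2)
        show "coeff q l \<in> polys_in {..<?d}" using q(1) by simp
        have "vanish_at g Z (subst (\<lambda>l. mvar (?s l)) (coeff q l))"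
          using vq[of l] by (simp add: coeff_map_poly)
        then show "vanish_at g Z (subst (\<lambda>l. mvar (\<sigma> l)) (coeff q l))"
          using q(1) by (simp only: sub)
      qed
      show "vanish_at g Z 1 \<or> P = 0"
      proof (cases "vanish_at g Z (1 :: (nat, 'k) mpol)")
        case False
        then have "q = 0" using c0 by (intro poly_eqI) simp
        then show ?thesis using q(2) by simp
      qed simp
    qed
  qed
qed

section \<open>Dimension and tangent spaces\<close>

abbreviation vanish :: "('k::comm_ring_1 ^ 'n) set \<Rightarrow> ('n, 'k) mpol \<Rightarrow> bool" where
  "vanish \<equiv> vanish_at ($)"

text \<open>
  Irreducibility without closedness: the vanishing ideal is prime. It applies to orbits, which need not
  be closed, and the dimension and the tangent spaces depend on the vanishing ideal only.
\<close>

definition prime_set :: "('k::comm_ring_1 ^ 'n) set \<Rightarrow> bool" where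
  "prime_set Z \<longleftrightarrow> Z \<noteq> {} \<and> (\<forall>P Q. vanish Z (P * Q) \<longrightarrow> vanish Z P \<or> vanish Z Q)"

abbreviation dval :: "('n, 'k::comm_ring_1) mpol \<Rightarrow> 'k ^ 'n \<Rightarrow> 'k ^ 'n \<Rightarrow> 'k" where
  "dval P x v \<equiv> dirderiv P (($) x) (($) v)"

lemma tangent_space_eq:
  "tangent_space (Z :: ('k::field ^ 'n::finite) set) p = {v. \<forall>P. vanish Z P \<longrightarrow> dval P p v = 0}"
  by (simp add: tangent_space_def vanish_at_def sum_mpol_deriv_eq_dirderiv)

lemma dirderiv_vec_add: "dirderiv P a (($) (v + w)) = dirderiv P a (($) v) + dirderiv P a (($) w)"
proof -
  have "($) (v + w) = (\<lambda>i. v $ i + w $ i)" by (simp add: fun_eq_iff)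
  then show ?thesis by (simp only: dirderiv_add_dir)
qed

lemma dirderiv_vec_scale: "dirderiv P a (($) (c *s v)) = c * dirderiv P a (($) v)"
proof -
  have "($) (c *s v) = (\<lambda>i. c * v $ i)" by (simp add: fun_eq_iff)
  then show ?thesis by (simp only: dirderiv_scale_dir)
qed

lemma dirderiv_vec_0: "dirderiv P a (($) (0 :: 'k::comm_ring_1 ^ 'n::finite)) = 0"
proof -
  have "($) (0 :: 'k ^ 'n) = (\<lambda>i. 0)" by (simp add: fun_eq_iff)
  then show ?thesis by (simp only: dirderiv_zero_dir)
qed

lemma subspace_tangent_space: "vec.subspace (tangent_space (Z :: ('k::field ^ 'n::finite) set) p)"
  by (rule vec.subspaceI) (auto simp: tangent_space_eq dirderiv_vec_0 dirderiv_vec_add dirderiv_vec_scale)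

lemma tangent_space_mono: "A \<subseteq> B \<Longrightarrow> tangent_space A p \<subseteq> tangent_space (B :: ('k::field ^ 'n::finite) set) p"
  by (auto simp: tangent_space_eq vanish_at_def)

lemma alg_independent_iff:
  "alg_independent Z r f \<longleftrightarrow> (\<forall>P\<in>polys_in {..<r}. vanish_at (\<lambda>x i. f i x) Z P \<longrightarrow> P = 0)"
  unfolding alg_independent_def vanish_at_def using vars_polys_in polys_in_vars by blast

text \<open>
  The \<open>w j\<close> are a basis of \<open>T\<close> dual to the coordinates \<open>l j\<close>.
\<close>

lemma vec_dim_by_coordinates:
  fixes w :: "nat \<Rightarrow> 'k::field ^ 'n" and T :: "('k ^ 'n) set"
  assumes "vec.subspace T" "finite J"
    and l_add: "\<And>j v v'. l j (v + v') = l j v + (l j v' :: 'k)"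
    and l_scale: "\<And>j c v. l j (c *s v) = c * l j v"
    and w: "\<And>j. j \<in> J \<Longrightarrow> w j \<in> T" "\<And>i j. i \<in> J \<Longrightarrow> j \<in> J \<Longrightarrow> l i (w j) = (if i = j then 1 else 0)"
    and inj: "\<And>v. v \<in> T \<Longrightarrow> (\<forall>j\<in>J. l j v = 0) \<Longrightarrow> v = 0"
  shows "vec.dim T = card J"
proof -
  have l0: "l j 0 = 0" for j using l_scale[of j 0 0] by simp
  have l_diff: "l j (v - v') = l j v - l j v'" for j v v'
    using l_add[of j "v - v'" v'] by simp
  have l_sum: "l j (sum f A) = (\<Sum>x\<in>A. l j (f x))" for j and f :: "nat \<Rightarrow> _" and A
    by (induction A rule: infinite_finite_induct) (auto simp: l0 l_add)
  have lw: "l i (\<Sum>j\<in>J. c j *s w j) = c i" if "i \<in> J" for c i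
  proof -
    have "l i (\<Sum>j\<in>J. c j *s w j) = (\<Sum>j\<in>J. c j * l i (w j))" by (simp add: l_sum l_scale)
    also have "\<dots> = (\<Sum>j\<in>J. if j = i then c j else 0)" using that w(2) by (intro sum.cong) auto
    also have "\<dots> = c i" using that assms(2) by simp
    finally show ?thesis .
  qed
  have inj_w: "inj_on w J"
    by (rule inj_onI) (metis w(2) zero_neq_one)
  have "vec.independent (w ` J)"
  proof (rule vec.independent_if_scalars_zero)
    show "finite (w ` J)" using assms(2) by simp
    fix f x assume s: "(\<Sum>x\<in>w ` J. f x *s x) = 0" and x: "x \<in> w ` J"
    then obtain i where i: "i \<in> J" "x = w i" by blast
    have "(\<Sum>j\<in>J. f (w j) *s w j) = 0" using s by (simp add: sum.reindex[OF inj_w])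
    then show "f x = 0" using lw[OF i(1), of "\<lambda>j. f (w j)"] i(2) l0 by simp
  qed
  moreover have "T \<subseteq> vec.span (w ` J)"
  proof
    fix v assume v: "v \<in> T"
    let ?s = "\<Sum>j\<in>J. l j v *s w j"
    have sp: "?s \<in> vec.span (w ` J)" by (intro vec.span_sum vec.span_scale vec.span_base) auto
    have "?s \<in> T" using w(1) by (intro vec.subspace_sum assms(1) vec.subspace_scale) auto
    then have "v - ?s \<in> T" using v assms(1) by (simp add: vec.subspace_diff)
    moreover have "\<forall>j\<in>J. l j (v - ?s) = 0" by (simp add: l_diff lw)
    ultimately have "v - ?s = 0" by (rule inj)
    then show "v \<in> vec.span (w ` J)" using sp by simp
  qed
  ultimately show ?thesis
    using w(1) vec.dim_unique[of "w ` J" T "card J"] by (auto simp: card_image[OF inj_w])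
qed

text \<open>
  The tower runs through \<open>F 0, \<dots>, F (r - 1)\<close> and then through the coordinates of the affine space. Since the
  \<open>F i\<close> are independent, they are all among the free coordinates of the tower, and the number \<open>d\<close> of free
  coordinates is the dimension of the general tangent space. Adding the \<open>F i\<close> in front does not change the
  tangent spaces, because it replaces \<open>Z\<close> by the graph of a polynomial map.
\<close>

lemma generic_tangent_dim:
  fixes Z :: "('k::field_char_0 ^ 'n::finite) set" and F :: "nat \<Rightarrow> ('n, 'k) mpol"
  assumes prime: "prime_set Z" and ind: "alg_independent Z r (\<lambda>i x. val x (F i))"
  obtains d h G where "r \<le> d" "\<not> vanish Z h" "alg_independent Z d (\<lambda>i x. val x (G i))"
    "\<And>p. p \<in> Z \<Longrightarrow> val p h \<noteq> 0 \<Longrightarrow> vec.dim (tangent_space Z p) = d"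
proof -
  define n where "n = CARD('n)"
  obtain e :: "nat \<Rightarrow> 'n" where e: "bij_betw e {..<n} UNIV"
    using ex_bij_betw_nat_finite[of "UNIV :: 'n set"] by (auto simp: n_def atLeast0LessThan)
  define e' where "e' = the_inv_into {..<n} e"
  have e': "e' k < n" "e (e' k) = k" for k
    using e by (auto simp: e'_def bij_betw_def the_inv_into_into f_the_inv_into_f intro: the_inv_into_into[of e "{..<n}" k "{..<n}", simplified])
  have ee': "e' (e j) = j" if "j < n" for j
    using e that by (auto simp: e'_def bij_betw_def the_inv_into_f_f)
  define N where "N = r + n"
  define s where "s i = (if i < r then F i else mvar (e (i - r)))" for i
  define x where "x k = r + e' k" for k
  have sx: "s (x k) = mvar k" "x k < N" for k by (simp_all add: s_def x_def e' N_def)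
  define g where "g p i = val p (s i)" for p i
  have gx: "g p (x k) = p $ k" for p k by (simp add: g_def sx)
  have van: "vanish_at g Z P \<longleftrightarrow> vanish Z (subst s P)" for P
    by (simp add: vanish_at_def eval_subst g_def[abs_def])
  have ne: "Z \<noteq> {}" using prime by (simp add: prime_set_def)
  have pr: "\<forall>P Q. vanish_at g Z (P * Q) \<longrightarrow> vanish_at g Z P \<or> vanish_at g Z Q"
    using prime by (simp add: van prime_set_def)
  define J where "J = {i. i < N \<and> transcendental_over g Z {..<i} i}"
  from tangent_tower[of g Z N, OF pr ne, folded J_def] obtain h where h: "\<not> vanish_at g Z h"
    and hh: "\<forall>z\<in>Z. mpol_eval (g z) h \<noteq> 0 \<longrightarrow>
      (\<forall>c. \<exists>v. tangent_at g Z {..<N} z v \<and> (\<forall>j\<in>J. v j = c j)) \<and>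
      (\<forall>v. tangent_at g Z {..<N} z v \<longrightarrow> (\<forall>j\<in>J. v j = 0) \<longrightarrow> (\<forall>j<N. v j = 0))"
    by (elim exE conjE) (rule that)
  have ex: "\<exists>v. tangent_at g Z {..<N} z v \<and> (\<forall>j\<in>J. v j = c j)"
    if "z \<in> Z" "mpol_eval (g z) h \<noteq> 0" for z c
    using hh that by simp
  have un: "\<forall>j<N. v j = 0"
    if "z \<in> Z" "mpol_eval (g z) h \<noteq> 0" "tangent_at g Z {..<N} z v" "\<forall>j\<in>J. v j = 0" for z v
    using hh[rule_format, OF that(1,2)] that(3,4) by simp
  from transcendental_independent[of N g Z, folded J_def] obtain \<sigma> where
    \<sigma>: "\<forall>P\<in>polys_in {..<card J}. vanish_at g Z (subst (\<lambda>l. mvar (\<sigma> l)) P) \<longrightarrow> vanish_at g Z 1 \<or> P = 0"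
    by (elim exE conjE) (rule that)
  have n1: "\<not> vanish_at g Z 1" using ne by (auto simp: vanish_at_def)
  \<comment> \<open>A relation between the independent \<open>F i\<close> is the zero polynomial, and so are its coefficients.\<close>
  have trans: "transcendental_over g Z {..<i} i" if "i < r" for i
    unfolding transcendental_over_def
  proof (intro allI impI)
    fix q l assume q: "\<forall>l. coeff q l \<in> polys_in {..<i}" and v: "vanish_at g Z (poly q (mvar i))"
    have "poly q (mvar i) \<in> polys_in {..<r}"
      by (rule poly_polys_in) (use q that in \<open>auto intro: polys_in.var polys_in_mono[of _ "{..<i}"]\<close>)
    moreover have "vanish_at (\<lambda>x i. val x (F i)) Z (poly q (mvar i))"
      unfolding vanish_at_def
    proof
      fix z assume "z \<in> Z"
      then have "mpol_eval (g z) (poly q (mvar i)) = 0" using v by (simp add: vanish_at_def)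
      moreover have "mpol_eval (g z) (poly q (mvar i)) = mpol_eval (\<lambda>i. val z (F i)) (poly q (mvar i))"
        by (rule eval_polys_in_cong[OF \<open>poly q (mvar i) \<in> polys_in {..<r}\<close>]) (simp add: g_def s_def)
      ultimately show "mpol_eval (\<lambda>i. val z (F i)) (poly q (mvar i)) = 0" by simp
    qed
    ultimately have q0: "poly q (mvar i) = 0" using ind by (simp add: alg_independent_iff)
    have "mpol_eval a (coeff q l) = 0" for a
    proof -
      have "poly (map_poly (mpol_eval a) q) t = poly 0 t" for t
      proof -
        have "mpol_eval (a(i := t)) (coeff q l') = mpol_eval a (coeff q l')" for l'
          by (rule eval_polys_in_cong[OF q[rule_format]]) simp
        then have "map_poly (mpol_eval (a(i := t))) q = map_poly (mpol_eval a) q"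
          by (intro poly_eqI) (simp add: coeff_map_poly)
        then show ?thesis using arg_cong[OF q0, of "mpol_eval (a(i := t))"] by (simp add: eval_poly)
      qed
      then have "map_poly (mpol_eval a) q = 0" by (rule poly_eqI_infinite)
      then show ?thesis using coeff_map_poly[of "mpol_eval a" q l] by simp
    qed
    then show "vanish_at g Z (coeff q l)" by (simp add: vanish_at_def)
  qed
  have finJ: "finite J" by (simp add: J_def)
  have "{..<r} \<subseteq> J" using trans by (auto simp: J_def N_def)
  then have "r \<le> card J" using card_mono[OF finJ, of "{..<r}"] by simp
  moreover have "\<not> vanish Z (subst s h)" using h van by simp
  moreover have "alg_independent Z (card J) (\<lambda>i x. val x (s (\<sigma> i)))"
    unfolding alg_independent_iff
  proof (intro ballI impI)
    fix P assume P: "P \<in> polys_in {..<card J}" "vanish_at (\<lambda>x i. val x (s (\<sigma> i))) Z P"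
    have "vanish_at g Z (subst (\<lambda>l. mvar (\<sigma> l)) P)" using P(2) by (simp add: vanish_at_def eval_subst g_def)
    then show "P = 0" using \<sigma> P(1) n1 by simp
  qed
  moreover have "vec.dim (tangent_space Z p) = card J" if p: "p \<in> Z" "val p (subst s h) \<noteq> 0" for p
  proof -
    have hp: "mpol_eval (g p) h \<noteq> 0" using p(2) by (simp add: eval_subst g_def[abs_def])
    let ?l = "\<lambda>i w. dval (s i) p w"
    have to_tower: "tangent_at g Z {..<N} p (\<lambda>i. ?l i w)" if w: "w \<in> tangent_space Z p" for w
      unfolding tangent_at_def
    proof (intro ballI impI)
      fix P assume "vanish_at g Z P"
      then have "dval (subst s P) p w = 0" using w van by (simp add: tangent_space_eq)
      then show "dirderiv P (g p) (\<lambda>i. ?l i w) = 0" by (simp add: dirderiv_subst g_def[abs_def])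
    qed
    have from_tower: "\<exists>w\<in>tangent_space Z p. \<forall>i<N. ?l i w = v i" if v: "tangent_at g Z {..<N} p v" for v
    proof -
      define w where "w = (\<chi> k. v (x k))"
      have wx: "($) w = (\<lambda>k. v (x k))" by (simp add: w_def fun_eq_iff)
      have sub: "subst (\<lambda>k. mvar (x k)) Q \<in> polys_in {..<N}" for Q :: "('n, 'k) mpol"
        by (rule polys_in_subst[OF polys_in_UNIV]) (simp add: polys_in.var sx)
      have dsub: "dirderiv (subst (\<lambda>k. mvar (x k)) Q) (g p) v = dval Q p w" for Q :: "('n, 'k) mpol"
        by (simp add: dirderiv_subst gx wx)
      have esub: "mpol_eval (g z) (subst (\<lambda>k. mvar (x k)) Q) = val z Q" for Q z
        by (simp add: eval_subst gx)
      have "w \<in> tangent_space Z p"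
        unfolding tangent_space_eq
      proof (intro CollectI allI impI)
        fix Q assume Q: "vanish Z Q"
        then have "vanish_at g Z (subst (\<lambda>k. mvar (x k)) Q)" by (simp add: vanish_at_def esub)
        then have "dirderiv (subst (\<lambda>k. mvar (x k)) Q) (g p) v = 0" using v sub by (auto simp: tangent_at_def)
        then show "dval Q p w = 0" by (simp add: dsub)
      qed
      moreover have "?l i w = v i" if "i < N" for i
      proof (cases "i < r")
        case True
        let ?R = "mvar i - subst (\<lambda>k. mvar (x k)) (F i)"
        have "?R \<in> polys_in {..<N}" using sub that by (auto intro: polys_in_diff polys_in.var)
        moreover have "vanish_at g Z ?R" using True by (simp add: vanish_at_def esub) (simp add: g_def s_def)
        ultimately have "dirderiv ?R (g p) v = 0" using v by (auto simp: tangent_at_def)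
        then show ?thesis using True by (simp add: dsub s_def)
      next
        case False
        then have "x (e (i - r)) = i" using that by (simp add: x_def ee' N_def)
        then show ?thesis using False by (simp add: s_def w_def)
      qed
      ultimately show ?thesis by blast
    qed
    have "\<exists>w\<in>tangent_space Z p. \<forall>i\<in>J. ?l i w = (if i = j then 1 else 0)" for j
    proof -
      obtain v where v: "tangent_at g Z {..<N} p v" "\<forall>i\<in>J. v i = (if i = j then 1 else 0)"
        using ex[OF p(1) hp, of "\<lambda>i. if i = j then 1 else 0"] by blast
      obtain w where w: "w\<in>tangent_space Z p" "\<forall>i<N. ?l i w = v i" using from_tower[OF v(1)] by blast
      show ?thesis by (rule bexI[OF _ w(1)]) (use w(2) v(2) in \<open>auto simp: J_def\<close>)
    qed
    then obtain w where w: "\<And>j. w j \<in> tangent_space Z p" "\<And>i j. i \<in> J \<Longrightarrow> ?l i (w j) = (if i = j then 1 else 0)"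
      by metis
    show ?thesis
    proof (rule vec_dim_by_coordinates[OF subspace_tangent_space finJ, of ?l w])
      fix v assume v: "v \<in> tangent_space Z p" "\<forall>j\<in>J. ?l j v = 0"
      have "\<forall>j<N. ?l j v = 0" using un[OF p(1) hp to_tower[OF v(1)]] v(2) by simp
      then have "?l (x k) v = 0" for k using sx by blast
      then show "v = 0" by (simp add: sx vec_eq_iff)
    qed (auto simp: dirderiv_vec_add dirderiv_vec_scale w)
  qed
  ultimately show ?thesis by (rule that)
qed

lemma alg_independent_0:
  assumes ne: "Z \<noteq> {}"
  shows "alg_independent (Z :: ('k::field ^ 'n) set) 0 f"
  unfolding alg_independent_iff
proof (intro ballI impI)
    fix P :: "(nat, 'k) mpol" assume P: "P \<in> polys_in {..<0}" and v: "vanish_at (\<lambda>x i. f i x) Z P"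
    obtain c where "P = mconst c" using polys_in_empty[of P] P by auto
    then show "P = 0" using v ne by (auto simp: vanish_at_def)
qed

lemma regular_alg_independent:
  assumes "\<forall>i<r. regular_fun Z (f i)" "alg_independent Z r f"
  obtains F where "alg_independent Z r (\<lambda>i x. val x (F i))"
    "\<And>i x. i < r \<Longrightarrow> x \<in> Z \<Longrightarrow> f i x = val x (F i)"
proof -
  obtain F where F: "\<forall>i<r. \<forall>x\<in>Z. f i x = val x (F i)"
    using assms(1) unfolding regular_fun_def by metis
  have "alg_independent Z r (\<lambda>i x. val x (F i))"
    unfolding alg_independent_iff
  proof (intro ballI impI)
    fix P assume P: "P \<in> polys_in {..<r}" "vanish_at (\<lambda>x i. val x (F i)) Z P"
    have "vanish_at (\<lambda>x i. f i x) Z P" unfolding vanish_at_def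
    proof
      fix z assume z: "z \<in> Z"
      have "mpol_eval (\<lambda>i. f i z) P = mpol_eval (\<lambda>i. val z (F i)) P"
        by (rule eval_polys_in_cong[OF P(1)]) (use F z in auto)
      then show "mpol_eval (\<lambda>i. f i z) P = 0" using P(2) z by (simp add: vanish_at_def)
    qed
    then show "P = 0" using P(1) assms(2) by (simp add: alg_independent_iff)
  qed
  then show ?thesis using that F by blast
qed

lemma prime_setD:
  assumes "prime_set Z" "\<not> vanish Z P" "\<not> vanish Z Q"
  shows "\<exists>z\<in>Z. val z P \<noteq> 0 \<and> val z Q \<noteq> 0"
proof -
  have "\<not> vanish Z (P * Q)" using assms unfolding prime_set_def by blast
  then obtain z where "z \<in> Z" "val z P * val z Q \<noteq> 0"
    unfolding vanish_at_def eval_mult by blast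
  then show ?thesis by (intro bexI[of _ z]) auto
qed

text \<open>
  Two families \<open>F\<close> give the same \<open>d\<close> in \<open>generic_tangent_dim\<close>, since two nonempty open sets of an
  irreducible set meet. Hence \<open>d\<close> bounds the size of every independent family, and it is attained: the
  transcendence degree equals the dimension of the general tangent space.
\<close>

lemma generic_dim:
  fixes Z :: "('k::field_char_0 ^ 'n::finite) set"
  assumes prime: "prime_set Z"
  obtains h G where "\<not> vanish Z h"
    "\<And>p. p \<in> Z \<Longrightarrow> val p h \<noteq> 0 \<Longrightarrow> vec.dim (tangent_space Z p) = variety_dim Z"
    "alg_independent Z (variety_dim Z) (\<lambda>i x. val x (G i))"
    "\<And>r F. alg_independent Z r (\<lambda>i x. val x (F i)) \<Longrightarrow> r \<le> variety_dim Z"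
proof -
  have "Z \<noteq> {}" using prime by (simp add: prime_set_def)
  obtain d h G where 1: "\<not> vanish Z h" "alg_independent Z d (\<lambda>i x. val x (G i))"
    "\<And>p. p \<in> Z \<Longrightarrow> val p h \<noteq> 0 \<Longrightarrow> vec.dim (tangent_space Z p) = d"
    using generic_tangent_dim[OF prime, of 0] alg_independent_0[OF \<open>Z \<noteq> {}\<close>] by metis
  have bound: "r \<le> d" if ind: "alg_independent Z r (\<lambda>i x. val x (F i))" for r F
  proof -
    obtain d' h' where 2: "r \<le> d'" "\<not> vanish Z h'"
      "\<And>p. p \<in> Z \<Longrightarrow> val p h' \<noteq> 0 \<Longrightarrow> vec.dim (tangent_space Z p) = d'"
      using generic_tangent_dim[OF prime ind] by metis
    then have "d = d'" using prime_setD[OF prime 1(1) 2(2)] 1(3) 2(3) by metis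
    then show ?thesis using 2(1) by simp
  qed
  have "variety_dim Z = d" unfolding variety_dim_def
  proof (rule Greatest_equality)
    show "\<exists>f. (\<forall>i<d. regular_fun Z (f i)) \<and> alg_independent Z d f"
      using 1(2) by (intro exI[of _ "\<lambda>i x. val x (G i)"]) (auto simp: regular_fun_def)
  next
    fix r assume "\<exists>f. (\<forall>i<r. regular_fun Z (f i)) \<and> alg_independent Z r f"
    then show "r \<le> d" using regular_alg_independent bound by metis
  qed
  then show ?thesis using that 1 bound by blast
qed

definition grad :: "('n::finite, 'k::field) mpol \<Rightarrow> 'k ^ 'n \<Rightarrow> 'k ^ 'n" where
  "grad P q = (\<chi> i. val q (mpol_deriv i P))"

lemma dirderiv_grad: "dval P q v = (\<Sum>i\<in>UNIV. grad P q $ i * v $ i)"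
  by (simp add: grad_def sum_mpol_deriv_eq_dirderiv)

lemma eval_det:
  fixes A :: "('i, 'k::comm_ring_1) mpol ^ 'n ^ 'n"
  shows "mpol_eval a (det A) = det (\<chi> i j. mpol_eval a (A $ i $ j))"
proof -
  have "mpol_eval a (of_nat n) = of_nat n" for n by (induction n) auto
  then have "mpol_eval a (of_int z) = of_int z" for z by (cases z) auto
  then show ?thesis by (simp add: det_def)
qed

lemma alg_independent_le_variety_dim:
  fixes Z :: "('k::field_char_0 ^ 'n::finite) set"
  assumes "prime_set Z" "alg_independent Z r (\<lambda>i x. val x (F i))"
  shows "r \<le> variety_dim Z"
  by (rule generic_dim[OF assms(1)]) (use assms(2) in blast)

lemma generic_point_dim:
  fixes Z :: "('k::field_char_0 ^ 'n::finite) set"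
  assumes "prime_set Z"
  obtains h where "\<not> vanish Z h"
    "\<And>p. p \<in> Z \<Longrightarrow> val p h \<noteq> 0 \<Longrightarrow> vec.dim (tangent_space Z p) = variety_dim Z"
  by (rule generic_dim[OF assms]) (use that in blast)

text \<open>
  Semicontinuity of the rank: gradients of relations that are independent at \<open>p\<close> stay independent at
  the general point, by the nonvanishing of a determinant.
\<close>

lemma variety_dim_le_tangent_dim:
  fixes Z :: "('k::field_char_0 ^ 'n::finite) set"
  assumes prime: "prime_set Z" and p: "p \<in> Z"
  shows "variety_dim Z \<le> vec.dim (tangent_space Z p)"
proof -
  define \<G> where "\<G> = {grad P p | P. vanish Z P}"
  obtain B where B: "B \<subseteq> \<G>" "vec.independent B" "\<G> \<subseteq> vec.span B"
    using vec.maximal_independent_subset[of \<G>] by blast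
  obtain C where C: "B \<subseteq> C" "vec.independent C" "vec.span C = UNIV"
    using vec.extend_basis_superset[OF B(2)] vec.independent_extend_basis[OF B(2)] vec.span_extend_basis[OF B(2)] that
    by metis
  have "card C = CARD('n)"
    using vec.dim_eq_card[of C UNIV] C by (simp add: vec_dim_card card_cart_basis)
  then have "card (UNIV :: 'n set) = card C" "finite C"
    using C(2) vec.finiteI_independent by auto
  then obtain r :: "'n \<Rightarrow> 'k ^ 'n" where r: "bij_betw r UNIV C"
    using finite_same_card_bij[of "UNIV :: 'n set" C] by auto
  have "\<exists>P. vanish Z P \<and> b = grad P p" if "b \<in> B" for b
    using that B(1) by (auto simp: \<G>_def)
  then obtain P where P: "\<And>b. b \<in> B \<Longrightarrow> vanish Z (P b)" "\<And>b. b \<in> B \<Longrightarrow> b = grad (P b) p"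
    by metis
  \<comment> \<open>At \<open>p\<close> the rows of this matrix are the basis \<open>C\<close>; at any point of \<open>Z\<close>, the rows from \<open>B\<close> are gradients of relations.\<close>
  define A :: "('n, 'k) mpol ^ 'n ^ 'n" where
    "A = (\<chi> i j. if r i \<in> B then mpol_deriv j (P (r i)) else mconst (r i $ j))"
  define M where "M q = (\<chi> i j. val q (A $ i $ j))" for q
  have Mv: "(M q *v v) $ i = (if r i \<in> B then dval (P (r i)) q v else (\<Sum>j\<in>UNIV. r i $ j * v $ j))" for q v i
    by (auto simp: matrix_vector_mult_def M_def A_def dirderiv_grad grad_def)
  have Mp: "(M p *v v) $ i = (\<Sum>j\<in>UNIV. r i $ j * v $ j)" for v i
    using P(2)[of "r i"] by (auto simp: Mv dirderiv_grad)
  have "v = 0" if "M p *v v = 0" for v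
  proof -
    have 1: "(\<Sum>j\<in>UNIV. c $ j * v $ j) = 0" if "c \<in> C" for c
    proof -
      obtain i where "c = r i" using r \<open>c \<in> C\<close> by (auto simp: bij_betw_def)
      then show ?thesis using Mp[of v i] \<open>M p *v v = 0\<close> by simp
    qed
    have "(\<Sum>j\<in>UNIV. x $ j * v $ j) = 0" if "x \<in> vec.span C" for x
      using that
    proof (induction rule: vec.span_induct_alt)
      case (step c x y)
      have "(\<Sum>j\<in>UNIV. (c *s x + y) $ j * v $ j) = c * (\<Sum>j\<in>UNIV. x $ j * v $ j) + (\<Sum>j\<in>UNIV. y $ j * v $ j)"
        by (simp add: sum.distrib sum_distrib_left distrib_right mult.assoc)
      then show ?case using step 1 by simp
    qed simp
    then have "(\<Sum>j\<in>UNIV. axis i 1 $ j * v $ j) = 0" for i using C(3) by blast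
    moreover have "(\<Sum>j\<in>UNIV. axis i 1 $ j * v $ j) = v $ i" for i
    proof -
      have "(\<Sum>j\<in>UNIV. axis i 1 $ j * v $ j) = (\<Sum>j\<in>UNIV. if j = i then v $ j else 0)"
        by (rule sum.cong) (auto simp: axis_def)
      then show ?thesis by simp
    qed
    ultimately show ?thesis by (simp add: vec_eq_iff)
  qed
  then have "\<exists>B. B ** M p = mat 1" by (simp add: matrix_left_invertible_ker)
  then obtain A' where "A' ** M p = mat 1" ..
  then have inv: "A' ** M p = mat 1" "M p ** A' = mat 1"
    by (simp_all add: matrix_left_right_inverse[of "M p" A'])
  then have "det (M p) \<noteq> 0" using invertible_det_nz[of "M p"] unfolding invertible_def by blast
  then have "\<not> vanish Z (det A)" using p by (auto simp: vanish_at_def eval_det M_def)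
  moreover obtain h where h: "\<not> vanish Z h"
    "\<And>p. p \<in> Z \<Longrightarrow> val p h \<noteq> 0 \<Longrightarrow> vec.dim (tangent_space Z p) = variety_dim Z"
    using generic_point_dim[OF prime] by blast
  ultimately obtain q where q: "q \<in> Z" "val q (det A) \<noteq> 0" "val q h \<noteq> 0"
    using prime_setD[OF prime, of "det A" h] by blast
  have "det (M q) \<noteq> 0" using q(2) by (simp add: eval_det M_def)
  then have "invertible (M q)" by (simp add: invertible_det_nz)
  then obtain B' where B': "B' ** M q = mat 1" by (auto simp: invertible_def)
  define W where "W = {w :: 'k ^ 'n. \<forall>i. r i \<in> B \<longrightarrow> w $ i = 0}"
  have injq: "inj ((*v) (M q))"
    by (rule inj_on_inverseI[of _ "(*v) B'"]) (simp add: matrix_vector_mul_assoc B')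
  have injA': "inj ((*v) A')"
    by (rule inj_on_inverseI[of _ "(*v) (M p)"]) (simp add: matrix_vector_mul_assoc inv)
  have "(*v) (M q) ` tangent_space Z q \<subseteq> W"
    using P(1) by (auto simp: W_def Mv tangent_space_eq)
  then have "vec.dim ((*v) (M q) ` tangent_space Z q) \<le> vec.dim W" by (rule vec.dim_subset)
  also have "vec.dim ((*v) (M q) ` tangent_space Z q) = vec.dim (tangent_space Z q)"
    by (rule vec.dim_image_eq) (auto intro: inj_on_subset[OF injq])
  also have "vec.dim W = vec.dim ((*v) A' ` W)"
    by (rule vec.dim_image_eq[symmetric]) (auto intro: inj_on_subset[OF injA'])
  also have "\<dots> \<le> vec.dim (tangent_space Z p)"
  proof (rule vec.dim_subset)
    show "(*v) A' ` W \<subseteq> tangent_space Z p"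
    proof
      fix v assume "v \<in> (*v) A' ` W"
      then obtain w where w: "w \<in> W" "v = A' *v w" by blast
      have Mw: "M p *v v = w" using w(2) by (simp add: matrix_vector_mul_assoc inv)
      have 1: "(\<Sum>j\<in>UNIV. b $ j * v $ j) = 0" if "b \<in> B" for b
      proof -
        obtain i where "b = r i" using r \<open>b \<in> B\<close> C(1) unfolding bij_betw_def by blast
        then show ?thesis using Mp[of v i] w(1) that by (simp add: Mw W_def)
      qed
      have 2: "(\<Sum>j\<in>UNIV. x $ j * v $ j) = 0" if "x \<in> vec.span B" for x
        using that
      proof (induction rule: vec.span_induct_alt)
        case (step c x y)
        have "(\<Sum>j\<in>UNIV. (c *s x + y) $ j * v $ j) = c * (\<Sum>j\<in>UNIV. x $ j * v $ j) + (\<Sum>j\<in>UNIV. y $ j * v $ j)"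
          by (simp add: sum.distrib sum_distrib_left distrib_right mult.assoc)
        then show ?case using step 1 by simp
      qed simp
      show "v \<in> tangent_space Z p"
        unfolding tangent_space_eq dirderiv_grad using B(3) 2 by (auto simp: \<G>_def)
    qed
  qed
  finally show ?thesis using h(2)[OF q(1,3)] by simp
qed

text \<open>
  A proper closed subset of an irreducible set has smaller dimension: if \<open>s\<close> vanishes on \<open>W\<close> but not on
  \<open>X\<close>, then a relation on \<open>X\<close> between \<open>s\<close> and a transcendence basis of \<open>W\<close>, not divisible by \<open>s\<close>, restricts to a
  nontrivial relation between the elements of the basis on \<open>W\<close>.
\<close>

lemma vanish_of_equal_dim:
  fixes X W :: "('k::field_char_0 ^ 'n::finite) set"
  assumes X: "prime_set X" and W: "prime_set W" "W \<subseteq> X" "variety_dim W = variety_dim X"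
    and s: "vanish W s"
  shows "vanish X s"
proof (rule ccontr)
  assume ns: "\<not> vanish X s"
  define d where "d = variety_dim X"
  obtain G where G: "alg_independent W d (\<lambda>i x. val x (G i))"
    by (rule generic_dim[OF W(1)]) (use W(3) that d_def in simp)
  define F where "F = G(d := s)"
  let ?e = "\<lambda>x i. val x (F i)"
  have "\<not> alg_independent X (Suc d) (\<lambda>i x. val x (F i))"
    using alg_independent_le_variety_dim[OF X, of "Suc d" F] unfolding d_def by auto
  then obtain P where P: "P \<in> polys_in {..<Suc d}" "vanish_at ?e X P" "P \<noteq> 0"
    by (auto simp: alg_independent_iff)
  define rel where "rel q \<longleftrightarrow> (\<forall>l. coeff q l \<in> polys_in {..<d}) \<and> vanish_at ?e X (poly q (mvar d)) \<and> q \<noteq> 0" for q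
  have "{..<Suc d} = insert d {..<d}" by auto
  then obtain q0 where "\<forall>l. coeff q0 l \<in> polys_in {..<d}" "P = poly q0 (mvar d)"
    using polys_in_insert[of P d "{..<d}"] P(1) by metis
  then have "rel q0" using P by (auto simp: rel_def)
  then obtain q where q: "rel q" and min: "\<And>q'. rel q' \<Longrightarrow> degree q \<le> degree q'"
    using arg_min_nat_lemma[of rel q0 degree] by metis
  have van: "vanish_at ?e X Q \<longleftrightarrow> vanish X (subst F Q)" for Q
    by (simp add: vanish_at_def eval_subst)
  \<comment> \<open>Otherwise the factor \<open>s\<close> could be cancelled, which contradicts minimality.\<close>
  have c0: "coeff q 0 \<noteq> 0"
  proof
    assume "coeff q 0 = 0"
    then obtain q' where q': "q = pCons 0 q'" by (metis coeff_pCons_0 pCons_cases)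
    then have "q' \<noteq> 0" using q by (auto simp: rel_def)
    have "vanish X (s * subst F (poly q' (mvar d)))"
    proof -
      have "vanish_at ?e X (mvar d * poly q' (mvar d))" using q by (simp add: rel_def q')
      then have "vanish X (F d * subst F (poly q' (mvar d)))" unfolding van by simp
      then show ?thesis by (simp only: F_def fun_upd_same)
    qed
    then have "vanish X (subst F (poly q' (mvar d)))" using X ns by (auto simp: prime_set_def)
    moreover have "coeff q' l \<in> polys_in {..<d}" for l
      using q[unfolded rel_def, THEN conjunct1, rule_format, of "Suc l"] by (simp add: q')
    ultimately have "rel q'" using \<open>q' \<noteq> 0\<close> by (simp add: rel_def van)
    then show False using min[of q'] \<open>q' \<noteq> 0\<close> by (simp add: q')
  qed
  have "vanish_at (\<lambda>x i. val x (G i)) W (coeff q 0)"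
    unfolding vanish_at_def
  proof
    fix z assume z: "z \<in> W"
    have "mpol_eval (?e z) (poly q (mvar d)) = 0" using q z W(2) by (auto simp: rel_def vanish_at_def)
    moreover have "?e z d = 0" using s z by (simp add: F_def vanish_at_def)
    ultimately have "mpol_eval (?e z) (coeff q 0) = 0"
      by (simp add: eval_poly poly_0_coeff_0 coeff_map_poly)
    moreover have "mpol_eval (?e z) (coeff q 0) = mpol_eval (\<lambda>i. val z (G i)) (coeff q 0)"
      by (rule eval_polys_in_cong[of _ "{..<d}"]) (use q in \<open>auto simp: rel_def F_def\<close>)
    ultimately show "mpol_eval (\<lambda>i. val z (G i)) (coeff q 0) = 0" by simp
  qed
  then have "coeff q 0 = 0" using G q by (auto simp: alg_independent_iff rel_def)
  then show False using c0 by simp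
qed

lemma affine_variety_prime_set:
  assumes "affine_variety (Z :: ('k::field ^ 'n) set)"
  shows "prime_set Z"
  unfolding prime_set_def
proof (intro conjI allI impI)
  show "Z \<noteq> {}" using assms by (simp add: affine_variety_def)
next
  fix P Q assume PQ: "vanish Z (P * Q)"
  obtain S where S: "Z = {x. \<forall>P\<in>S. val x P = 0}"
    using assms by (auto simp: affine_variety_def zariski_closed_def)
  have cl: "zariski_closed {x \<in> Z. val x R = 0}" for R
    unfolding zariski_closed_def by (rule exI[of _ "insert R S"]) (auto simp: S)
  have "Z = {x \<in> Z. val x P = 0} \<union> {x \<in> Z. val x Q = 0}"
    using PQ by (auto simp: vanish_at_def)
  then have "Z = {x \<in> Z. val x P = 0} \<or> Z = {x \<in> Z. val x Q = 0}"
    using assms cl[of P] cl[of Q] unfolding affine_variety_def by blast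
  then show "vanish Z P \<or> vanish Z Q" by (auto simp: vanish_at_def)
qed

lemma prime_set_affine_variety:
  assumes "prime_set (Z :: ('k::field ^ 'n) set)" "zariski_closed Z"
  shows "affine_variety Z"
  unfolding affine_variety_def
proof (intro conjI allI impI)
  show "Z \<noteq> {}" using assms by (simp add: prime_set_def)
  show "zariski_closed Z" by fact
  fix A B assume "zariski_closed A" "zariski_closed B" and Z: "Z = A \<union> B"
  then obtain S T where S: "A = {x. \<forall>P\<in>S. val x P = 0}" and T: "B = {x. \<forall>P\<in>T. val x P = 0}"
    by (auto simp: zariski_closed_def)
  show "Z = A \<or> Z = B"
  proof (rule ccontr)
    assume "\<not> ?thesis"
    then have "\<not> Z \<subseteq> A" "\<not> Z \<subseteq> B" using Z by auto
    then obtain P Q where P: "P \<in> S" "\<not> vanish Z P" and Q: "Q \<in> T" "\<not> vanish Z Q"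
      unfolding S T vanish_at_def by blast
    then obtain z where "z \<in> Z" "val z P \<noteq> 0" "val z Q \<noteq> 0"
      using prime_setD[OF assms(1)] by blast
    then show False using Z P(1) Q(1) by (auto simp: S T)
  qed
qed

text \<open>
  Each coordinate satisfies a univariate equation on \<open>Z\<close>. In an equation of minimal degree the linear factor
  belonging to a point of \<open>Z\<close> must vanish on the whole irreducible set \<open>Z\<close>.
\<close>

lemma variety_dim_0:
  fixes Z :: "('k::field_char_0 ^ 'n::finite) set"
  assumes prime: "prime_set Z" and d: "variety_dim Z = 0"
  shows "\<exists>p. Z = {p}"
proof -
  obtain z0 where z0: "z0 \<in> Z" using prime by (auto simp: prime_set_def)
  have coord: "z $ i = z0 $ i" if z: "z \<in> Z" for z i
  proof -
    have "\<not> alg_independent Z 1 (\<lambda>l x. val x (mvar i))"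
      using alg_independent_le_variety_dim[OF prime, of 1 "\<lambda>_. mvar i"] d by auto
    then obtain P :: "(nat, 'k) mpol" where P: "P \<noteq> 0" "P \<in> polys_in {..<1}" "vanish_at (\<lambda>x l. x $ i) Z P"
      by (auto simp: alg_independent_iff)
    have "\<exists>q. P = poly (map_poly mconst q) (mvar 0)"
      using P(2)
    proof (induction rule: polys_in.induct)
      case (const c) show ?case by (rule exI[of _ "[:c:]"]) (simp add: map_poly_pCons)
    next
      case (var j) then show ?case by (intro exI[of _ "[:0, 1:]"]) (simp add: map_poly_pCons)
    next
      case (add P Q)
      then obtain p q where "P = poly (map_poly mconst p) (mvar 0)" "Q = poly (map_poly mconst q) (mvar 0)" by blast
      moreover have "map_poly mconst (p + q) = map_poly mconst p + (map_poly mconst q :: (nat, 'k) mpol poly)"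
        by (rule poly_eqI) (simp add: coeff_map_poly single_add)
      ultimately show ?case by (intro exI[of _ "p + q"]) simp
    next
      case (mult P Q)
      then obtain p q where "P = poly (map_poly mconst p) (mvar 0)" "Q = poly (map_poly mconst q) (mvar 0)" by blast
      moreover have "mconst (sum f A) = (\<Sum>x\<in>A. mconst (f x) :: (nat, 'k) mpol)" for f :: "nat \<Rightarrow> 'k" and A
        by (induction A rule: infinite_finite_induct) (auto simp: single_add)
      then have "map_poly mconst (p * q) = map_poly mconst p * (map_poly mconst q :: (nat, 'k) mpol poly)"
        by (intro poly_eqI) (simp add: coeff_map_poly coeff_mult mult_single)
      ultimately show ?case by (intro exI[of _ "p * q"]) simp
    qed
    then obtain q0 where q0: "P = poly (map_poly mconst q0) (mvar 0)" by blast
    define rel where "rel q \<longleftrightarrow> q \<noteq> 0 \<and> (\<forall>z\<in>Z. poly q (z $ i) = 0)" for q :: "'k poly"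
    have id: "map_poly (mpol_eval a) (map_poly mconst q) = q" for a :: "nat \<Rightarrow> 'k" and q
      by (rule poly_eqI) (simp add: coeff_map_poly)
    have id': "map_poly (mpol_eval a) (map_poly mconst q) = q" for a :: "'n \<Rightarrow> 'k" and q
      by (rule poly_eqI) (simp add: coeff_map_poly)
    have "rel q0" using P by (auto simp: rel_def q0 vanish_at_def eval_poly id)
    then obtain q where q: "rel q" and min: "\<And>q'. rel q' \<Longrightarrow> degree q \<le> degree q'"
      using arg_min_nat_lemma[of rel q0 degree] by metis
    have "poly q (z0 $ i) = 0" using q z0 by (simp add: rel_def)
    then obtain q' where q': "q = [:- (z0 $ i), 1:] * q'" by (auto simp: poly_eq_0_iff_dvd)
    have "q' \<noteq> 0" using q by (auto simp: rel_def q')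
    have "degree q = Suc (degree q')" unfolding q' using \<open>q' \<noteq> 0\<close> by (subst degree_mult_eq) auto
    then have "\<not> rel q'" using min[of q'] by auto
    then have "\<not> vanish Z (poly (map_poly mconst q') (mvar i))"
      using \<open>q' \<noteq> 0\<close> by (auto simp: rel_def vanish_at_def eval_poly id')
    moreover have "vanish Z ((mvar i - mconst (z0 $ i)) * poly (map_poly mconst q') (mvar i))"
      using q by (auto simp: rel_def vanish_at_def q' eval_poly id')
    ultimately have "vanish Z (mvar i - mconst (z0 $ i))" using prime prime_set_def by metis
    then show ?thesis using z by (simp add: vanish_at_def)
  qed
  have "z = z0" if "z \<in> Z" for z using coord[OF that] by (simp add: vec_eq_iff)
  then have "Z = {z0}" using z0 by blast
  then show ?thesis by blast
qed

section \<open>Flows and velocities\<close>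

text \<open>
  A point of the product of the affine line (the time) and the affine space, in the index type that
  \<^const>\<open>Ga_subgroup\<close> uses for it.
\<close>

abbreviation timed :: "'k \<Rightarrow> 'k ^ 'n \<Rightarrow> 1 + 'n \<Rightarrow> 'k" where
  "timed t z \<equiv> case_sum (\<lambda>_. t) (($) z)"

abbreviation tval :: "'k::comm_ring_1 \<Rightarrow> 'k ^ 'n \<Rightarrow> (1 + 'n, 'k) mpol \<Rightarrow> 'k" where
  "tval t z \<equiv> mpol_eval (timed t z)"

text \<open>
  An action of the additive group on \<open>Z\<close> by polynomial maps; the trivial action is included.
\<close>

definition flow :: "('k::field ^ 'n) set \<Rightarrow> ('k \<Rightarrow> 'k ^ 'n \<Rightarrow> 'k ^ 'n) \<Rightarrow> bool" where
  "flow Z \<phi> \<longleftrightarrow> (\<forall>t. \<forall>z\<in>Z. \<phi> t z \<in> Z) \<and> (\<forall>z\<in>Z. \<phi> 0 z = z) \<and>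
     (\<forall>s t. \<forall>z\<in>Z. \<phi> (s + t) z = \<phi> s (\<phi> t z)) \<and>
     (\<exists>\<Phi>. \<forall>t. \<forall>z\<in>Z. \<forall>i. \<phi> t z $ i = tval t z (\<Phi> i))"

definition velocity :: "('k::field ^ 'n) set \<Rightarrow> 'k ^ 'n \<Rightarrow> 'k ^ 'n \<Rightarrow> bool" where
  "velocity Z z v \<longleftrightarrow> (\<exists>\<phi> \<gamma>. flow Z \<phi> \<and> (\<forall>t i. \<phi> t z $ i = poly (\<gamma> i) t) \<and> (\<forall>i. v $ i = coeff (\<gamma> i) 1))"

definition flexible_at :: "('k::field ^ 'n::finite) set \<Rightarrow> 'k ^ 'n \<Rightarrow> bool" where
  "flexible_at Z p \<longleftrightarrow> tangent_space Z p \<subseteq> vec.span {v. velocity Z p v}"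

lemma flow_in: "flow Z \<phi> \<Longrightarrow> z \<in> Z \<Longrightarrow> \<phi> t z \<in> Z"
  and flow_0: "flow Z \<phi> \<Longrightarrow> z \<in> Z \<Longrightarrow> \<phi> 0 z = z"
  and flow_add: "flow Z \<phi> \<Longrightarrow> z \<in> Z \<Longrightarrow> \<phi> (s + t) z = \<phi> s (\<phi> t z)"
  by (simp_all add: flow_def)

lemma flow_poly:
  assumes "flow Z \<phi>"
  obtains \<Phi> where "\<And>t z i. z \<in> Z \<Longrightarrow> \<phi> t z $ i = tval t z (\<Phi> i)"
  using assms by (auto simp: flow_def)

lemma flow_minus: "flow Z \<phi> \<Longrightarrow> z \<in> Z \<Longrightarrow> \<phi> (- t) (\<phi> t z) = z"
  and flow_minus': "flow Z \<phi> \<Longrightarrow> z \<in> Z \<Longrightarrow> \<phi> t (\<phi> (- t) z) = z"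
  using flow_add[of Z \<phi> z "-t" t] flow_add[of Z \<phi> z t "-t"] by (simp_all add: flow_0)

lemma mpol_eval_cong: "(\<And>i. a i = b i) \<Longrightarrow> mpol_eval a P = mpol_eval b P"
  by (metis ext)

lemma along_curve:
  assumes "\<And>t i. c t $ i = poly (\<gamma> i) t"
  shows "val (c t) P = poly (along \<gamma> P) t"
proof -
  have "($) (c t) = (\<lambda>i. poly (\<gamma> i) t)" using assms by (simp add: fun_eq_iff)
  then show ?thesis by (simp only: poly_along)
qed

lemma flow_along_curve:
  assumes "flow Z \<phi>" "\<And>t. c t \<in> Z" "\<And>t i. c t $ i = poly (\<gamma> i) t"
  obtains \<delta> where "\<And>t i. \<phi> (poly \<tau> t) (c t) $ i = poly (\<delta> i) t"
proof -
  obtain \<Phi> where \<Phi>: "\<And>t z i. z \<in> Z \<Longrightarrow> \<phi> t z $ i = tval t z (\<Phi> i)"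
    using flow_poly[OF assms(1)] by blast
  have "timed (poly \<tau> t) (c t) = (\<lambda>i. poly (case_sum (\<lambda>_. \<tau>) \<gamma> i) t)" for t
    using assms(3) by (auto simp: fun_eq_iff split: sum.split)
  then have "\<phi> (poly \<tau> t) (c t) $ i = poly (along (case_sum (\<lambda>_. \<tau>) \<gamma>) (\<Phi> i)) t" for t i
    by (simp add: \<Phi>[OF assms(2)] poly_along)
  then show ?thesis by (rule that)
qed

lemma flow_curve:
  assumes "flow Z \<phi>" "z \<in> Z"
  obtains \<gamma> where "\<And>t i. \<phi> t z $ i = poly (\<gamma> i) t"
proof -
  have "\<exists>\<delta>. \<forall>t i. \<phi> (poly [:0, 1:] t) z $ i = poly (\<delta> i) t"
    by (rule flow_along_curve[OF assms(1), of "\<lambda>_. z" "\<lambda>i. [:z $ i:]" "[:0, 1:]"]) (simp add: assms(2), simp, blast)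
  then show ?thesis using that by auto
qed

lemma curve_derivative:
  fixes c :: "'k::field_char_0 \<Rightarrow> 'k ^ 'n"
  assumes c: "\<And>t i. c t $ i = poly (\<gamma> i) t" and q: "\<And>t. val (c t) P = poly q t"
    and v: "\<And>i. v $ i = coeff (\<gamma> i) 1"
  shows "coeff q 1 = dval P (c 0) v"
proof -
  have "q = along \<gamma> P" by (rule poly_eqI_infinite) (simp add: along_curve[OF c, symmetric] q)
  moreover have "($) (c 0) = (\<lambda>i. coeff (\<gamma> i) 0)" using c by (simp add: fun_eq_iff poly_0_coeff_0)
  moreover have "($) v = (\<lambda>i. coeff (\<gamma> i) 1)" using v by (simp add: fun_eq_iff)
  ultimately show ?thesis by (simp only: coeff_1_along)
qed

lemma curve_tangent:
  fixes c :: "'k::field_char_0 \<Rightarrow> 'k ^ 'n::finite"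
  assumes c: "\<And>t i. c t $ i = poly (\<gamma> i) t" and Z: "\<And>t. c t \<in> Z" and v: "\<And>i. v $ i = coeff (\<gamma> i) 1"
  shows "v \<in> tangent_space Z (c 0)"
  unfolding tangent_space_eq
proof (intro CollectI allI impI)
  fix P assume "vanish Z P"
  then have "\<And>t. val (c t) P = poly 0 t" using Z by (simp add: vanish_at_def)
  from curve_derivative[OF c this v] show "dval P (c 0) v = 0" by simp
qed

lemma velocity_tangent:
  fixes Z :: "('k::field_char_0 ^ 'n::finite) set"
  assumes "velocity Z z v" "z \<in> Z" shows "v \<in> tangent_space Z z"
proof -
  obtain \<phi> \<gamma> where "flow Z \<phi>" "\<And>t i. \<phi> t z $ i = poly (\<gamma> i) t" "\<And>i. v $ i = coeff (\<gamma> i) 1"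
    using assms(1) by (auto simp: velocity_def)
  then show ?thesis using curve_tangent[of "\<lambda>t. \<phi> t z" \<gamma> Z v] assms(2) by (simp add: flow_in flow_0)
qed

definition poly_map :: "('n \<Rightarrow> ('n, 'k::comm_ring_1) mpol) \<Rightarrow> 'k ^ 'n \<Rightarrow> 'k ^ 'n" where
  "poly_map \<Theta> z = (\<chi> i. val z (\<Theta> i))"

definition differential :: "('n \<Rightarrow> ('n, 'k::comm_ring_1) mpol) \<Rightarrow> 'k ^ 'n \<Rightarrow> 'k ^ 'n \<Rightarrow> 'k ^ 'n" where
  "differential \<Theta> z v = (\<chi> i. dval (\<Theta> i) z v)"

lemma flow_time_map:
  assumes "flow Z \<phi>"
  obtains \<Theta> where "\<And>z. z \<in> Z \<Longrightarrow> \<phi> a z = poly_map \<Theta> z"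
proof -
  obtain \<Phi> where \<Phi>: "\<And>t z i. z \<in> Z \<Longrightarrow> \<phi> t z $ i = tval t z (\<Phi> i)"
    using flow_poly[OF assms] by blast
  have "\<phi> a z = poly_map (\<lambda>i. subst (case_sum (\<lambda>_. mconst a) mvar) (\<Phi> i)) z" if "z \<in> Z" for z
    by (auto simp: vec_eq_iff poly_map_def eval_subst \<Phi>[OF that] intro!: mpol_eval_cong split: sum.split)
  then show ?thesis by (rule that)
qed

lemma eval_at_poly_map: "val (poly_map \<Theta> z) P = val z (subst \<Theta> P)"
proof -
  have "($) (poly_map \<Theta> z) = (\<lambda>i. val z (\<Theta> i))" by (simp add: fun_eq_iff poly_map_def)
  then show ?thesis by (simp add: eval_subst)
qed

lemma dirderiv_differential: "dval P (poly_map \<Theta> z) (differential \<Theta> z v) = dval (subst \<Theta> P) z v"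
proof -
  have "($) (poly_map \<Theta> z) = (\<lambda>i. val z (\<Theta> i))" by (simp add: fun_eq_iff poly_map_def)
  moreover have "($) (differential \<Theta> z v) = (\<lambda>i. dval (\<Theta> i) z v)" by (simp add: fun_eq_iff differential_def)
  ultimately show ?thesis by (simp add: dirderiv_subst)
qed

lemma linear_differential: "Vector_Spaces.linear (*s) (*s) (differential \<Theta> (z :: 'k::field ^ 'n::finite))"
  by unfold_locales (simp_all add: differential_def vec_eq_iff dirderiv_vec_add dirderiv_vec_scale)

lemma differential_tangent:
  fixes Z :: "('k::field ^ 'n::finite) set"
  assumes "\<And>z. z \<in> Z \<Longrightarrow> poly_map \<Theta> z \<in> Z" "v \<in> tangent_space Z z"
  shows "differential \<Theta> z v \<in> tangent_space Z (poly_map \<Theta> z)"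
  unfolding tangent_space_eq
proof (intro CollectI allI impI)
  fix P assume "vanish Z P"
  then have "vanish Z (subst \<Theta> P)" using assms(1) by (simp add: vanish_at_def flip: eval_at_poly_map)
  then show "dval P (poly_map \<Theta> z) (differential \<Theta> z v) = 0"
    using assms(2) by (simp add: dirderiv_differential tangent_space_eq)
qed

lemma differential_inverse:
  fixes Z :: "('k::field ^ 'n::finite) set"
  assumes "\<And>z. z \<in> Z \<Longrightarrow> poly_map \<Theta>' (poly_map \<Theta> z) = z" "v \<in> tangent_space Z z"
  shows "differential \<Theta>' (poly_map \<Theta> z) (differential \<Theta> z v) = v"
proof -
  have "dval (\<Theta>' i) (poly_map \<Theta> z) (differential \<Theta> z v) = v $ i" for i
  proof -
    have "vanish Z (subst \<Theta> (\<Theta>' i) - mvar i)" unfolding vanish_at_def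
    proof
      fix z assume "z \<in> Z"
      then have "poly_map \<Theta>' (poly_map \<Theta> z) $ i = z $ i" using assms(1) by simp
      then show "val z (subst \<Theta> (\<Theta>' i) - mvar i) = 0"
        by (simp add: poly_map_def[of \<Theta>'] eval_at_poly_map)
    qed
    then have "dval (subst \<Theta> (\<Theta>' i) - mvar i) z v = 0" using assms(2) unfolding tangent_space_eq by blast
    then show ?thesis by (simp add: dirderiv_differential)
  qed
  then show ?thesis by (simp add: vec_eq_iff differential_def[of \<Theta>'])
qed

text \<open>
  Time maps of flows are automorphisms, and their differentials are inverse to each other on tangent
  spaces.
\<close>

lemma flow_tangent_dim_le:
  fixes Z :: "('k::field_char_0 ^ 'n::finite) set"
  assumes \<psi>: "flow Z \<psi>" and z: "z \<in> Z"
  shows "vec.dim (tangent_space Z z) \<le> vec.dim (tangent_space Z (\<psi> a z))"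
proof -
  obtain \<Theta> where \<Theta>: "\<And>z. z \<in> Z \<Longrightarrow> \<psi> a z = poly_map \<Theta> z" using flow_time_map[OF \<psi>] by blast
  obtain \<Theta>' where \<Theta>': "\<And>z. z \<in> Z \<Longrightarrow> \<psi> (- a) z = poly_map \<Theta>' z" using flow_time_map[OF \<psi>] by blast
  have inv: "poly_map \<Theta>' (poly_map \<Theta> z) = z" if "z \<in> Z" for z
    using flow_minus[OF \<psi> that, of a] flow_in[OF \<psi> that, of a] that by (simp add: \<Theta> \<Theta>')
  have "vec.dim (tangent_space Z z) = vec.dim (differential \<Theta> z ` tangent_space Z z)"
  proof (rule vec.dim_image_eq[symmetric, OF linear_differential])
    have "vec.span (tangent_space Z z) = tangent_space Z z"
      by (simp add: vec.span_eq_iff subspace_tangent_space)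
    then show "inj_on (differential \<Theta> z) (vec.span (tangent_space Z z))"
      using differential_inverse[of Z \<Theta>' \<Theta>, OF inv] by (metis inj_onI)
  qed
  also have "\<dots> \<le> vec.dim (tangent_space Z (\<psi> a z))"
  proof (rule vec.dim_subset)
    have "poly_map \<Theta> z \<in> Z" if "z \<in> Z" for z using flow_in[OF \<psi> that, of a] that by (simp add: \<Theta>)
    then show "differential \<Theta> z ` tangent_space Z z \<subseteq> tangent_space Z (\<psi> a z)"
      using differential_tangent[of Z \<Theta> _ z] by (auto simp: \<Theta> z)
  qed
  finally show ?thesis .
qed

lemma flow_tangent_dim:
  fixes Z :: "('k::field_char_0 ^ 'n::finite) set"
  assumes \<psi>: "flow Z \<psi>" and z: "z \<in> Z"
  shows "vec.dim (tangent_space Z (\<psi> a z)) = vec.dim (tangent_space Z z)"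
  using flow_tangent_dim_le[OF \<psi> z, of a] flow_tangent_dim_le[OF \<psi> flow_in[OF \<psi> z, of a], of "- a"]
  by (simp add: flow_minus[OF \<psi> z])

lemma flow_conjugate:
  fixes Z :: "('k::field_char_0 ^ 'n::finite) set"
  assumes \<phi>: "flow Z \<phi>" and \<psi>: "flow Z \<psi>"
  shows "flow Z (\<lambda>t z. \<psi> a (\<phi> t (\<psi> (- a) z)))"
  unfolding flow_def
proof (intro conjI allI ballI)
  fix t z assume z: "z \<in> Z"
  show "\<psi> a (\<phi> t (\<psi> (- a) z)) \<in> Z" by (intro flow_in[OF \<psi>] flow_in[OF \<phi>] z)
next
  fix z assume z: "z \<in> Z"
  show "\<psi> a (\<phi> 0 (\<psi> (- a) z)) = z" by (simp add: flow_0[OF \<phi> flow_in[OF \<psi> z]] flow_minus'[OF \<psi> z])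
next
  fix s t z assume z: "z \<in> Z"
  show "\<psi> a (\<phi> (s + t) (\<psi> (- a) z)) = \<psi> a (\<phi> s (\<psi> (- a) (\<psi> a (\<phi> t (\<psi> (- a) z)))))"
    by (simp add: flow_add[OF \<phi> flow_in[OF \<psi> z]] flow_minus[OF \<psi> flow_in[OF \<phi> flow_in[OF \<psi> z]]])
next
  obtain \<Theta> where \<Theta>: "\<And>z. z \<in> Z \<Longrightarrow> \<psi> a z = poly_map \<Theta> z" using flow_time_map[OF \<psi>] by blast
  obtain \<Theta>' where \<Theta>': "\<And>z. z \<in> Z \<Longrightarrow> \<psi> (- a) z = poly_map \<Theta>' z" using flow_time_map[OF \<psi>] by blast
  obtain \<Phi> where \<Phi>: "\<And>t z i. z \<in> Z \<Longrightarrow> \<phi> t z $ i = tval t z (\<Phi> i)"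
    using flow_poly[OF \<phi>] by blast
  define \<rho> :: "1 + 'n \<Rightarrow> (1 + 'n, 'k) mpol" where
    "\<rho> = case_sum (\<lambda>_. mvar (Inl 1)) (\<lambda>k. subst (\<lambda>l. mvar (Inr l)) (\<Theta>' k))"
  define \<Xi> where "\<Xi> i = subst (\<lambda>j. subst \<rho> (\<Phi> j)) (\<Theta> i)" for i
  have "\<psi> a (\<phi> t (\<psi> (- a) z)) $ i = tval t z (\<Xi> i)" if z: "z \<in> Z" for t z i
  proof -
    have 1: "tval t z (\<rho> j) = timed t (\<psi> (- a) z) j" for j
      by (cases j) (simp_all add: \<rho>_def \<Theta>'[OF z] poly_map_def eval_subst)
    have "\<psi> a (\<phi> t (\<psi> (- a) z)) $ i = val (\<phi> t (\<psi> (- a) z)) (\<Theta> i)"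
      by (simp add: \<Theta>[OF flow_in[OF \<phi> flow_in[OF \<psi> z]]] poly_map_def)
    also have "\<dots> = mpol_eval (\<lambda>j. tval t (\<psi> (- a) z) (\<Phi> j)) (\<Theta> i)"
      by (rule mpol_eval_cong) (simp add: \<Phi>[OF flow_in[OF \<psi> z]])
    also have "\<dots> = tval t z (\<Xi> i)"
      unfolding \<Xi>_def eval_subst by (intro mpol_eval_cong) (simp add: 1)
    finally show ?thesis .
  qed
  then show "\<exists>\<Xi>. \<forall>t. \<forall>z\<in>Z. \<forall>i. \<psi> a (\<phi> t (\<psi> (- a) z)) $ i = tval t z (\<Xi> i)" by blast
qed

lemma velocity_differential:
  fixes Z :: "('k::field_char_0 ^ 'n::finite) set"
  assumes v: "velocity Z z v" and \<psi>: "flow Z \<psi>" and z: "z \<in> Z"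
    and \<Theta>: "\<And>z. z \<in> Z \<Longrightarrow> \<psi> a z = poly_map \<Theta> z"
  shows "velocity Z (\<psi> a z) (differential \<Theta> z v)"
proof -
  obtain \<phi> \<gamma> where \<phi>: "flow Z \<phi>" and \<gamma>: "\<And>t i. \<phi> t z $ i = poly (\<gamma> i) t" "\<And>i. v $ i = coeff (\<gamma> i) 1"
    using v by (auto simp: velocity_def)
  let ?\<chi> = "\<lambda>t z. \<psi> a (\<phi> t (\<psi> (- a) z))"
  have val: "?\<chi> t (\<psi> a z) $ i = val (\<phi> t z) (\<Theta> i)" for t i
    by (simp add: flow_minus[OF \<psi> z] \<Theta>[OF flow_in[OF \<phi> z]]) (simp add: poly_map_def)
  have "?\<chi> t (\<psi> a z) $ i = poly (along \<gamma> (\<Theta> i)) t" for t i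
    unfolding val by (rule along_curve[OF \<gamma>(1)])
  moreover have "coeff (along \<gamma> (\<Theta> i)) 1 = differential \<Theta> z v $ i" for i
    using curve_derivative[of "\<lambda>t. \<phi> t z" \<gamma> "\<Theta> i" "along \<gamma> (\<Theta> i)" v, OF \<gamma>(1) along_curve[OF \<gamma>(1)] \<gamma>(2)]
    by (simp add: differential_def flow_0[OF \<phi> z])
  ultimately show ?thesis unfolding velocity_def
    by (intro exI[of _ ?\<chi>] exI[of _ "\<lambda>i. along \<gamma> (\<Theta> i)"]) (simp add: flow_conjugate[OF \<phi> \<psi>])
qed

text \<open>
  Conjugating flows by the automorphism \<open>\<psi> a\<close> transports velocities by its differential, so that
  flexibility at one point of an orbit gives flexibility at the others.
\<close>

lemma flexible_at_flow:
  fixes Z :: "('k::field_char_0 ^ 'n::finite) set"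
  assumes \<psi>: "flow Z \<psi>" and z: "z \<in> Z" and fl: "flexible_at Z (\<psi> a z)"
  shows "flexible_at Z z"
  unfolding flexible_at_def
proof
  fix v assume v: "v \<in> tangent_space Z z"
  obtain \<Theta> where \<Theta>: "\<And>z. z \<in> Z \<Longrightarrow> \<psi> a z = poly_map \<Theta> z" using flow_time_map[OF \<psi>] by blast
  obtain \<Theta>' where \<Theta>': "\<And>z. z \<in> Z \<Longrightarrow> \<psi> (- a) z = poly_map \<Theta>' z" using flow_time_map[OF \<psi>] by blast
  have inv: "poly_map \<Theta>' (poly_map \<Theta> z) = z" if "z \<in> Z" for z
    using flow_minus[OF \<psi> that, of a] flow_in[OF \<psi> that, of a] that by (simp add: \<Theta> \<Theta>')
  let ?q = "\<psi> a z"
  have q: "?q \<in> Z" by (rule flow_in[OF \<psi> z])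
  interpret p: Vector_Spaces.linear "(*s)" "(*s)" "differential \<Theta>' ?q" by (rule linear_differential)
  have pull_back: "differential \<Theta>' ?q x \<in> vec.span {v. velocity Z z v}" if "x \<in> vec.span {v. velocity Z ?q v}" for x
    using that
  proof (induction rule: vec.span_induct_alt)
    case base then show ?case by (simp add: vec.span_zero p.zero)
  next
    case (step c x y)
    have "velocity Z z (differential \<Theta>' ?q x)"
      using velocity_differential[OF _ \<psi> q, of x "- a" \<Theta>'] step(1) by (simp add: \<Theta>' flow_minus[OF \<psi> z])
    then show ?case using step(2) by (simp add: p.add p.scale vec.span_add vec.span_scale vec.span_base)
  qed
  have "differential \<Theta> z v \<in> tangent_space Z ?q"
  proof -
    have "poly_map \<Theta> z \<in> Z" if "z \<in> Z" for z using flow_in[OF \<psi> that, of a] that by (simp add: \<Theta>)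
    from differential_tangent[of Z \<Theta> v z, OF this v] show ?thesis by (simp add: \<Theta> z)
  qed
  then have "differential \<Theta>' ?q (differential \<Theta> z v) \<in> vec.span {v. velocity Z z v}"
    using fl pull_back by (auto simp: flexible_at_def)
  then show "v \<in> vec.span {v. velocity Z z v}"
    using differential_inverse[of Z \<Theta>' \<Theta>, OF inv v] by (simp add: \<Theta> z)
qed

section \<open>Local slices and orbits\<close>

lemma flow_on_orbit: "flow Z \<phi> \<Longrightarrow> z \<in> Z \<Longrightarrow> flow (range (\<lambda>t. \<phi> t z)) \<phi>"
proof -
  assume f: "flow Z \<phi>" and z: "z \<in> Z"
  have sub: "range (\<lambda>t. \<phi> t z) \<subseteq> Z" using flow_in[OF f z] by blast
  have "\<phi> s (\<phi> t z) \<in> range (\<lambda>t. \<phi> t z)" for s t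
    using flow_add[OF f z, of s t] by (metis rangeI)
  then show ?thesis
    using f sub unfolding flow_def by (fastforce simp: subset_iff)
qed

abbreviation time_line :: "('i \<Rightarrow> 'k::comm_ring_1) \<Rightarrow> 1 + 'i \<Rightarrow> 'k poly" where
  "time_line x \<equiv> case_sum (\<lambda>_. [:0, 1:]) (\<lambda>j. [:x j:])"

lemma along_degree_bound:
  "\<exists>N. \<forall>x. degree (along (time_line x) P) \<le> N"
proof (induction P rule: mpol_induct)
  case (const c) show ?case by (rule exI[of _ 0]) simp
next
  case (var i) show ?case by (rule exI[of _ 1]) (simp split: sum.split)
next
  case (add P Q)
  then obtain M N where "\<And>x. degree (along (time_line x) P) \<le> M"
    "\<And>x. degree (along (time_line x) Q) \<le> N" by blast
  then show ?case by (intro exI[of _ "max M N"] allI, unfold along_add, intro degree_add_le) (simp_all add: le_max_iff_disj)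
next
  case (mult P Q)
  then obtain M N where "\<And>x. degree (along (time_line x) P) \<le> M"
    "\<And>x. degree (along (time_line x) Q) \<le> N" by blast
  then show ?case
    by (intro exI[of _ "M + N"] allI) (simp add: order_trans[OF degree_mult_le] add_mono)
qed

lemma along_coeff_poly:
  "\<exists>C. \<forall>x. coeff (along (time_line x) P) l = mpol_eval x C"
proof (induction P arbitrary: l rule: mpol_induct)
  case (const c) show ?case by (rule exI[of _ "mconst (coeff [:c:] l)"]) simp
next
  case (var i) 
  show ?case
  proof (cases i)
    case (Inl a) then show ?thesis by (intro exI[of _ "mconst (coeff [:0, 1:] l)"]) simp
  next
    case (Inr j) then show ?thesis
      by (intro exI[of _ "if l = 0 then mvar j else 0"]) (simp add: coeff_pCons split: nat.split)
  qed
next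
  case (add P Q)
  obtain C D where "\<And>x. coeff (along (time_line x) P) l = mpol_eval x C"
    "\<And>x. coeff (along (time_line x) Q) l = mpol_eval x D"
    using add.IH[of l] by blast
  then show ?case by (intro exI[of _ "C + D"]) simp
next
  case (mult P Q)
  obtain C where C: "\<And>l x. coeff (along (time_line x) P) l = mpol_eval x (C l)"
    using mult.IH(1) by metis
  obtain D where D: "\<And>l x. coeff (along (time_line x) Q) l = mpol_eval x (D l)"
    using mult.IH(2) by metis
  show ?case by (intro exI[of _ "\<Sum>i\<le>l. C i * D (l - i)"]) (simp add: coeff_mult C D)
qed

text \<open>
  The leading terms cancel in the difference. If the difference is a constant \<open>c\<close>, then \<open>p\<close> agrees with a
  linear polynomial of slope \<open>c\<close> at all natural numbers.
\<close>

lemma degree_difference: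
  fixes p :: "'k::field_char_0 poly"
  defines "r \<equiv> pcompose p [:1, 1:] - p"
  shows "degree r \<le> degree p - 1" and "2 \<le> degree p \<Longrightarrow> 1 \<le> degree r"
proof -
  have d: "degree (pcompose p [:1, 1:]) = degree p" by (simp add: degree_pcompose)
  have "lead_coeff (pcompose p [:1, 1:]) = lead_coeff p" by (subst lead_coeff_comp) auto
  then have "coeff r (degree p) = 0" by (simp add: r_def d)
  moreover have "degree r \<le> degree p" unfolding r_def by (rule degree_diff_le) (simp_all add: d)
  ultimately have "r = 0 \<or> degree r < degree p" using eq_zero_or_degree_less by blast
  then show "degree r \<le> degree p - 1" by auto
  show "1 \<le> degree r" if "2 \<le> degree p"
  proof (rule ccontr)
    assume "\<not> 1 \<le> degree r"
    then obtain c where c: "r = [:c:]" by (metis degree_eq_zeroE not_less_eq_eq One_nat_def le_0_eq)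
    have step: "poly p (1 + t) = poly p t + c" for t
    proof -
      have "poly r t = c" by (simp add: c)
      then show ?thesis by (simp add: r_def poly_pcompose algebra_simps)
    qed
    have vals: "poly p (of_nat n) = poly p 0 + of_nat n * c" for n
      by (induction n) (simp_all add: step algebra_simps)
    let ?q = "p - [:poly p 0, c:]"
    have "range (of_nat :: nat \<Rightarrow> 'k) \<subseteq> {t. poly ?q t = 0}" using vals by auto
    moreover have "infinite (range (of_nat :: nat \<Rightarrow> 'k))" by (simp add: finite_image_iff inj_of_nat)
    ultimately have "?q = 0" using poly_roots_finite[of ?q] finite_subset by blast
    then have "p = [:poly p 0, c:]" by simp
    then have "degree p \<le> 1" by (metis degree_pCons_le degree_pCons_0 One_nat_def)
    then show False using that by simp
  qed
qed

text \<open>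
  Along each orbit, a polynomial \<open>w\<close> is a polynomial in the time. Choose \<open>w\<close> that is not invariant and for
  which the maximal degree in the time is as small as possible. The difference of \<open>w\<close> under the time-one map
  has smaller degree and is not invariant if that degree exceeds one; hence the degree is one, and \<open>w\<close> is a
  local slice with invariant slope \<open>s\<close>.
\<close>

lemma flow_slice:
  fixes Z :: "('k::field_char_0 ^ 'n::finite) set"
  assumes \<phi>: "flow Z \<phi>" and z0: "z0 \<in> Z" "\<phi> a z0 \<noteq> z0"
  obtains w s z1 where "\<And>z t. z \<in> Z \<Longrightarrow> val (\<phi> t z) w = val z w + t * val z s"
    "\<And>z t. z \<in> Z \<Longrightarrow> val (\<phi> t z) s = val z s"
    "z1 \<in> Z" "val z1 s \<noteq> 0"
proof -
  obtain \<Phi> where \<Phi>: "\<And>t z i. z \<in> Z \<Longrightarrow> \<phi> t z $ i = tval t z (\<Phi> i)"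
    using flow_poly[OF \<phi>] by blast
  define q where "q w z = along (time_line (($) z)) (subst \<Phi> w)" for w z
  have q: "poly (q w z) t = val (\<phi> t z) w" if "z \<in> Z" for w z t
  proof -
    have "poly (q w z) t = tval t z (subst \<Phi> w)"
      unfolding q_def poly_along by (rule mpol_eval_cong) (simp split: sum.split)
    also have "\<dots> = val (\<phi> t z) w"
      unfolding eval_subst by (rule mpol_eval_cong) (simp add: \<Phi>[OF that])
    finally show ?thesis .
  qed
  \<comment> \<open>\<open>N\<close> bounds the degree in the time of some polynomial that is not invariant.\<close>
  define good where "good N \<longleftrightarrow> (\<exists>w. (\<forall>z\<in>Z. degree (q w z) \<le> N) \<and> (\<exists>z\<in>Z. 1 \<le> degree (q w z)))" for N
  have "\<exists>N. good N"
  proof -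
    obtain i where i: "\<phi> a z0 $ i \<noteq> z0 $ i" using z0(2) by (auto simp: vec_eq_iff)
    obtain N where N: "\<And>x. degree (along (time_line x) (subst \<Phi> (mvar i))) \<le> N"
      using along_degree_bound by blast
    have "1 \<le> degree (q (mvar i) z0)"
    proof (rule ccontr)
      assume "\<not> 1 \<le> degree (q (mvar i) z0)"
      then obtain c where "q (mvar i) z0 = [:c:]" by (metis degree_eq_zeroE not_less_eq_eq One_nat_def le_0_eq)
      then show False using i q[OF z0(1), of "mvar i" a] q[OF z0(1), of "mvar i" 0] by (simp add: flow_0[OF \<phi> z0(1)])
    qed
    then have "good N" unfolding good_def using N z0(1) by (intro exI[of _ "mvar i"]) (auto simp: q_def)
    then show ?thesis by blast
  qed
  define N where "N = (LEAST N. good N)"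
  have "good N" unfolding N_def using \<open>\<exists>N. good N\<close> by (rule LeastI_ex)
  then obtain w z1 where w: "\<And>z. z \<in> Z \<Longrightarrow> degree (q w z) \<le> N" and z1: "z1 \<in> Z" "1 \<le> degree (q w z1)"
    unfolding good_def by blast
  have N1: "N \<le> 1"
  proof (rule ccontr)
    assume N: "\<not> N \<le> 1"
    have "\<exists>z2\<in>Z. 2 \<le> degree (q w z2)"
    proof (rule ccontr)
      assume "\<not> ?thesis"
      then have "\<forall>z\<in>Z. degree (q w z) \<le> 1" by force
      then have "good 1" unfolding good_def using z1 by blast
      then have "N \<le> 1" unfolding N_def by (rule Least_le)
      then show False using N by simp
    qed
    then obtain z2 where z2: "z2 \<in> Z" "2 \<le> degree (q w z2)" by blast
    obtain \<Theta> where \<Theta>: "\<And>z. z \<in> Z \<Longrightarrow> \<phi> 1 z = poly_map \<Theta> z" using flow_time_map[OF \<phi>] by blast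
    let ?w = "subst \<Theta> w - w"
    have q': "q ?w z = pcompose (q w z) [:1, 1:] - q w z" if z: "z \<in> Z" for z
    proof (rule poly_eqI_infinite)
      fix t
      have "val (\<phi> t z) (subst \<Theta> w) = val (\<phi> (1 + t) z) w"
        by (simp add: flow_add[OF \<phi> z] \<Theta>[OF flow_in[OF \<phi> z]] eval_at_poly_map)
      then show "poly (q ?w z) t = poly (pcompose (q w z) [:1, 1:] - q w z) t"
        by (simp add: poly_pcompose q[OF z])
    qed
    have "good (N - 1)" unfolding good_def
    proof (intro exI[of _ ?w] conjI ballI)
      fix z assume z: "z \<in> Z"
      show "degree (q ?w z) \<le> N - 1"
        unfolding q'[OF z] using degree_difference(1)[of "q w z"] w[OF z] by linarith
    next
      show "\<exists>z\<in>Z. 1 \<le> degree (q ?w z)"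
        using degree_difference(2)[OF z2(2)] by (intro bexI[OF _ z2(1)]) (simp add: q'[OF z2(1)])
    qed
    then have "N \<le> N - 1" unfolding N_def by (rule Least_le)
    then show False using N by simp
  qed
  obtain s where s: "\<And>x. coeff (along (time_line x) (subst \<Phi> w)) 1 = mpol_eval x s"
    using along_coeff_poly by blast
  have cs: "coeff (q w z) 1 = val z s" for z unfolding q_def by (rule s)
  have lin: "val (\<phi> t z) w = val z w + t * val z s" if z: "z \<in> Z" for z t
  proof -
    have "degree (q w z) \<le> 1" using w[OF z] N1 by simp
    then have "coeff (q w z) (Suc (Suc l)) = 0" for l by (intro coeff_eq_0) simp
    then have "q w z = [:coeff (q w z) 0, coeff (q w z) 1:]"
      by (intro poly_eqI) (simp add: coeff_pCons split: nat.split)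
    then obtain c0 c1 where c: "q w z = [:c0, c1:]" by blast
    have "c1 = val z s" using cs[of z] by (simp add: c)
    moreover have "c0 = val z w" using q[OF z, of w 0] by (simp add: c flow_0[OF \<phi> z])
    ultimately show ?thesis using q[OF z, of w t] by (simp add: c)
  qed
  show ?thesis
  proof (rule that[OF lin _ z1(1)])
    fix z t assume z: "z \<in> Z"
    have "val (\<phi> (1 + t) z) w = val (\<phi> t z) w + val (\<phi> t z) s"
      unfolding flow_add[OF \<phi> z] by (simp add: lin[OF flow_in[OF \<phi> z]])
    then show "val (\<phi> t z) s = val z s" by (simp add: lin[OF z] algebra_simps)
  next
    have "degree (q w z1) = 1" using w[OF z1(1)] N1 z1(2) by simp
    then have "coeff (q w z1) 1 \<noteq> 0" by (metis leading_coeff_0_iff degree_0 zero_neq_one)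
    then show "val z1 s \<noteq> 0" using cs[of z1] by simp
  qed
qed

lemma eval_poly_const: "mpol_eval a (poly (map_poly mconst p) x) = poly p (mpol_eval a x)"
  by (induction p) (simp_all add: map_poly_pCons)

lemma dirderiv_poly_const: "dirderiv (poly (map_poly mconst p) x) a v = poly (pderiv p) (mpol_eval a x) * dirderiv x a (v :: 'i \<Rightarrow> 'k::field_char_0)"
  by (induction p) (simp_all add: map_poly_pCons pderiv_pCons eval_poly_const algebra_simps)

text \<open>
  On a nontrivial orbit, the local slice divided by its constant slope is a polynomial that recovers the
  time. It makes the orbit a graph over the affine line, with tangent line spanned by the velocity.
\<close>

lemma orbit_tangent:
  fixes Z :: "('k::field_char_0 ^ 'n::finite) set"
  assumes \<phi>: "flow Z \<phi>" and p: "p \<in> Z"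
  shows "tangent_space (range (\<lambda>t. \<phi> t p)) p \<subseteq> vec.span {v. velocity Z p v}"
proof
  fix v assume v: "v \<in> tangent_space (range (\<lambda>t. \<phi> t p)) p"
  obtain \<gamma> where \<gamma>: "\<And>t i. \<phi> t p $ i = poly (\<gamma> i) t" using flow_curve[OF \<phi> p] by blast
  show "v \<in> vec.span {v. velocity Z p v}"
  proof (cases "\<forall>t. \<phi> t p = p")
    case True
    have "v $ i = 0" for i
    proof -
      have "vanish (range (\<lambda>t. \<phi> t p)) (mvar i - mconst (p $ i))" using True by (simp add: vanish_at_def)
      then have "dval (mvar i - mconst (p $ i)) p v = 0" using v unfolding tangent_space_eq by blast
      then show ?thesis by simp
    qed
    then have "v = 0" by (simp add: vec_eq_iff)
    then show ?thesis by (simp add: vec.span_zero)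
  next
    case False
    let ?O = "range (\<lambda>t. \<phi> t p)"
    have \<phi>O: "flow ?O \<phi>" by (rule flow_on_orbit[OF \<phi> p])
    have pO: "p \<in> ?O" using flow_0[OF \<phi> p] by (metis rangeI)
    obtain a where "\<phi> a p \<noteq> p" using False by blast
    then obtain w s z1 where lin: "\<And>z t. z \<in> ?O \<Longrightarrow> val (\<phi> t z) w = val z w + t * val z s"
      and inv: "\<And>z t. z \<in> ?O \<Longrightarrow> val (\<phi> t z) s = val z s"
      and z1: "z1 \<in> ?O" "val z1 s \<noteq> 0"
      using flow_slice[OF \<phi>O pO] by blast
    define c where "c = val p s"
    obtain t1 where "z1 = \<phi> t1 p" using z1(1) by blast
    then have c: "c \<noteq> 0" using z1(2) inv[OF pO, of t1] by (simp add: c_def)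
    \<comment> \<open>The polynomial that recovers the time.\<close>
    define u where "u = mconst (1 / c) * (w - mconst (val p w))"
    have u: "val (\<phi> t p) u = t" for t
      using lin[OF pO, of t] c by (simp add: u_def c_def)
    define r0 where "r0 = dval u p v"
    have "v $ i = r0 * coeff (\<gamma> i) 1" for i
    proof -
      have "vanish ?O (mvar i - poly (map_poly mconst (\<gamma> i)) u)"
        by (auto simp: vanish_at_def eval_poly_const u \<gamma>)
      then have "dval (mvar i - poly (map_poly mconst (\<gamma> i)) u) p v = 0"
        using v unfolding tangent_space_eq by blast
      moreover have "val p u = 0" using u[of 0] by (simp add: flow_0[OF \<phi> p])
      ultimately show ?thesis by (simp add: dirderiv_poly_const r0_def poly_0_coeff_0 coeff_pderiv)
    qed
    then have "v = r0 *s (\<chi> i. coeff (\<gamma> i) 1)" by (simp add: vec_eq_iff)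
    moreover have "velocity Z p (\<chi> i. coeff (\<gamma> i) 1)"
      unfolding velocity_def using \<phi> \<gamma> by (intro exI[of _ \<phi>] exI[of _ \<gamma>]) simp
    ultimately show ?thesis by (simp add: vec.span_scale vec.span_base)
  qed
qed

text \<open>
  Movement by finitely many time maps: the orbits of the group generated by all \<open>G\<^sub>a\<close>-subgroups.
\<close>

inductive reach :: "('k::field ^ 'n) set \<Rightarrow> 'k ^ 'n \<Rightarrow> 'k ^ 'n \<Rightarrow> bool" for Z p where
  here: "reach Z p p"
| step: "reach Z p q \<Longrightarrow> flow Z \<psi> \<Longrightarrow> reach Z p (\<psi> a q)"

lemma reach_in: "reach Z p q \<Longrightarrow> p \<in> Z \<Longrightarrow> q \<in> Z"
  by (induction rule: reach.induct) (auto simp: flow_in)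

lemma reach_trans: "reach Z q r \<Longrightarrow> reach Z p q \<Longrightarrow> reach Z p r"
  by (induction rule: reach.induct) (auto intro: reach.step)

lemma reach_sym: "reach Z p q \<Longrightarrow> p \<in> Z \<Longrightarrow> reach Z q p"
proof (induction rule: reach.induct)
  case (step q \<psi> a)
  have "reach Z (\<psi> a q) (\<psi> (- a) (\<psi> a q))" by (rule reach.step[OF reach.here step(2)])
  then have "reach Z (\<psi> a q) q" using reach_in[OF step(1,4)] by (simp add: flow_minus[OF step(2)])
  then show ?case using step reach_trans by blast
qed (rule reach.here)

text \<open>
  Multiplying all times of a chain of flows by a common parameter \<open>t\<close> gives a polynomial curve in the
  orbit from \<open>p\<close> (at \<open>t = 0\<close>) to \<open>q\<close> (at \<open>t = 1\<close>).
\<close>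

lemma reach_curve:
  assumes "reach Z p q" "p \<in> Z"
  shows "\<exists>\<gamma> c. (\<forall>t i. c t $ i = poly (\<gamma> i) t) \<and> c 0 = p \<and> c 1 = q \<and> (\<forall>t. reach Z p (c t))"
  using assms
proof (induction rule: reach.induct)
  case here
  show ?case by (rule exI[of _ "\<lambda>i. [:p $ i:]"], rule exI[of _ "\<lambda>_. p"]) (simp add: reach.here)
next
  case (step q \<psi> a)
  then obtain \<gamma> c where c: "\<And>t i. c t $ i = poly (\<gamma> i) t" "c 0 = p" "c 1 = q" "\<And>t. reach Z p (c t)" by blast
  have cZ: "c t \<in> Z" for t using reach_in[OF c(4)] step.prems by blast
  obtain \<delta> where \<delta>: "\<And>t i. \<psi> (poly [:0, a:] t) (c t) $ i = poly (\<delta> i) t"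
    using flow_along_curve[OF step(2) cZ c(1), of "[:0, a:]"] by blast
  show ?case
    by (rule exI[of _ \<delta>], rule exI[of _ "\<lambda>t. \<psi> (poly [:0, a:] t) (c t)"])
       (use \<delta> c reach.step[OF c(4) step(2)] flow_0[OF step(2) step.prems] in auto)
qed

lemma reach_tangent_dim:
  fixes Z :: "('k::field_char_0 ^ 'n::finite) set"
  shows "reach Z p q \<Longrightarrow> p \<in> Z \<Longrightarrow> vec.dim (tangent_space Z q) = vec.dim (tangent_space Z p)"
  by (induction rule: reach.induct) (auto simp: flow_tangent_dim reach_in)

lemma reach_flexible_at:
  fixes Z :: "('k::field_char_0 ^ 'n::finite) set"
  shows "reach Z p q \<Longrightarrow> p \<in> Z \<Longrightarrow> flexible_at Z q \<Longrightarrow> flexible_at Z p"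
proof (induction rule: reach.induct)
  case (step q \<psi> a)
  then show ?case using flexible_at_flow[OF step(2) reach_in[OF step(1)]] by blast
qed

text \<open>
  Two points of the orbit lie on a polynomial curve in the orbit, and the affine line is irreducible.
\<close>

lemma prime_set_orbit:
  fixes X :: "('k::field_char_0 ^ 'n::finite) set"
  assumes p: "p \<in> X"
  shows "prime_set {q. reach X p q}"
  unfolding prime_set_def
proof (intro conjI allI impI)
  show "{q. reach X p q} \<noteq> {}" using reach.here by blast
  fix P Q assume PQ: "vanish {q. reach X p q} (P * Q)"
  show "vanish {q. reach X p q} P \<or> vanish {q. reach X p q} Q"
  proof (rule ccontr)
    assume "\<not> ?thesis"
    then obtain u w where u: "reach X p u" "val u P \<noteq> 0" and w: "reach X p w" "val w Q \<noteq> 0"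
      by (auto simp: vanish_at_def)
    have uX: "u \<in> X" by (rule reach_in[OF u(1) p])
    have "reach X u w" by (rule reach_trans[OF w(1) reach_sym[OF u(1) p]])
    then obtain \<gamma> c where c: "\<And>t i. c t $ i = poly (\<gamma> i) t" "c 0 = u" "c 1 = w" "\<And>t. reach X u (c t)"
      using reach_curve[OF _ uX] by blast
    have "poly (along \<gamma> P * along \<gamma> Q) t = poly 0 t" for t
      using PQ reach_trans[OF c(4) u(1), of t]
      by (simp add: vanish_at_def flip: along_curve[OF c(1)])
    then have "along \<gamma> P * along \<gamma> Q = 0" by (rule poly_eqI_infinite)
    then have "along \<gamma> P = 0 \<or> along \<gamma> Q = 0" by simp
    then show False
      using u(2) w(2) along_curve[OF c(1), of 0 P] along_curve[OF c(1), of 1 Q] c(2,3) by auto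
  qed
qed

text \<open>
  All points of the orbit \<open>O\<close> are smooth on \<open>X\<close>, hence flexible, and the velocities are tangent to \<open>O\<close>.
  Thus \<open>O\<close> and \<open>X\<close> have the same tangent spaces along \<open>O\<close>, so that they have the same dimension, and a
  polynomial that vanishes on \<open>O\<close> vanishes on \<open>X\<close>.
\<close>

lemma orbit_dense:
  fixes X :: "('k::field_char_0 ^ 'n::finite) set"
  assumes X: "prime_set X" and fl: "\<And>p. smooth_point X p \<Longrightarrow> flexible_at X p"
    and p: "smooth_point X p" and s: "\<not> vanish X s"
  obtains q where "reach X p q" "val q s \<noteq> 0"
proof -
  let ?O = "{q. reach X p q}"
  have pX: "p \<in> X" and dp: "vec.dim (tangent_space X p) = variety_dim X" using p by (auto simp: smooth_point_def)
  have OX: "?O \<subseteq> X" using reach_in pX by blast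
  have prO: "prime_set ?O" by (rule prime_set_orbit[OF pX])
  have dim: "vec.dim (tangent_space ?O q) = variety_dim X" if q: "reach X p q" for q
  proof -
    have qX: "q \<in> X" using q OX by blast
    have sm: "smooth_point X q" using reach_tangent_dim[OF q pX] dp qX by (simp add: smooth_point_def)
    have "v \<in> tangent_space ?O q" if "velocity X q v" for v
    proof -
      obtain \<phi> \<gamma> where \<phi>: "flow X \<phi>" "\<And>t i. \<phi> t q $ i = poly (\<gamma> i) t" "\<And>i. v $ i = coeff (\<gamma> i) 1"
        using \<open>velocity X q v\<close> by (auto simp: velocity_def)
      have "v \<in> tangent_space ?O (\<phi> 0 q)"
        by (rule curve_tangent[of "\<lambda>t. \<phi> t q" \<gamma>, OF \<phi>(2) _ \<phi>(3)]) (use reach.step[OF q \<phi>(1)] in simp)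
      then show ?thesis by (simp add: flow_0[OF \<phi>(1) qX])
    qed
    then have "vec.span {v. velocity X q v} \<subseteq> tangent_space ?O q"
      by (intro vec.span_minimal subspace_tangent_space) auto
    then have "tangent_space X q \<subseteq> tangent_space ?O q" using fl[OF sm] by (auto simp: flexible_at_def)
    then have "tangent_space ?O q = tangent_space X q" using tangent_space_mono[OF OX] by blast
    then show ?thesis using sm by (simp add: smooth_point_def)
  qed
  have "variety_dim ?O = variety_dim X"
  proof -
    obtain h where h: "\<not> vanish ?O h"
      "\<And>p. p \<in> ?O \<Longrightarrow> val p h \<noteq> 0 \<Longrightarrow> vec.dim (tangent_space ?O p) = variety_dim ?O"
      using generic_point_dim[OF prO] by blast
    then obtain q where "q \<in> ?O" "val q h \<noteq> 0" unfolding vanish_at_def by blast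
    then show ?thesis using h(2)[of q] dim[of q] by simp
  qed
  then have "\<not> vanish ?O s" using vanish_of_equal_dim[OF X prO OX] s by blast
  then show ?thesis using that by (auto simp: vanish_at_def)
qed

section \<open>Subgroups isomorphic to the additive group\<close>

lemma vec_join_nth: "($) (vec_join x y) = case_sum (($) x) (($) y)"
  by (auto simp: vec_join_def fun_eq_iff split: sum.split)

lemma vec_left_join [simp]: "vec_left (vec_join x y) = x"
  and vec_right_join [simp]: "vec_right (vec_join x y) = y"
  by (simp_all add: vec_left_def vec_right_def vec_join_def vec_eq_iff)

lemma vec_join_surj: "vec_join (vec_left w) (vec_right w) = w"
  by (auto simp: vec_left_def vec_right_def vec_join_def vec_eq_iff split: sum.split)

lemma Ga_subgroup_flow:
  fixes Z :: "('k::field ^ 'n::finite) set"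
  assumes "Ga_subgroup Z H"
  obtains \<phi> where "flow Z \<phi>" "\<And>p. orbit_of H p = range (\<lambda>t. \<phi> t p)"
proof -
  obtain \<phi> where sub: "subgroup H (aut_group Z)" and iso: "\<phi> \<in> iso additive_grp ((aut_group Z)\<lparr>carrier := H\<rparr>)"
    and mor: "morphism (variety_prod (UNIV :: ('k ^ 1) set) Z) Z (\<lambda>w. \<phi> (vec_left w $ 1) (vec_right w))"
    using assms by (auto simp: Ga_subgroup_def)
  have H: "H = range \<phi>" using iso by (auto simp: iso_def bij_betw_def additive_grp_def)
  have Bij: "\<phi> t \<in> Bij Z" for t
    using subgroup.subset[OF sub] H by (auto simp: aut_group_def)
  then have in_Z: "\<phi> t z \<in> Z" if "z \<in> Z" for t z
    using that by (auto simp: Bij_def bij_betw_def)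
  have add: "\<phi> (s + t) z = \<phi> s (\<phi> t z)" if "z \<in> Z" for s t z
  proof -
    have "\<phi> (s + t) = compose Z (\<phi> s) (\<phi> t)"
      using iso Bij[of s] Bij[of t] by (auto simp: iso_def hom_def additive_grp_def aut_group_def BijGroup_def)
    then show ?thesis using that by (simp add: compose_def)
  qed
  have zero: "\<phi> 0 z = z" if "z \<in> Z" for z
  proof -
    have "inj_on (\<phi> 0) Z" using Bij[of 0] by (auto simp: Bij_def bij_betw_def)
    moreover have "\<phi> 0 (\<phi> 0 z) = \<phi> 0 z" using add[OF that, of 0 0] by simp
    ultimately show ?thesis using in_Z[OF that] that by (auto dest: inj_onD)
  qed
  have "\<exists>P. \<forall>t. \<forall>z\<in>Z. \<phi> t z $ i = tval t z P" for i
  proof -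
    have "\<exists>P. \<forall>w\<in>variety_prod (UNIV :: ('k ^ 1) set) Z. \<phi> (vec_left w $ 1) (vec_right w) $ i = val w P"
      using mor by (simp add: morphism_def regular_fun_def)
    then obtain P where P: "\<forall>w\<in>variety_prod (UNIV :: ('k ^ 1) set) Z. \<phi> (vec_left w $ 1) (vec_right w) $ i = val w P" ..
    have "\<phi> t z $ i = tval t z P" if "z \<in> Z" for t z
    proof -
      have "vec_join (\<chi> _. t) z \<in> variety_prod (UNIV :: ('k ^ 1) set) Z" using that by (auto simp: variety_prod_def)
      then have "\<phi> t z $ i = val (vec_join (\<chi> _ :: 1. t) z) P" using P by fastforce
      also have "($) (vec_join (\<chi> _ :: 1. t) z) = timed t z"
        by (auto simp: vec_join_nth fun_eq_iff split: sum.split)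
      finally show ?thesis .
    qed
    then show ?thesis by blast
  qed
  then have "\<exists>\<Phi>. \<forall>t. \<forall>z\<in>Z. \<forall>i. \<phi> t z $ i = tval t z (\<Phi> i)"
    by metis
  then have "flow Z \<phi>" using in_Z add zero by (simp add: flow_def)
  moreover have "orbit_of H p = range (\<lambda>t. \<phi> t p)" for p
    by (auto simp: orbit_of_def H)
  ultimately show ?thesis by (rule that)
qed

text \<open>
  A nontrivial flow is injective in the time because a local slice separates the times, so that its image
  is isomorphic to the additive group.
\<close>

lemma flow_Ga_subgroup:
  fixes Z :: "('k::field_char_0 ^ 'n::finite) set"
  assumes \<phi>: "flow Z \<phi>" and nontrivial: "z0 \<in> Z" "\<phi> a z0 \<noteq> z0"
  obtains H where "Ga_subgroup Z H" "\<And>p. p \<in> Z \<Longrightarrow> orbit_of H p = range (\<lambda>t. \<phi> t p)"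
proof -
  define \<rho> where "\<rho> t = restrict (\<phi> t) Z" for t
  have \<rho>Z: "\<rho> t z = \<phi> t z" if "z \<in> Z" for t z using that by (simp add: \<rho>_def)
  have bij: "bij_betw (\<rho> t) Z Z" for t
    by (rule bij_betw_byWitness[of _ "\<rho> (- t)"])
       (auto simp: \<rho>Z flow_in[OF \<phi>] flow_minus[OF \<phi>] flow_minus'[OF \<phi>])
  have Bij: "\<rho> t \<in> Bij Z" for t using bij by (simp add: Bij_def) (simp add: \<rho>_def)
  have inv: "inv_into Z (\<rho> t) z = \<phi> (- t) z" if "z \<in> Z" for t z
  proof (rule inv_into_f_eq)
    show "inj_on (\<rho> t) Z" using bij by (rule bij_betw_imp_inj_on)
    show "\<phi> (- t) z \<in> Z" by (rule flow_in[OF \<phi> that])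
    then show "\<rho> t (\<phi> (- t) z) = z" by (simp add: \<rho>Z flow_minus'[OF \<phi> that])
  qed
  have reg: "morphism Z Z \<psi>" if "\<And>z. z \<in> Z \<Longrightarrow> \<psi> z = \<phi> t z" for \<psi> t
  proof -
    obtain \<Theta> where "\<And>z. z \<in> Z \<Longrightarrow> \<phi> t z = poly_map \<Theta> z" using flow_time_map[OF \<phi>] by blast
    then have "\<forall>z\<in>Z. \<psi> z $ i = val z (\<Theta> i)" for i using that by (simp add: poly_map_def)
    then show ?thesis using that flow_in[OF \<phi>] unfolding morphism_def regular_fun_def by (metis Pi_I)
  qed
  have carrier: "\<rho> t \<in> carrier (aut_group Z)" for t
    using Bij reg[of "\<rho> t" t] reg[of "inv_into Z (\<rho> t)" "- t"] inv
    by (simp add: aut_group_def \<rho>Z)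
  have mult: "\<rho> s \<otimes>\<^bsub>aut_group Z\<^esub> \<rho> t = \<rho> (s + t)" for s t
    using Bij[of s] Bij[of t]
    by (auto simp: aut_group_def BijGroup_def compose_def fun_eq_iff flow_add[OF \<phi>] flow_in[OF \<phi>]) (auto simp: \<rho>_def flow_add[OF \<phi>] flow_in[OF \<phi>])
  have one: "\<one>\<^bsub>aut_group Z\<^esub> = \<rho> 0"
    by (auto simp: aut_group_def BijGroup_def fun_eq_iff \<rho>_def flow_0[OF \<phi>])
  define H where "H = range \<rho>"
  have minv: "inv\<^bsub>aut_group Z\<^esub> \<rho> t = \<rho> (- t)" for t
    unfolding m_inv_def
  proof (rule the_equality)
    show "\<rho> (- t) \<in> carrier (aut_group Z) \<and> \<rho> t \<otimes>\<^bsub>aut_group Z\<^esub> \<rho> (- t) = \<one>\<^bsub>aut_group Z\<^esub> \<and> \<rho> (- t) \<otimes>\<^bsub>aut_group Z\<^esub> \<rho> t = \<one>\<^bsub>aut_group Z\<^esub>"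
      using carrier by (simp add: mult one)
  next
    fix y assume y: "y \<in> carrier (aut_group Z) \<and> \<rho> t \<otimes>\<^bsub>aut_group Z\<^esub> y = \<one>\<^bsub>aut_group Z\<^esub> \<and> y \<otimes>\<^bsub>aut_group Z\<^esub> \<rho> t = \<one>\<^bsub>aut_group Z\<^esub>"
    then have yB: "y \<in> Bij Z" by (simp add: aut_group_def)
    then have "compose Z (\<rho> t) y = \<rho> 0" using y Bij[of t] one by (simp add: aut_group_def BijGroup_def)
    then have c: "compose Z (\<rho> t) y z = \<rho> 0 z" for z by simp
    show "y = \<rho> (- t)"
    proof
      fix z
      show "y z = \<rho> (- t) z"
      proof (cases "z \<in> Z")
        case True
        then have yz: "y z \<in> Z" using yB by (auto simp: Bij_def bij_betw_def)
        have "\<phi> t (y z) = z" using c[of z] True yz by (simp add: compose_def \<rho>Z flow_0[OF \<phi>])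
        then show ?thesis using flow_minus[OF \<phi> yz, of t] True by (simp add: \<rho>Z)
      next
        case False
        then show ?thesis using yB by (simp add: Bij_def \<rho>_def extensional_def)
      qed
    qed
  qed
  have sub: "subgroup H (aut_group Z)"
    by (rule subgroup.intro) (auto simp: H_def carrier mult minv one)
  have inj: "inj \<rho>"
  proof (rule injI)
    fix s t assume st: "\<rho> s = \<rho> t"
    obtain w c z1 where lin: "\<And>z t. z \<in> Z \<Longrightarrow> val (\<phi> t z) w = val z w + t * val z c"
      and "\<And>z t. z \<in> Z \<Longrightarrow> val (\<phi> t z) c = val z c"
      and z1: "z1 \<in> Z" "val z1 c \<noteq> 0"
      by (rule flow_slice[OF \<phi> nontrivial]) (rule that, simp_all)
    have "\<phi> s z1 = \<phi> t z1" using st z1(1) by (metis \<rho>Z)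
    then have "s * val z1 c = t * val z1 c" using lin[OF z1(1), of s] lin[OF z1(1), of t] by auto
    then show "s = t" using z1(2) by auto
  qed
  have "\<rho> \<in> iso additive_grp ((aut_group Z)\<lparr>carrier := H\<rparr>)"
    using inj by (auto simp: iso_def hom_def additive_grp_def bij_betw_def H_def mult)
  moreover have "morphism (variety_prod (UNIV :: ('k ^ 1) set) Z) Z (\<lambda>w. \<rho> (vec_left w $ 1) (vec_right w))"
  proof -
    obtain \<Phi> where \<Phi>: "\<And>t z i. z \<in> Z \<Longrightarrow> \<phi> t z $ i = tval t z (\<Phi> i)"
      using flow_poly[OF \<phi>] by blast
    have "\<rho> (vec_left w $ 1) (vec_right w) $ i = val w (\<Phi> i)"
      if wZ: "w \<in> variety_prod (UNIV :: ('k ^ 1) set) Z" for w i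
    proof -
      obtain x z where w: "w = vec_join x z" "z \<in> Z" using wZ by (auto simp: variety_prod_def)
      have "timed (x $ 1) z = ($) w"
        unfolding w(1) vec_join_nth by (rule ext) (simp split: sum.split)
      then show ?thesis using w by (simp add: \<rho>Z \<Phi>)
    qed
    moreover have "(\<lambda>w. \<rho> (vec_left w $ 1) (vec_right w)) \<in> variety_prod (UNIV :: ('k ^ 1) set) Z \<rightarrow> Z"
      by (auto simp: variety_prod_def \<rho>Z flow_in[OF \<phi>])
    ultimately show ?thesis unfolding morphism_def regular_fun_def by blast
  qed
  ultimately have "Ga_subgroup Z H" using sub by (auto simp: Ga_subgroup_def)
  moreover have "orbit_of H p = range (\<lambda>t. \<phi> t p)" if "p \<in> Z" for p
    using that by (auto simp: orbit_of_def H_def \<rho>Z image_iff)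
  ultimately show ?thesis by (rule that)
qed

text \<open>
  By \<open>orbit_tangent\<close>, the tangent space of an orbit is spanned by velocities. Conversely, a nonzero velocity
  belongs to a nontrivial flow, that is, to a \<open>G\<^sub>a\<close>-subgroup.
\<close>

lemma flexible_iff:
  fixes Z :: "('k::field_char_0 ^ 'n::finite) set"
  shows "flexible Z \<longleftrightarrow> (\<forall>p. smooth_point Z p \<longrightarrow> flexible_at Z p)"
proof -
  have "vec.span (\<Union>H\<in>{H. Ga_subgroup Z H}. tangent_space (orbit_of H p) p) = tangent_space Z p \<longleftrightarrow> flexible_at Z p"
    if p: "p \<in> Z" for p
  proof -
    let ?U = "\<Union>H\<in>{H. Ga_subgroup Z H}. tangent_space (orbit_of H p) p"
    let ?V = "{v. velocity Z p v}"
    have "?U \<subseteq> vec.span ?V"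
    proof (intro UN_least)
      fix H assume "H \<in> {H. Ga_subgroup Z H}"
      then have "Ga_subgroup Z H" by simp
      then obtain \<phi> where \<phi>: "flow Z \<phi>" and orb: "\<And>p. orbit_of H p = range (\<lambda>t. \<phi> t p)" by (rule Ga_subgroup_flow) (rule that, simp_all)
      show "tangent_space (orbit_of H p) p \<subseteq> vec.span ?V" unfolding orb by (rule orbit_tangent[OF \<phi> p])
    qed
    then have UV: "vec.span ?U \<subseteq> vec.span ?V" by (intro vec.span_minimal vec.subspace_span)
    have "?V \<subseteq> vec.span ?U"
    proof
      fix v assume "v \<in> ?V"
      then obtain \<phi> \<gamma> where \<phi>: "flow Z \<phi>" "\<And>t i. \<phi> t p $ i = poly (\<gamma> i) t" "\<And>i. v $ i = coeff (\<gamma> i) 1"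
        by (auto simp: velocity_def)
      show "v \<in> vec.span ?U"
      proof (cases "\<forall>t. \<phi> t p = p")
        case True
        have "\<gamma> i = [:p $ i:]" for i using \<phi>(2)[of _ i] True by (intro poly_eqI_infinite) simp
        then have "v = 0" using \<phi>(3) by (simp add: vec_eq_iff)
        then show ?thesis by (simp add: vec.span_zero)
      next
        case False
        then obtain a where "\<phi> a p \<noteq> p" by blast
        obtain H where H: "Ga_subgroup Z H" and orb: "\<And>p. p \<in> Z \<Longrightarrow> orbit_of H p = range (\<lambda>t. \<phi> t p)"
          by (rule flow_Ga_subgroup[OF \<phi>(1) p \<open>\<phi> a p \<noteq> p\<close>]) (rule that, simp_all)
        have "v \<in> tangent_space (orbit_of H p) (\<phi> 0 p)"
          by (rule curve_tangent[of "\<lambda>t. \<phi> t p" \<gamma>, OF \<phi>(2) _ \<phi>(3)]) (simp add: orb[OF p])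
        then have "v \<in> ?U" using H by (auto simp: flow_0[OF \<phi>(1) p])
        then show ?thesis by (rule vec.span_base)
      qed
    qed
    then have VU: "vec.span ?V \<subseteq> vec.span ?U" by (intro vec.span_minimal vec.subspace_span)
    have "?V \<subseteq> tangent_space Z p" using velocity_tangent[OF _ p] by blast
    then have "vec.span ?V \<subseteq> tangent_space Z p" by (rule vec.span_minimal[OF _ subspace_tangent_space])
    then show ?thesis using UV VU unfolding flexible_at_def by auto
  qed
  then show ?thesis unfolding flexible_def by (meson smooth_point_def)
qed

section \<open>Ideal, tangent spaces and dimension of a suspension\<close>

text \<open>
  Dedekind's argument, for functions \<open>ch \<alpha>\<close> that are multiplicative on a set \<open>G\<close> closed under the
  operation \<open>m\<close>.
\<close>

lemma characters_independent:
  fixes ch :: "'a \<Rightarrow> 'g \<Rightarrow> 'k::field"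
  assumes "finite A" "e \<in> G" "\<And>y z. y \<in> G \<Longrightarrow> z \<in> G \<Longrightarrow> m y z \<in> G"
    and mult: "\<And>\<alpha> y z. y \<in> G \<Longrightarrow> z \<in> G \<Longrightarrow> ch \<alpha> (m y z) = ch \<alpha> y * ch \<alpha> z"
    and one: "\<And>\<alpha>. ch \<alpha> e \<noteq> 0"
    and dist: "\<And>\<alpha> \<beta>. \<alpha> \<in> A \<Longrightarrow> \<beta> \<in> A \<Longrightarrow> \<alpha> \<noteq> \<beta> \<Longrightarrow> \<exists>y\<in>G. ch \<alpha> y \<noteq> ch \<beta> y"
    and sum: "\<And>y. y \<in> G \<Longrightarrow> (\<Sum>\<alpha>\<in>A. c \<alpha> * ch \<alpha> y) = 0"
  shows "\<forall>\<alpha>\<in>A. c \<alpha> = 0"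
  using assms(1) dist sum
proof (induction A arbitrary: c rule: finite_induct)
  case (insert \<beta> A)
  have A0: "c \<alpha> = 0" if \<alpha>: "\<alpha> \<in> A" for \<alpha>
  proof -
    obtain y0 where y0: "y0 \<in> G" "ch \<alpha> y0 \<noteq> ch \<beta> y0" using insert.prems(1)[of \<alpha> \<beta>] \<alpha> insert.hyps by auto
    have "(\<Sum>\<alpha>\<in>A. (c \<alpha> * (ch \<alpha> y0 - ch \<beta> y0)) * ch \<alpha> y) = 0" if y: "y \<in> G" for y
    proof -
      define u where "u = c \<beta> * (ch \<beta> y0 * ch \<beta> y)"
      have 1: "(\<Sum>\<alpha>\<in>A. c \<alpha> * (ch \<alpha> y0 * ch \<alpha> y)) + u = 0"
        using insert.prems(2)[OF assms(3)[OF y0(1) y]] insert.hyps by (simp add: mult[OF y0(1) y] add.commute u_def)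
      have "ch \<beta> y0 * ((\<Sum>\<alpha>\<in>A. c \<alpha> * ch \<alpha> y) + c \<beta> * ch \<beta> y) = 0"
        using insert.prems(2)[OF y] insert.hyps by (simp add: add.commute)
      then have 2: "ch \<beta> y0 * (\<Sum>\<alpha>\<in>A. c \<alpha> * ch \<alpha> y) + u = 0"
        by (simp add: u_def distrib_left mult.left_commute)
      have "(\<Sum>\<alpha>\<in>A. (c \<alpha> * (ch \<alpha> y0 - ch \<beta> y0)) * ch \<alpha> y) =
          (\<Sum>\<alpha>\<in>A. c \<alpha> * (ch \<alpha> y0 * ch \<alpha> y)) - ch \<beta> y0 * (\<Sum>\<alpha>\<in>A. c \<alpha> * ch \<alpha> y)"
        unfolding sum_distrib_left sum_subtractf[symmetric] by (rule sum.cong) (simp_all add: algebra_simps)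
      also have "\<dots> = ((\<Sum>\<alpha>\<in>A. c \<alpha> * (ch \<alpha> y0 * ch \<alpha> y)) + u) - (ch \<beta> y0 * (\<Sum>\<alpha>\<in>A. c \<alpha> * ch \<alpha> y) + u)"
        by (simp only: add_diff_cancel_right)
      finally show ?thesis unfolding 1 2 by simp
    qed
    then have "\<forall>\<alpha>\<in>A. c \<alpha> * (ch \<alpha> y0 - ch \<beta> y0) = 0" using insert.prems(1) by (intro insert.IH) auto
    then show ?thesis using \<alpha> y0 by auto
  qed
  moreover have "c \<beta> = 0" using insert.prems(2)[OF assms(2)] A0 insert.hyps one[of \<beta>] by simp
  ultimately show ?case by simp
qed simp

definition lift_left :: "('n, 'k::comm_ring_1) mpol \<Rightarrow> ('n + 'm, 'k) mpol" where
  "lift_left P = subst (\<lambda>i. mvar (Inl i)) P"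

lemma lift_left_simps [simp]:
  "lift_left (P + Q) = lift_left P + lift_left Q" "lift_left (P * Q) = lift_left P * lift_left Q"
  "lift_left (mconst c) = mconst c" "lift_left (mvar i) = mvar (Inl i)" "lift_left 0 = 0"
  by (simp_all add: lift_left_def)

lemma lift_left_1 [simp]: "lift_left 1 = 1"
  using lift_left_simps(3)[of 1] by simp

lemma eval_lift_left [simp]: "mpol_eval a (lift_left P) = mpol_eval (\<lambda>i. a (Inl i)) P"
  by (simp add: lift_left_def eval_subst)

lemma dirderiv_lift_left [simp]: "dirderiv (lift_left P) a v = dirderiv P (\<lambda>i. a (Inl i)) (\<lambda>i. v (Inl i))"
  by (simp add: lift_left_def dirderiv_subst)

lemma vec_join_Inl [simp]: "(\<lambda>i. vec_join x y $ Inl i) = ($) x"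
  and vec_join_Inr [simp]: "vec_join x y $ Inr j = y $ j"
  and vec_join_Inl' [simp]: "vec_join x y $ Inl i = x $ i"
  by (simp_all add: vec_join_def fun_eq_iff)

lemma vec_left_fun: "(\<lambda>i. u $ Inl i) = ($) (vec_left u)"
  by (simp add: vec_left_def fun_eq_iff)

lemma vec_right_nth: "u $ Inr j = vec_right u $ j"
  by (simp add: vec_right_def)

definition mono_right :: "('m::finite \<Rightarrow> nat) \<Rightarrow> ('n + 'm, 'k::comm_ring_1) mpol" where
  "mono_right \<alpha> = (\<Prod>j\<in>UNIV. mvar (Inr j) ^ \<alpha> j)"

lemma mono_right_add: "mono_right (\<lambda>j. \<alpha> j + \<beta> j) = mono_right \<alpha> * mono_right \<beta>"
  by (simp add: mono_right_def power_add prod.distrib)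

lemma mono_right_0 [simp]: "mono_right (\<lambda>j. 0) = 1"
  by (simp add: mono_right_def)

lemma eval_mono_right: "mpol_eval a (mono_right \<alpha>) = (\<Prod>j\<in>UNIV. a (Inr j) ^ \<alpha> j)"
  by (simp add: mono_right_def)

text \<open>
  The coordinate \<open>j1\<close> has weight one, so that the equation of the suspension reads \<open>y\<^sub>j\<^sub>1 Y = f(x)\<close>, where
  \<open>Y\<close> is a monomial in the other coordinates. Where \<open>Y\<close> does not vanish, the suspension is the graph of
  \<open>f / Y\<close>.
\<close>

locale suspension_data =
  fixes X :: "('k::field_char_0 ^ 'n::finite) set" and f :: "('n, 'k) mpol"
    and k :: "'m::finite \<Rightarrow> nat" and j1 :: 'm
  assumes X: "prime_set X" and f: "\<not> vanish X f" and kj1: "k j1 = 1" and k: "j \<noteq> j1 \<Longrightarrow> k j > 1"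
begin

abbreviation S where "S \<equiv> suspension X (\<lambda>x. val x f) k"

definition F :: "('n + 'm, 'k) mpol" where
  "F = mono_right k - lift_left f"

definition Y :: "('m \<Rightarrow> 'k) \<Rightarrow> 'k" where
  "Y y = (\<Prod>j\<in>UNIV - {j1}. y j ^ k j)"

abbreviation Y_at :: "'k ^ ('n + 'm) \<Rightarrow> 'k" where
  "Y_at w \<equiv> Y (($) (vec_right w))"

lemma prod_split: "(\<Prod>j\<in>UNIV. g j) = g j1 * (\<Prod>j\<in>UNIV - {j1}. g j)" for g :: "'m \<Rightarrow> 'b::comm_monoid_mult"
  by (rule prod.remove) auto

lemma prod_k: "(\<Prod>j\<in>UNIV. y j ^ k j) = y j1 * Y y"
  by (subst prod_split) (simp add: kj1 Y_def)

lemma mem_S: "vec_join x y \<in> S \<longleftrightarrow> x \<in> X \<and> y $ j1 * Y (($) y) = val x f"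
proof -
  have "vec_join x y = vec_join x' y' \<longleftrightarrow> x = x' \<and> y = y'" for x' and y'
    by (metis vec_left_join vec_right_join)
  then show ?thesis by (auto simp: suspension_def prod_k)
qed

lemma mem_S': "w \<in> S \<longleftrightarrow> vec_left w \<in> X \<and> vec_right w $ j1 * Y_at w = val (vec_left w) f"
  using mem_S[of "vec_left w" "vec_right w"] by (simp add: vec_join_surj)

lemma eval_F: "mpol_eval a F = a (Inr j1) * Y (\<lambda>j. a (Inr j)) - mpol_eval (\<lambda>i. a (Inl i)) f"
  by (simp add: F_def eval_mono_right prod_k)

lemma eval_F_S: "w \<in> S \<Longrightarrow> val w F = 0"
  by (simp add: mem_S' eval_F vec_left_fun vec_right_nth)

text \<open>
  The exponents of monomials that are not divisible by the monomial of the equation.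
\<close>

definition reduced :: "('m \<Rightarrow> nat) \<Rightarrow> bool" where
  "reduced \<alpha> \<longleftrightarrow> (\<exists>j. \<alpha> j < k j)"

definition normal_form :: "('n + 'm, 'k) mpol \<Rightarrow> bool" where
  "normal_form Q \<longleftrightarrow> (\<exists>I q A. finite I \<and> (\<forall>\<alpha>\<in>I. reduced \<alpha>) \<and> Q = (\<Sum>\<alpha>\<in>I. lift_left (q \<alpha>) * mono_right \<alpha>) + F * A)"

lemma normal_form_add:
  assumes "normal_form P" "normal_form Q" shows "normal_form (P + Q)"
proof -
  obtain I p A where P: "finite I" "\<forall>\<alpha>\<in>I. reduced \<alpha>" "P = (\<Sum>\<alpha>\<in>I. lift_left (p \<alpha>) * mono_right \<alpha>) + F * A"
    using assms(1) by (auto simp: normal_form_def)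
  obtain J q B where Q: "finite J" "\<forall>\<alpha>\<in>J. reduced \<alpha>" "Q = (\<Sum>\<alpha>\<in>J. lift_left (q \<alpha>) * mono_right \<alpha>) + F * B"
    using assms(2) by (auto simp: normal_form_def)
  define r where "r \<alpha> = (if \<alpha> \<in> I then p \<alpha> else 0) + (if \<alpha> \<in> J then q \<alpha> else 0)" for \<alpha>
  have 1: "(\<Sum>\<alpha>\<in>I. lift_left (p \<alpha>) * mono_right \<alpha>) = (\<Sum>\<alpha>\<in>I \<union> J. lift_left (if \<alpha> \<in> I then p \<alpha> else 0) * (mono_right \<alpha> :: ('n + 'm, 'k) mpol))"
    by (rule sum.mono_neutral_cong_left) (use P(1) Q(1) in auto)
  have 2: "(\<Sum>\<alpha>\<in>J. lift_left (q \<alpha>) * mono_right \<alpha>) = (\<Sum>\<alpha>\<in>I \<union> J. lift_left (if \<alpha> \<in> J then q \<alpha> else 0) * (mono_right \<alpha> :: ('n + 'm, 'k) mpol))"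
    by (rule sum.mono_neutral_cong_left) (use P(1) Q(1) in auto)
  have "P + Q = (\<Sum>\<alpha>\<in>I \<union> J. lift_left (r \<alpha>) * mono_right \<alpha>) + F * (A + B)"
    unfolding P(3) Q(3) 1 2 r_def by (simp add: algebra_simps sum.distrib)
  then show ?thesis unfolding normal_form_def using P(1,2) Q(1,2)
    by (intro exI[of _ "I \<union> J"] exI[of _ r] exI[of _ "A + B"]) auto
qed

lemma normal_form_F: "normal_form (F * A)"
  unfolding normal_form_def by (intro exI[of _ "{}"] exI[of _ "\<lambda>_. 0"] exI[of _ A]) simp

lemma normal_form_sum: "(\<And>x. x \<in> I \<Longrightarrow> normal_form (g x)) \<Longrightarrow> normal_form (sum g I)"
  using normal_form_F[of 0] by (induction I rule: infinite_finite_induct) (auto intro: normal_form_add)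

text \<open>
  Dividing by the monomial of the equation lowers the degree and multiplies the coefficient by \<open>f\<close>,
  modulo \<open>F\<close>.
\<close>

lemma normal_form_monomial: "normal_form (lift_left c * mono_right \<alpha>)"
proof (induction "sum \<alpha> UNIV" arbitrary: \<alpha> c rule: less_induct)
  case less
  show ?case
  proof (cases "reduced \<alpha>")
    case True
    then show ?thesis unfolding normal_form_def
      by (intro exI[of _ "{\<alpha>}"] exI[of _ "\<lambda>_. c"] exI[of _ 0]) simp
  next
    case False
    define \<beta> where "\<beta> j = \<alpha> j - k j" for j
    have \<alpha>: "\<alpha> = (\<lambda>j. \<beta> j + k j)" using False by (auto simp: fun_eq_iff \<beta>_def reduced_def not_less)
    have "sum \<beta> UNIV < sum \<alpha> UNIV"
      unfolding \<alpha> using member_le_sum[of j1 UNIV k] kj1 by (simp add: sum.distrib)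
    then have "normal_form (lift_left (c * f) * mono_right \<beta>)" by (rule less)
    moreover have "lift_left c * mono_right \<alpha> = lift_left (c * f) * mono_right \<beta> + F * (lift_left c * mono_right \<beta>)"
      unfolding \<alpha> mono_right_add by (simp add: F_def algebra_simps)
    ultimately show ?thesis using normal_form_add normal_form_F by metis
  qed
qed

lemma normal_form_all: "normal_form Q"
proof (induction Q rule: mpol_induct)
  case (const c)
  show ?case using normal_form_monomial[of "mconst c" "\<lambda>_. 0"] by simp
next
  case (var i)
  show ?case
  proof (cases i)
    case (Inl i)
    then show ?thesis using normal_form_monomial[of "mvar i" "\<lambda>_. 0"] by simp
  next
    case (Inr j)
    have "mono_right (\<lambda>i. if i = j then 1 else 0) = (mvar (Inr j) :: ('n + 'm, 'k) mpol)"
    proof -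
      have "mono_right (\<lambda>i. if i = j then 1 else 0) = (\<Prod>i\<in>UNIV. if i = j then mvar (Inr i) else (1 :: ('n + 'm, 'k) mpol))"
        unfolding mono_right_def by (rule prod.cong) auto
      then show ?thesis by simp
    qed
    then show ?thesis using normal_form_monomial[of 1 "\<lambda>i. if i = j then 1 else 0"] Inr by simp
  qed
next
  case (add P Q) then show ?case by (rule normal_form_add)
next
  case (mult P Q)
  obtain I p A where P: "P = (\<Sum>\<alpha>\<in>I. lift_left (p \<alpha>) * mono_right \<alpha>) + F * A"
    using mult(1) by (auto simp: normal_form_def)
  obtain J q B where Q: "Q = (\<Sum>\<alpha>\<in>J. lift_left (q \<alpha>) * mono_right \<alpha>) + F * B"
    using mult(2) by (auto simp: normal_form_def)
  define P0 :: "('n + 'm, 'k) mpol" where "P0 = (\<Sum>\<alpha>\<in>I. lift_left (p \<alpha>) * mono_right \<alpha>)"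
  define Q0 :: "('n + 'm, 'k) mpol" where "Q0 = (\<Sum>\<alpha>\<in>J. lift_left (q \<alpha>) * mono_right \<alpha>)"
  have "P0 * Q0 = (\<Sum>\<alpha>\<in>I. \<Sum>\<beta>\<in>J. lift_left (p \<alpha> * q \<beta>) * mono_right (\<lambda>j. \<alpha> j + \<beta> j))"
    unfolding P0_def Q0_def sum_product mono_right_add by (simp add: ac_simps)
  then have "normal_form (P0 * Q0)" by (simp only:) (intro normal_form_sum normal_form_monomial)
  moreover have "P * Q = P0 * Q0 + F * (A * Q0 + P0 * B + F * A * B)"
    unfolding P Q P0_def[symmetric] Q0_def[symmetric] by (simp add: algebra_simps)
  ultimately show ?case using normal_form_add normal_form_F by metis
qed

lemma two_power_inj: "(2 :: 'k) ^ a = 2 ^ b \<longleftrightarrow> a = b"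
proof -
  have "(2 :: 'k) ^ n = of_nat (2 ^ n)" for n by simp
  then show ?thesis by (metis of_nat_eq_iff power_inject_exp one_less_numeral_iff semiring_norm(76))
qed

lemma Y_nonzero: "Y y \<noteq> 0 \<longleftrightarrow> (\<forall>j. j \<noteq> j1 \<longrightarrow> y j \<noteq> 0)"
proof -
  have "k j \<noteq> 0" if "j \<noteq> j1" for j using k[OF that] by simp
  then show ?thesis by (auto simp: Y_def)
qed

lemma Y_upd [simp]: "Y (y(j1 := c)) = Y y"
  unfolding Y_def by (rule prod.cong) auto

text \<open>
  Fix \<open>x\<close> with \<open>f(x) \<noteq> 0\<close>, and eliminate \<open>y\<^sub>j\<^sub>1\<close> where \<open>Y\<close> is nonzero. The reduced monomials become
  distinct characters of the torus, because the exponents that give the same character differ by multiples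
  of \<open>k\<close>. Hence all coefficients of a normal form vanish at \<open>x\<close>, and then on \<open>X\<close>. So the ideal of the
  suspension is generated by \<open>F\<close> and the ideal of \<open>X\<close>.
\<close>

lemma ideal_of_S:
  assumes van: "\<And>x y. vec_join x y \<in> S \<Longrightarrow> Y (($) y) \<noteq> 0 \<Longrightarrow> val (vec_join x y) Q = 0"
  obtains I q A where "\<And>\<alpha>. \<alpha> \<in> I \<Longrightarrow> vanish X (q \<alpha>)" "Q = (\<Sum>\<alpha>\<in>I. lift_left (q \<alpha>) * mono_right \<alpha>) + F * A"
proof -
  obtain I q A where I: "finite I" "\<And>\<alpha>. \<alpha> \<in> I \<Longrightarrow> reduced \<alpha>" and Q: "Q = (\<Sum>\<alpha>\<in>I. lift_left (q \<alpha>) * mono_right \<alpha>) + F * A"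
    using normal_form_all[of Q] by (auto simp: normal_form_def)
  have qx: "val x (q \<alpha>) = 0" if x: "x \<in> X" "val x f \<noteq> 0" and \<alpha>: "\<alpha> \<in> I" for x \<alpha>
  proof -
    \<comment> \<open>The coefficients are absorbed into \<open>q(x) f(x)\<^sup>\<alpha>\<close>, the exponent being \<open>\<alpha> j1\<close>; negative powers of \<open>Y\<close> are allowed.\<close>
    define l where "l = val x f"
    define G where "G = {y :: 'm \<Rightarrow> 'k. \<forall>j. y j \<noteq> 0}"
    define ch where "ch \<alpha> y = inverse (Y y) ^ \<alpha> j1 * (\<Prod>j\<in>UNIV - {j1}. y j ^ \<alpha> j)" for \<alpha> :: "'m \<Rightarrow> nat" and y
    have "\<forall>\<alpha>\<in>I. val x (q \<alpha>) * l ^ \<alpha> j1 = 0"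
    proof (rule characters_independent[of I "\<lambda>_. 1" G "\<lambda>y z j. y j * z j" ch])
      show "finite I" by fact
      show "(\<lambda>_. 1) \<in> G" by (simp add: G_def)
      show "(\<lambda>j. y j * z j) \<in> G" if "y \<in> G" "z \<in> G" for y z using that by (simp add: G_def)
      show "ch \<alpha> (\<lambda>j. y j * z j) = ch \<alpha> y * ch \<alpha> z" for \<alpha> y z
        by (simp add: ch_def Y_def power_mult_distrib prod.distrib)
      show "ch \<alpha> (\<lambda>_. 1) \<noteq> 0" for \<alpha> by (simp add: ch_def Y_def)
    next
      fix \<alpha> \<beta> assume ab: "\<alpha> \<in> I" "\<beta> \<in> I" "\<alpha> \<noteq> \<beta>"
      show "\<exists>y\<in>G. ch \<alpha> y \<noteq> ch \<beta> y"
      proof (rule ccontr)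
        assume "\<not> ?thesis"
        then have eq: "ch \<alpha> y = ch \<beta> y" if "y \<in> G" for y using that by blast
        have rel: "\<alpha> j + k j * \<beta> j1 = \<beta> j + k j * \<alpha> j1" if j: "j \<noteq> j1" for j
        proof -
          define y :: "'m \<Rightarrow> 'k" where "y i = (if i = j then 2 else 1)" for i
          have pr: "(\<Prod>i\<in>UNIV - {j1}. y i ^ \<gamma> i) = 2 ^ \<gamma> j" for \<gamma> :: "'m \<Rightarrow> nat"
          proof -
            have "(\<Prod>i\<in>UNIV - {j1}. y i ^ \<gamma> i) = (\<Prod>i\<in>UNIV - {j1}. if i = j then 2 ^ \<gamma> i else 1)"
              by (rule prod.cong) (auto simp: y_def)
            then show ?thesis using j by simp
          qed
          have "y \<in> G" by (simp add: G_def y_def)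
          then have "inverse (2 ^ k j) ^ \<alpha> j1 * 2 ^ \<alpha> j = inverse (2 ^ k j) ^ \<beta> j1 * (2 :: 'k) ^ \<beta> j"
            using eq[of y] by (simp add: ch_def Y_def pr)
          then have "(2 :: 'k) ^ \<alpha> j * (2 ^ k j) ^ \<beta> j1 = 2 ^ \<beta> j * (2 ^ k j) ^ \<alpha> j1"
            by (simp add: field_simps power_inverse)
          then have "(2 :: 'k) ^ (\<alpha> j + k j * \<beta> j1) = 2 ^ (\<beta> j + k j * \<alpha> j1)"
            by (simp add: power_add power_mult)
          then show ?thesis by (simp only: two_power_inj)
        qed
        \<comment> \<open>If the entries at \<open>j1\<close> differ, then the larger exponent is at least \<open>k\<close> everywhere.\<close>
        have big: "\<not> reduced \<gamma>" if "\<delta> j1 < \<gamma> j1" and r: "\<And>j. j \<noteq> j1 \<Longrightarrow> \<gamma> j + k j * \<delta> j1 = \<delta> j + k j * \<gamma> j1" for \<gamma> \<delta>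
        proof -
          have "k j \<le> \<gamma> j" for j
          proof (cases "j = j1")
            case True then show ?thesis using that(1) kj1 by simp
          next
            case False
            have "k j * \<delta> j1 + k j \<le> k j * \<gamma> j1" using that(1) by (metis Suc_leI mult_Suc_right mult_le_mono2 add.commute)
            then show ?thesis using r[OF False] by linarith
          qed
          then show ?thesis by (auto simp: reduced_def not_less)
        qed
        have "\<alpha> j1 = \<beta> j1"
          using big[of \<alpha> \<beta>] big[of \<beta> \<alpha>] rel I(2)[OF ab(1)] I(2)[OF ab(2)] by (metis linorder_less_linear)
        then have "\<alpha> j = \<beta> j" for j using rel[of j] by (cases "j = j1") auto
        then show False using ab(3) by auto
      qed
    next
      fix y assume y: "y \<in> G"
      then have Y0: "Y y \<noteq> 0" by (simp add: Y_nonzero G_def)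
      define y' where "y' = (\<chi> j. (y(j1 := l / Y y)) j)"
      have y'f: "($) y' = y(j1 := l / Y y)" by (simp add: y'_def fun_eq_iff)
      have "vec_join x y' \<in> S" using Y0 x by (simp add: mem_S y'f l_def)
      then have "val (vec_join x y') (Q - F * A) = 0"
        using van[of x y'] Y0 eval_F_S[of "vec_join x y'"] by (simp add: y'f)
      moreover have "Q - F * A = (\<Sum>\<alpha>\<in>I. lift_left (q \<alpha>) * mono_right \<alpha>)" by (simp add: Q)
      ultimately have s: "(\<Sum>\<alpha>\<in>I. val x (q \<alpha>) * (\<Prod>j\<in>UNIV. (y(j1 := l / Y y)) j ^ \<alpha> j)) = 0"
        by (simp add: eval_mono_right y'_def)
      have "(\<Prod>j\<in>UNIV. (y(j1 := l / Y y)) j ^ \<alpha> j) = l ^ \<alpha> j1 * ch \<alpha> y" for \<alpha>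
      proof -
        have "(\<Prod>j\<in>UNIV - {j1}. (y(j1 := l / Y y)) j ^ \<alpha> j) = (\<Prod>j\<in>UNIV - {j1}. y j ^ \<alpha> j)"
          by (rule prod.cong) auto
        then show ?thesis by (subst prod_split) (simp add: ch_def power_divide power_inverse field_simps)
      qed
      then show "(\<Sum>\<alpha>\<in>I. val x (q \<alpha>) * l ^ \<alpha> j1 * ch \<alpha> y) = 0"
        using s by (simp add: mult.assoc)
    qed
    then show ?thesis using \<alpha> x(2) by (simp add: l_def)
  qed
  have "vanish X (q \<alpha>)" if "\<alpha> \<in> I" for \<alpha>
  proof -
    have "vanish X (f * q \<alpha>)" using qx that by (auto simp: vanish_at_def)
    then show ?thesis using X f unfolding prime_set_def by blast
  qed
  then show ?thesis using Q that by blast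
qed

end

text \<open>
  Irreducibility of \<open>X \<times> K\<^sup>m\<close>: some \<open>x \<in> X\<close> is good for two given fibre points at once, and the line
  that joins them in the fibre over \<open>x\<close> is irreducible.
\<close>

lemma prime_cylinder:
  fixes X :: "('k::field_char_0 ^ 'n::finite) set" and P Q :: "('n + 'm::finite, 'k) mpol"
  assumes X: "prime_set X" and PQ: "vanish {w. vec_left w \<in> X} (P * Q)"
  shows "vanish {w. vec_left w \<in> X} P \<or> vanish {w. vec_left w \<in> X} Q"
proof (rule ccontr)
  assume "\<not> ?thesis"
  then obtain w1 w2 where w: "vec_left w1 \<in> X" "val w1 P \<noteq> 0" "vec_left w2 \<in> X" "val w2 Q \<noteq> 0"
    by (auto simp: vanish_at_def)
  define x1 y1 x2 y2 where xy: "x1 = vec_left w1" "y1 = vec_right w1" "x2 = vec_left w2" "y2 = vec_right w2"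
  define R :: "'k ^ 'm \<Rightarrow> ('n + 'm, 'k) mpol \<Rightarrow> ('n, 'k) mpol" where
    "R y = subst (case_sum mvar (\<lambda>j. mconst (y $ j)))" for y
  have R: "val x (R y P) = val (vec_join x y) P" for x :: "'k ^ 'n" and y and P :: "('n + 'm, 'k) mpol"
    unfolding R_def eval_subst vec_join_nth by (rule mpol_eval_cong) (simp split: sum.split)
  have "\<not> vanish X (R y1 P)" "\<not> vanish X (R y2 Q)"
  proof -
    have "val x1 (R y1 P) \<noteq> 0" "val x2 (R y2 Q) \<noteq> 0"
      using w by (simp_all add: R xy vec_join_surj)
    then show "\<not> vanish X (R y1 P)" "\<not> vanish X (R y2 Q)" using w(1,3) xy by (auto simp: vanish_at_def)
  qed
  then obtain x where x: "x \<in> X" "val (vec_join x y1) P \<noteq> 0" "val (vec_join x y2) Q \<noteq> 0"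
    using prime_setD[OF X] R by metis
  define \<gamma> where "\<gamma> = case_sum (\<lambda>i. [:x $ i:]) (\<lambda>j. [:y1 $ j, y2 $ j - y1 $ j:])"
  define c where "c t = vec_join x (y1 + t *s (y2 - y1))" for t
  have c: "c t $ i = poly (\<gamma> i) t" for t i
    by (cases i) (simp_all add: c_def \<gamma>_def algebra_simps)
  have "poly (along \<gamma> P * along \<gamma> Q) t = poly 0 t" for t
    using PQ x(1) by (simp add: vanish_at_def c_def flip: along_curve[OF c])
  then have "along \<gamma> P * along \<gamma> Q = 0" by (rule poly_eqI_infinite)
  then have "along \<gamma> P = 0 \<or> along \<gamma> Q = 0" by simp
  moreover have "c 0 = vec_join x y1" "c 1 = vec_join x y2" by (simp_all add: c_def)
  ultimately show False
    using x(2,3) along_curve[OF c, of 0 P] along_curve[OF c, of 1 Q] by auto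
qed

lemma dim_cylinder:
  fixes T :: "('k::field ^ 'n::finite) set"
  assumes T: "vec.subspace T"
  shows "vec.dim {u :: 'k ^ ('n + 'm::finite). vec_left u \<in> T} = vec.dim T + CARD('m)"
proof -
  define i1 :: "'k ^ 'n \<Rightarrow> 'k ^ ('n + 'm)" where "i1 x = vec_join x 0" for x
  define i2 :: "'k ^ 'm \<Rightarrow> 'k ^ ('n + 'm)" where "i2 y = vec_join 0 y" for y
  have l1: "Vector_Spaces.linear (*s) (*s) i1"
    by unfold_locales (auto simp: i1_def vec_join_def vec_eq_iff split: sum.split)
  have l2: "Vector_Spaces.linear (*s) (*s) i2"
    by unfold_locales (auto simp: i2_def vec_join_def vec_eq_iff split: sum.split)
  have inj1: "inj i1" by (rule injI) (metis i1_def vec_left_join)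
  have inj2: "inj i2" by (rule injI) (metis i2_def vec_right_join)
  have d1: "vec.dim (i1 ` T) = vec.dim T"
    by (rule vec.dim_image_eq[OF l1]) (rule inj_on_subset[OF inj1], simp)
  have d2: "vec.dim (range i2) = CARD('m)"
  proof -
    have "vec.dim (i2 ` UNIV) = vec.dim (UNIV :: ('k ^ 'm) set)"
      by (rule vec.dim_image_eq[OF l2]) (rule inj_on_subset[OF inj2], simp)
    then show ?thesis by (simp add: vec_dim_card card_cart_basis)
  qed
  have s1: "vec.subspace (i1 ` T)" by (rule vec.linear_subspace_image[OF l1 T])
  have s2: "vec.subspace (range i2)" by (rule vec.linear_subspace_image[OF l2 vec.subspace_UNIV])
  have "{u :: 'k ^ ('n + 'm). vec_left u \<in> T} = {x + y |x y. x \<in> i1 ` T \<and> y \<in> range i2}"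
  proof (intro equalityI subsetI)
    fix u :: "'k ^ ('n + 'm)" assume "u \<in> {u. vec_left u \<in> T}"
    moreover have "u = i1 (vec_left u) + i2 (vec_right u)"
      by (auto simp: i1_def i2_def vec_join_def vec_left_def vec_right_def vec_eq_iff split: sum.split)
    ultimately show "u \<in> {x + y |x y. x \<in> i1 ` T \<and> y \<in> range i2}" by blast
  next
    fix u assume "u \<in> {x + y |x y. x \<in> i1 ` T \<and> y \<in> range i2}"
    then obtain x y where "x \<in> T" "u = i1 x + i2 y" by blast
    moreover have "vec_left (i1 x + i2 y) = x"
      by (simp add: i1_def i2_def vec_join_def vec_left_def vec_eq_iff)
    ultimately show "u \<in> {u. vec_left u \<in> T}" by simp
  qed
  moreover have "i1 ` T \<inter> range i2 = {0}"
  proof (intro equalityI subsetI)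
    fix u assume "u \<in> i1 ` T \<inter> range i2"
    then obtain x y where xy: "u = vec_join x 0" "u = vec_join 0 y" unfolding i1_def i2_def by blast
    then have "x = 0" by (metis vec_left_join)
    then show "u \<in> {0}" using xy(1) by (auto simp: vec_join_def vec_eq_iff split: sum.split)
  next
    fix u :: "'k ^ ('n + 'm)" assume "u \<in> {0}"
    then show "u \<in> i1 ` T \<inter> range i2" using vec.subspace_0[OF s1] vec.subspace_0[OF s2] by simp
  qed
  ultimately show ?thesis using vec.dim_sums_Int[OF s1 s2] d1 d2 by simp
qed

context suspension_data
begin

definition YP :: "('n + 'm, 'k) mpol" where
  "YP = (\<Prod>j\<in>UNIV - {j1}. mvar (Inr j) ^ k j)"

lemma eval_YP: "val w YP = Y_at w"
  by (simp add: YP_def Y_def vec_right_nth)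

text \<open>
  By \<open>ideal_of_S\<close>, such a polynomial lies in the ideal generated by \<open>F\<close> and the ideal of \<open>X\<close>.
\<close>

lemma vanish_S_dense:
  assumes van: "\<And>w. w \<in> S \<Longrightarrow> Y_at w \<noteq> 0 \<Longrightarrow> val w Q = 0"
  shows "vanish S Q"
proof -
  obtain I q A where q: "\<And>\<alpha>. \<alpha> \<in> I \<Longrightarrow> vanish X (q \<alpha>)" "Q = (\<Sum>\<alpha>\<in>I. lift_left (q \<alpha>) * mono_right \<alpha>) + F * A"
    by (rule ideal_of_S[of Q]) (use van in \<open>simp, blast\<close>)
  show ?thesis unfolding vanish_at_def
  proof
    fix w assume w: "w \<in> S"
    then have "vec_left w \<in> X" by (simp add: mem_S')
    then show "val w Q = 0"
      using q(1) w by (simp add: q(2) eval_F_S vec_left_fun vanish_at_def)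
  qed
qed

lemma tangent_space_S:
  assumes w: "w \<in> S"
  shows "tangent_space S w = {u. vec_left u \<in> tangent_space X (vec_left w) \<and> dval F w u = 0}"
proof (intro equalityI subsetI CollectI conjI)
  fix u assume u: "u \<in> tangent_space S w"
  show "vec_left u \<in> tangent_space X (vec_left w)"
    unfolding tangent_space_eq
  proof (intro CollectI allI impI)
    fix P assume P: "vanish X P"
    have "vanish S (lift_left P)" using P by (auto simp: vanish_at_def vec_left_fun mem_S')
    then have "dval (lift_left P) w u = 0" using u unfolding tangent_space_eq by blast
    then show "dval P (vec_left w) (vec_left u) = 0" by (simp add: vec_left_fun)
  qed
  have "vanish S F" by (simp add: vanish_at_def eval_F_S)
  then show "dval F w u = 0" using u unfolding tangent_space_eq by blast
next
  fix u assume u: "u \<in> {u. vec_left u \<in> tangent_space X (vec_left w) \<and> dval F w u = 0}"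
  show "u \<in> tangent_space S w"
    unfolding tangent_space_eq
  proof (intro CollectI allI impI)
    fix Q assume Q: "vanish S Q"
    obtain I q A where q: "\<And>\<alpha>. \<alpha> \<in> I \<Longrightarrow> vanish X (q \<alpha>)" "Q = (\<Sum>\<alpha>\<in>I. lift_left (q \<alpha>) * mono_right \<alpha>) + F * A"
      by (rule ideal_of_S[of Q]) (use Q in \<open>simp add: vanish_at_def, blast\<close>)
    have "dval (q \<alpha>) (vec_left w) (vec_left u) = 0" if "\<alpha> \<in> I" for \<alpha>
      using u q(1)[OF that] by (simp add: tangent_space_eq)
    moreover have "val (vec_left w) (q \<alpha>) = 0" if "\<alpha> \<in> I" for \<alpha>
      using w q(1)[OF that] by (simp add: vanish_at_def mem_S')
    ultimately show "dval Q w u = 0"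
      using u by (simp add: q(2) eval_F_S[OF w] vec_left_fun)
  qed
qed

lemma zariski_closed_S:
  assumes "zariski_closed X" shows "zariski_closed S"
proof -
  obtain E where E: "X = {x. \<forall>P\<in>E. val x P = 0}" using assms by (auto simp: zariski_closed_def)
  have "S = {w. \<forall>P\<in>insert F (lift_left ` E). val w P = 0}"
  proof (rule Set.set_eqI)
    fix w :: "'k ^ ('n + 'm)"
    have "vec_left w \<in> X \<longleftrightarrow> (\<forall>P\<in>E. val (vec_left w) P = 0)" unfolding E by blast
    then show "w \<in> S \<longleftrightarrow> w \<in> {w. \<forall>P\<in>insert F (lift_left ` E). val w P = 0}"
      by (auto simp: mem_S' eval_F vec_left_fun vec_right_nth)
  qed
  then show ?thesis unfolding zariski_closed_def by blast
qed

definition solve :: "'k ^ ('n + 'm) \<Rightarrow> 'k ^ ('n + 'm)" where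
  "solve w = vec_join (vec_left w)
     (\<chi> j. if j = j1 then val (vec_left w) f / Y_at w else vec_right w $ j)"

lemma Y_solve [simp]: "Y_at (solve w) = Y_at w"
  unfolding solve_def vec_right_join Y_def by (rule prod.cong) auto

lemma solve_in_S: "vec_left w \<in> X \<Longrightarrow> Y_at w \<noteq> 0 \<Longrightarrow> solve w \<in> S"
  using Y_solve[of w] by (simp add: mem_S') (simp add: solve_def)

lemma solve_S: "w \<in> S \<Longrightarrow> Y_at w \<noteq> 0 \<Longrightarrow> solve w = w"
proof -
  assume w: "w \<in> S" "Y_at w \<noteq> 0"
  have "(\<chi> j. if j = j1 then val (vec_left w) f / Y_at w else vec_right w $ j) = vec_right w"
    using w by (auto simp: vec_eq_iff mem_S' field_simps)
  then show ?thesis by (simp add: solve_def vec_join_surj)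
qed

lemma clear_denominator:
  "\<exists>D Q'. \<forall>w. Y_at w \<noteq> 0 \<longrightarrow> val w Q' = Y_at w ^ D * val (solve w) Q"
proof (induction Q rule: mpol_induct)
  case (const c) show ?case by (intro exI[of _ 0] exI[of _ "mconst c"]) simp
next
  case (var i)
  show ?case
  proof (cases "i = Inr j1")
    case True
    then show ?thesis
      by (intro exI[of _ 1] exI[of _ "lift_left f"]) (simp add: solve_def vec_left_fun)
  next
    case False
    then show ?thesis
      by (intro exI[of _ 0] exI[of _ "mvar i"], cases i) (auto simp: solve_def vec_right_nth vec_left_def)
  qed
next
  case (add P Q)
  obtain D P' where P: "\<And>w. Y_at w \<noteq> 0 \<Longrightarrow> val w P' = Y_at w ^ D * val (solve w) P"
    using add.IH(1) by blast
  obtain E Q' where Q: "\<And>w. Y_at w \<noteq> 0 \<Longrightarrow> val w Q' = Y_at w ^ E * val (solve w) Q"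
    using add.IH(2) by blast
  show ?case
    by (intro exI[of _ "D + E"] exI[of _ "YP ^ E * P' + YP ^ D * Q'"]) (simp add: P Q eval_YP power_add algebra_simps)
next
  case (mult P Q)
  obtain D P' where P: "\<And>w. Y_at w \<noteq> 0 \<Longrightarrow> val w P' = Y_at w ^ D * val (solve w) P"
    using mult.IH(1) by blast
  obtain E Q' where Q: "\<And>w. Y_at w \<noteq> 0 \<Longrightarrow> val w Q' = Y_at w ^ E * val (solve w) Q"
    using mult.IH(2) by blast
  show ?case
    by (intro exI[of _ "D + E"] exI[of _ "P' * Q'"]) (simp add: P Q power_add algebra_simps)
qed

lemma S_lift_nonzero:
  assumes "\<not> vanish X P"
  obtains w where "w \<in> S" "Y_at w \<noteq> 0" "val (vec_left w) P \<noteq> 0"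
proof -
  obtain x where x: "x \<in> X" "val x P \<noteq> 0" using assms by (auto simp: vanish_at_def)
  let ?w = "vec_join x (\<chi> j. 1)"
  have Y1: "Y_at ?w \<noteq> 0" by (simp add: Y_def)
  show ?thesis by (rule that[of "solve ?w"]) (use x Y1 in \<open>simp_all add: solve_in_S\<close>, simp add: solve_def)
qed

text \<open>
  Clearing denominators in \<open>y\<^sub>j\<^sub>1 = f / Y\<close> reduces the irreducibility to that of the cylinder over \<open>X\<close>.
\<close>

lemma prime_S: "prime_set S"
  unfolding prime_set_def
proof (intro conjI allI impI)
  show "S \<noteq> {}" using S_lift_nonzero[OF f] by blast
next
  fix P Q assume PQ: "vanish S (P * Q)"
  let ?C = "{w :: 'k ^ ('n + 'm). vec_left w \<in> X}"
  obtain D P' where P: "\<And>w. Y_at w \<noteq> 0 \<Longrightarrow> val w P' = Y_at w ^ D * val (solve w) P"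
    using clear_denominator[of P] by blast
  obtain E Q' where Q: "\<And>w. Y_at w \<noteq> 0 \<Longrightarrow> val w Q' = Y_at w ^ E * val (solve w) Q"
    using clear_denominator[of Q] by blast
  have "vanish ?C ((YP * P') * Q')" unfolding vanish_at_def
  proof
    fix w :: "'k ^ ('n + 'm)" assume w: "w \<in> ?C"
    show "val w ((YP * P') * Q') = 0"
    proof (cases "Y_at w = 0")
      case True then show ?thesis by (simp add: eval_YP)
    next
      case False
      then have "val (solve w) (P * Q) = 0" using PQ w solve_in_S by (simp add: vanish_at_def)
      then show ?thesis using P[OF False] Q[OF False] by auto
    qed
  qed
  from prime_cylinder[OF X this] show "vanish S P \<or> vanish S Q"
  proof
    assume v: "vanish ?C (YP * P')"
    have "vanish S P"
    proof (rule vanish_S_dense)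
      fix w assume w: "w \<in> S" "Y_at w \<noteq> 0"
      then have "val w (YP * P') = 0" using v by (simp add: vanish_at_def mem_S')
      then show "val w P = 0" using w P[OF w(2)] by (simp add: eval_YP solve_S)
    qed
    then show ?thesis ..
  next
    assume v: "vanish ?C Q'"
    have "vanish S Q"
    proof (rule vanish_S_dense)
      fix w assume w: "w \<in> S" "Y_at w \<noteq> 0"
      then have "val w Q' = 0" using v by (simp add: vanish_at_def mem_S')
      then show "val w Q = 0" using w Q[OF w(2)] by (simp add: solve_S)
    qed
    then show ?thesis ..
  qed
qed

definition e1 :: "'k ^ ('n + 'm)" where
  "e1 = vec_join 0 (axis j1 1)"

lemma dirderiv_F_e1: "dval F w e1 = Y_at w"
proof -
  let ?c = "\<lambda>t. w + t *s e1"
  have "e1 $ i = (if i = Inr j1 then 1 else 0)" for i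
    by (cases i) (auto simp: e1_def axis_def)
  then have r: "vec_right (?c t) $ j = (if j = j1 then vec_right w $ j1 + t else vec_right w $ j)"
    and l: "vec_left (?c t) = vec_left w" for t j
    by (auto simp: vec_right_def vec_left_def vec_eq_iff)
  have YY: "Y_at ((?c t)) = Y_at w" for t
    unfolding Y_def by (rule prod.cong) (auto simp: r)
  have r1: "vec_right (?c t) $ j1 = vec_right w $ j1 + t" for t by (simp add: r)
  have "val (?c t) F = poly [:vec_right w $ j1 * Y_at w - val (vec_left w) f, Y_at w:] t" for t
    unfolding eval_F vec_left_fun vec_right_nth l YY r1 by (simp add: algebra_simps)
  from curve_derivative[of ?c "\<lambda>i. [:w $ i, e1 $ i:]" F _ e1, OF _ this]
  show ?thesis by simp
qed

text \<open>
  The tangent space is the hyperplane \<open>dF = 0\<close> in the cylinder over the tangent space of \<open>X\<close>; it is a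
  proper one since it does not contain \<open>e1\<close>.
\<close>

lemma tangent_dim_S:
  assumes w: "w \<in> S" and Y: "Y_at w \<noteq> 0"
  shows "vec.dim (tangent_space S w) + 1 = vec.dim (tangent_space X (vec_left w)) + CARD('m)"
proof -
  let ?V = "{u :: 'k ^ ('n + 'm). vec_left u \<in> tangent_space X (vec_left w)}"
  let ?T = "tangent_space S w"
  have eV: "e1 \<in> ?V"
    by (simp add: e1_def vec.subspace_0 subspace_tangent_space)
  have addV: "x + c *s y \<in> ?V" if "x \<in> ?V" "y \<in> ?V" for x y c
  proof -
    have "vec_left (x + c *s y) = vec_left x + c *s vec_left y" by (simp add: vec_left_def vec_eq_iff)
    then show ?thesis using that
      by (simp add: vec.subspace_add vec.subspace_scale subspace_tangent_space)
  qed
  have sp: "vec.span ?T = ?T" by (simp only: vec.span_eq_iff subspace_tangent_space)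
  have "e1 \<notin> vec.span ?T"
    unfolding sp unfolding tangent_space_S[OF w] using Y by (simp add: dirderiv_F_e1)
  moreover have "vec.dim ?V = vec.dim (insert e1 ?T)"
  proof (rule antisym)
    have "?V \<subseteq> vec.span (insert e1 ?T)"
    proof
      fix u assume u: "u \<in> ?V"
      define c where "c = dval F w u / Y_at w"
      have "u + (- c) *s e1 \<in> ?T"
        using addV[OF u eV, of "- c"] Y by (simp only: tangent_space_S[OF w] mem_Collect_eq dirderiv_vec_add dirderiv_vec_scale dirderiv_F_e1) (simp add: c_def)
      then have "u + (- c) *s e1 \<in> vec.span (insert e1 ?T)" by (simp add: vec.span_base)
      moreover have "c *s e1 \<in> vec.span (insert e1 ?T)" by (simp add: vec.span_base vec.span_scale)
      ultimately have "(u + (- c) *s e1) + c *s e1 \<in> vec.span (insert e1 ?T)" by (rule vec.span_add)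
      moreover have "(u + (- c) *s e1) + c *s e1 = u" by (simp add: vec_eq_iff)
      ultimately show "u \<in> vec.span (insert e1 ?T)" by simp
    qed
    then show "vec.dim ?V \<le> vec.dim (insert e1 ?T)"
      using vec.dim_subset[of ?V "vec.span (insert e1 ?T)"] by simp
    show "vec.dim (insert e1 ?T) \<le> vec.dim ?V"
      by (rule vec.dim_subset) (use eV tangent_space_S[OF w] in auto)
  qed
  ultimately show ?thesis
    using dim_cylinder[OF subspace_tangent_space, of X "vec_left w", where 'm='m] by (simp add: vec.dim_insert)
qed

lemma variety_dim_S: "variety_dim S + 1 = variety_dim X + CARD('m)"
proof -
  obtain g where g: "\<not> vanish X g"
    "\<And>p. p \<in> X \<Longrightarrow> val p g \<noteq> 0 \<Longrightarrow> vec.dim (tangent_space X p) = variety_dim X"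
    using generic_point_dim[OF X] by blast
  obtain h where h: "\<not> vanish S h"
    "\<And>p. p \<in> S \<Longrightarrow> val p h \<noteq> 0 \<Longrightarrow> vec.dim (tangent_space S p) = variety_dim S"
    using generic_point_dim[OF prime_S] by blast
  obtain w0 where "w0 \<in> S" "Y_at w0 \<noteq> 0" "val (vec_left w0) g \<noteq> 0"
    by (rule S_lift_nonzero[OF g(1)])
  then have "\<not> vanish S (YP * lift_left g)" by (auto simp: vanish_at_def eval_YP vec_left_fun)
  then obtain w where w: "w \<in> S" "val w (YP * lift_left g) \<noteq> 0" "val w h \<noteq> 0"
    using prime_setD[OF prime_S _ h(1)] by blast
  then have "Y_at w \<noteq> 0" "val (vec_left w) g \<noteq> 0" by (auto simp: eval_YP vec_left_fun)
  then show ?thesis using tangent_dim_S[OF w(1)] h(2)[OF w(1,3)] g(2)[of "vec_left w"] w(1) by (simp add: mem_S')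
qed

lemma smooth_left:
  assumes "smooth_point S w" "Y_at w \<noteq> 0"
  shows "smooth_point X (vec_left w)"
proof -
  have w: "w \<in> S" and d: "vec.dim (tangent_space S w) = variety_dim S" using assms(1) by (auto simp: smooth_point_def)
  then show ?thesis using tangent_dim_S[OF w assms(2)] variety_dim_S by (simp add: smooth_point_def mem_S')
qed

text \<open>
  A coordinate with exponent at least two vanishes, so that the monomial of \<open>F\<close> has differential zero, like \<open>f\<close>.
  The tangent space is then the whole cylinder over the tangent space of \<open>X\<close>, which is too large.
\<close>

lemma not_smooth:
  assumes w: "w \<in> S" and j: "j \<noteq> j1" "vec_right w $ j = 0"
    and crit: "\<And>v. dval f (vec_left w) v = 0"
  shows "\<not> smooth_point S w"
proof -
  have "dval F w u = 0" for u
  proof -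
    obtain c where c: "k j = Suc (Suc c)" using k[OF j(1)] less_imp_Suc_add[of 1 "k j"] by auto
    have "mono_right k = mvar (Inr j) * (mvar (Inr j) * (mvar (Inr j) ^ c * (\<Prod>i\<in>UNIV - {j}. mvar (Inr i) ^ k i)) :: ('n + 'm, 'k) mpol)"
      unfolding mono_right_def by (subst prod.remove[of _ j]) (simp_all add: c mult.assoc)
    then show ?thesis using j(2) crit by (simp add: F_def vec_left_fun vec_right_nth)
  qed
  then have "tangent_space S w = {u. vec_left u \<in> tangent_space X (vec_left w)}"
    by (simp add: tangent_space_S[OF w])
  then have "vec.dim (tangent_space S w) = vec.dim (tangent_space X (vec_left w)) + CARD('m)"
    using dim_cylinder[OF subspace_tangent_space, of X "vec_left w", where 'm='m] by simp
  moreover have "variety_dim X \<le> vec.dim (tangent_space X (vec_left w))"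
    by (rule variety_dim_le_tangent_dim[OF X]) (use w in \<open>simp add: mem_S'\<close>)
  ultimately show ?thesis using variety_dim_S by (simp add: smooth_point_def)
qed

end

section \<open>Flows on a suspension\<close>

lemma divided_difference:
  "\<exists>G. \<forall>t z. tval t z P = tval 0 z P + t * tval t z G"
proof (induction P rule: mpol_induct)
  case (const c) show ?case by (rule exI[of _ 0]) simp
next
  case (var i)
  show ?case
  proof (cases i)
    case (Inl a) then show ?thesis by (intro exI[of _ 1]) simp
  next
    case (Inr b) then show ?thesis by (intro exI[of _ 0]) simp
  qed
next
  case (add P Q)
  then obtain G H where G: "\<And>t z. tval t z P = tval 0 z P + t * tval t z G"
    and H: "\<And>t z. tval t z Q = tval 0 z Q + t * tval t z H" by blast
  have "tval t z (P + Q) = tval 0 z (P + Q) + t * tval t z (G + H)" for t z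
    using G[of t z] H[of t z] by (simp add: algebra_simps)
  then show ?case by blast
next
  case (mult P Q)
  then obtain G H where G: "\<And>t z. tval t z P = tval 0 z P + t * tval t z G"
    and H: "\<And>t z. tval t z Q = tval 0 z Q + t * tval t z H" by blast
  let ?s = "subst (case_sum (\<lambda>_. 0) (\<lambda>i. mvar (Inr i)))"
  have s: "tval t z (?s P) = tval 0 z P" for t z and P
    unfolding eval_subst by (rule mpol_eval_cong) (simp split: sum.split)
  have "tval t z (P * Q) = tval 0 z (P * Q) + t * tval t z (?s P * H + G * Q)" for t z
  proof -
    have "tval t z P * tval t z Q =
      tval 0 z P * tval t z Q + t * (tval t z G * tval t z Q)"
      by (subst (1) G[of t z]) (simp add: algebra_simps)
    also have "tval 0 z P * tval t z Q =
      tval 0 z P * tval 0 z Q + t * (tval 0 z P * tval t z H)"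
      by (subst (1) H[of t z]) (simp add: algebra_simps)
    finally show ?thesis by (simp add: s algebra_simps)
  qed
  then show ?case by blast
qed

lemma velocityI:
  assumes "flow Z \<phi>" "\<And>t i. \<phi> t z $ i = poly (\<gamma> i) t"
  shows "velocity Z z (\<chi> i. coeff (\<gamma> i) 1)"
  using assms unfolding velocity_def by (intro exI[of _ \<phi>] exI[of _ \<gamma>]) simp

lemma coeff_1_pcompose_scale: "coeff (pcompose p [:0, c:]) 1 = c * coeff p (1 :: nat)" for p :: "'k::field_char_0 poly"
proof -
  have pd: "coeff q 1 = poly (pderiv q) 0" for q :: "'k poly"
    by (simp add: poly_0_coeff_0 coeff_pderiv)
  show ?thesis unfolding pd by (simp add: pderiv_pcompose poly_pcompose pderiv_pCons)
qed

context suspension_data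
begin

text \<open>
  A flow on \<open>X\<close> run for the time \<open>T\<close>, together with the addition of \<open>C\<close> to the coordinate \<open>j\<close>, where
  \<open>T\<close> and \<open>C\<close> depend on the time and the point. Both kinds of flows on the suspension have this form.
\<close>

definition shear :: "('k \<Rightarrow> 'k ^ 'n \<Rightarrow> 'k ^ 'n) \<Rightarrow> (1 + ('n + 'm), 'k) mpol \<Rightarrow> 'm \<Rightarrow> (1 + ('n + 'm), 'k) mpol \<Rightarrow>
    'k \<Rightarrow> 'k ^ ('n + 'm) \<Rightarrow> 'k ^ ('n + 'm)" where
  "shear \<phi> T j C t w = vec_join (\<phi> (tval t w T) (vec_left w))
     (\<chi> i. if i = j then vec_right w $ j + tval t w C else vec_right w $ i)"

lemma shear_left: "vec_left (shear \<phi> T j C t w) = \<phi> (tval t w T) (vec_left w)"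
  and shear_right: "vec_right (shear \<phi> T j C t w) $ i =
      (if i = j then vec_right w $ j + tval t w C else vec_right w $ i)"
  by (simp_all add: shear_def)

text \<open>
  The conditions on \<open>T\<close> and \<open>C\<close> are those of a cocycle.
\<close>

lemma flow_shear:
  assumes \<phi>: "flow X \<phi>"
    and S: "\<And>w t. w \<in> S \<Longrightarrow> shear \<phi> T j C t w \<in> S"
    and zero: "\<And>w. w \<in> S \<Longrightarrow> tval 0 w T = 0" "\<And>w. w \<in> S \<Longrightarrow> tval 0 w C = 0"
    and addT: "\<And>w s t. w \<in> S \<Longrightarrow> tval (s + t) w T = tval s (shear \<phi> T j C t w) T + tval t w T"
    and addC: "\<And>w s t. w \<in> S \<Longrightarrow> tval (s + t) w C = tval s (shear \<phi> T j C t w) C + tval t w C"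
  shows "flow S (shear \<phi> T j C)"
  unfolding flow_def
proof (intro conjI allI ballI)
  fix t w assume w: "w \<in> S" show "shear \<phi> T j C t w \<in> S" by (rule S[OF w])
next
  fix w assume w: "w \<in> S"
  have "vec_left w \<in> X" using w by (simp add: mem_S')
  then have "vec_left (shear \<phi> T j C 0 w) = vec_left w" by (simp add: shear_left zero[OF w] flow_0[OF \<phi>])
  moreover have "vec_right (shear \<phi> T j C 0 w) = vec_right w" by (simp add: vec_eq_iff shear_right zero[OF w])
  ultimately show "shear \<phi> T j C 0 w = w" by (metis vec_join_surj)
next
  fix s t w assume w: "w \<in> S"
  have x: "vec_left w \<in> X" using w by (simp add: mem_S')
  have "vec_left (shear \<phi> T j C (s + t) w) = vec_left (shear \<phi> T j C s (shear \<phi> T j C t w))"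
    by (simp add: shear_left addT[OF w] flow_add[OF \<phi> x])
  moreover have "vec_right (shear \<phi> T j C (s + t) w) = vec_right (shear \<phi> T j C s (shear \<phi> T j C t w))"
    by (simp add: vec_eq_iff shear_right addC[OF w] add.assoc add.commute[of "tval t w C"])
  ultimately show "shear \<phi> T j C (s + t) w = shear \<phi> T j C s (shear \<phi> T j C t w)" by (metis vec_join_surj)
next
  obtain \<Phi> where \<Phi>: "\<And>t z i. z \<in> X \<Longrightarrow> \<phi> t z $ i = tval t z (\<Phi> i)"
    using flow_poly[OF \<phi>] by blast
  define \<rho> :: "1 + 'n \<Rightarrow> (1 + ('n + 'm), 'k) mpol" where
    "\<rho> = case_sum (\<lambda>_. T) (\<lambda>i. mvar (Inr (Inl i)))"
  define \<Xi> where "\<Xi> = case_sum (\<lambda>i. subst \<rho> (\<Phi> i)) (\<lambda>i. if i = j then mvar (Inr (Inr j)) + C else mvar (Inr (Inr i)))"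
  have "shear \<phi> T j C t w $ i = tval t w (\<Xi> i)" if w: "w \<in> S" for t w i
  proof (cases i)
    case (Inl l)
    have x: "vec_left w \<in> X" using w by (simp add: mem_S')
    have "tval t w (\<rho> a) = timed (tval t w T) (vec_left w) a" for a
      by (cases a) (simp_all add: \<rho>_def vec_left_def)
    then have "tval t w (subst \<rho> (\<Phi> l)) = tval (tval t w T) (vec_left w) (\<Phi> l)"
      unfolding eval_subst by (rule mpol_eval_cong)
    then show ?thesis by (simp add: Inl \<Xi>_def shear_def \<Phi>[OF x])
  next
    case (Inr l)
    then show ?thesis by (simp add: \<Xi>_def shear_def vec_right_nth)
  qed
  then show "\<exists>\<Xi>. \<forall>t. \<forall>w\<in>S. \<forall>i. shear \<phi> T j C t w $ i = tval t w (\<Xi> i)" by blast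
qed

text \<open>
  If \<open>f(\<phi>\<^sub>\<tau>(x)) = f(x) + \<tau> g(\<tau>, x)\<close>, then moving \<open>x\<close> for the time \<open>\<tau> = t Y\<close> is compensated in the
  equation \<open>y\<^sub>j\<^sub>1 Y = f(x)\<close> by adding \<open>t g(t Y, x)\<close> to \<open>y\<^sub>j\<^sub>1\<close>. In terms of derivations, \<open>\<partial>\<close> becomes \<open>Y \<partial>\<close>
  on functions of \<open>x\<close>, and \<open>y\<^sub>j\<^sub>1\<close> goes to \<open>\<partial> f\<close>.
\<close>

lemma lifted_flow:
  assumes \<phi>: "flow X \<phi>"
  obtains \<psi> where "flow S \<psi>"
    "\<And>t w. vec_left (\<psi> t w) = \<phi> (t * Y_at w) (vec_left w)"
    "\<And>t w i. i \<noteq> j1 \<Longrightarrow> vec_right (\<psi> t w) $ i = vec_right w $ i"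
proof -
  obtain \<Phi> where \<Phi>: "\<And>t z i. z \<in> X \<Longrightarrow> \<phi> t z $ i = tval t z (\<Phi> i)"
    using flow_poly[OF \<phi>] by blast
  obtain G0 where G0: "\<And>t z. tval t z (subst \<Phi> f) = tval 0 z (subst \<Phi> f) + t * tval t z G0"
    using divided_difference[of "subst \<Phi> f"] by blast
  define g where "g t x = tval t x G0" for t x
  have fg: "val (\<phi> t x) f = val x f + t * g t x" if x: "x \<in> X" for t x
  proof -
    have "tval t x (subst \<Phi> f) = val (\<phi> t x) f" for t
      unfolding eval_subst by (rule mpol_eval_cong) (simp add: \<Phi>[OF x])
    then show ?thesis using G0[of t x] by (simp add: g_def flow_0[OF \<phi> x])
  qed
  let ?inr = "subst (\<lambda>i. mvar (Inr i)) :: ('n + 'm, 'k) mpol \<Rightarrow> (1 + ('n + 'm), 'k) mpol"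
  define T :: "(1 + ('n + 'm), 'k) mpol" where "T = mvar (Inl 1) * ?inr YP"
  define C :: "(1 + ('n + 'm), 'k) mpol" where
    "C = mvar (Inl 1) * subst (case_sum (\<lambda>_. T) (\<lambda>i. mvar (Inr (Inl i)))) G0"
  have T: "tval t w T = t * Y_at w" for t w
    by (simp add: T_def eval_subst eval_YP)
  have C: "tval t w C = t * g (t * Y_at w) (vec_left w)" for t w
  proof -
    have "tval t w (subst (case_sum (\<lambda>_. T) (\<lambda>i. mvar (Inr (Inl i)))) G0) = g (t * Y_at w) (vec_left w)"
      unfolding eval_subst g_def by (rule mpol_eval_cong) (simp add: T vec_left_def split: sum.split)
    then show ?thesis by (simp add: C_def)
  qed
  let ?\<psi> = "shear \<phi> T j1 C"
  have Yp: "Y_at ((?\<psi> t w)) = Y_at w" for t w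
    unfolding Y_def by (rule prod.cong) (auto simp: shear_right)
  have "flow S ?\<psi>"
  proof (rule flow_shear[OF \<phi>])
    fix w t assume w: "w \<in> S"
    then have x: "vec_left w \<in> X" and eq: "vec_right w $ j1 * Y_at w = val (vec_left w) f"
      by (simp_all add: mem_S')
    show "?\<psi> t w \<in> S"
      unfolding mem_S' Yp by (simp add: shear_left shear_right flow_in[OF \<phi> x] fg[OF x] T C eq[symmetric] algebra_simps)
    show "tval 0 w T = 0" "tval 0 w C = 0" by (simp_all add: T C)
  next
    fix w s t assume w: "w \<in> S"
    then have x: "vec_left w \<in> X" by (simp add: mem_S')
    show "tval (s + t) w T = tval s (?\<psi> t w) T + tval t w T"
      unfolding T Yp by (simp add: algebra_simps)
    define b where "b = Y_at w"
    let ?x = "vec_left w"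
    have "(s + t) * g ((s + t) * b) ?x = s * g (s * b) (\<phi> (t * b) ?x) + t * g (t * b) ?x"
    proof (cases "b = 0")
      case True
      then show ?thesis by (simp add: flow_0[OF \<phi> x] algebra_simps)
    next
      case False
      have "val (\<phi> (s * b) (\<phi> (t * b) ?x)) f = val (\<phi> ((s + t) * b) ?x) f"
        by (simp add: flow_add[OF \<phi> x, symmetric] distrib_right)
      then have "b * ((s + t) * g ((s + t) * b) ?x) = b * (s * g (s * b) (\<phi> (t * b) ?x) + t * g (t * b) ?x)"
        by (simp add: fg[OF x] fg[OF flow_in[OF \<phi> x]] algebra_simps)
      then show ?thesis using False by simp
    qed
    then show "tval (s + t) w C = tval s (?\<psi> t w) C + tval t w C"
      unfolding C Yp shear_left T b_def .
  qed
  then show ?thesis by (rule that) (simp_all add: shear_left shear_right T)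
qed

text \<open>
  For \<open>f(\<phi>\<^sub>\<tau>(x)) = f(x) + \<tau> \<sigma>(x)\<close> with invariant \<open>\<sigma>\<close> the roles can be exchanged: adding \<open>t \<sigma>\<close> to \<open>y\<^sub>j\<close>
  changes the monomial by a multiple \<open>\<sigma> T\<close> of \<open>\<sigma>\<close>, and moving \<open>x\<close> for the time \<open>T\<close> changes \<open>f\<close> by the same
  amount. This works for every weight \<open>k j\<close>.
\<close>

lemma slice_flow:
  assumes \<phi>: "flow X \<phi>"
    and f_lin: "\<And>x t. x \<in> X \<Longrightarrow> val (\<phi> t x) f = val x f + t * val x \<sigma>"
    and inv: "\<And>x t. x \<in> X \<Longrightarrow> val (\<phi> t x) \<sigma> = val x \<sigma>"
  obtains \<psi> where "flow S \<psi>"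
    "\<And>t w. w \<in> S \<Longrightarrow> val (vec_left (\<psi> t w)) \<sigma> = val (vec_left w) \<sigma>"
    "\<And>t w i. vec_right (\<psi> t w) $ i = vec_right w $ i + (if i = j then t * val (vec_left w) \<sigma> else 0)"
proof -
  let ?inr = "subst (\<lambda>i. mvar (Inr i)) :: ('n + 'm, 'k) mpol \<Rightarrow> (1 + ('n + 'm), 'k) mpol"
  define M where "M y = (\<Prod>i\<in>UNIV - {j}. y $ i ^ k i)" for y :: "'k ^ 'm"
  define MP :: "('n + 'm, 'k) mpol" where "MP = (\<Prod>i\<in>UNIV - {j}. mvar (Inr i) ^ k i)"
  have MP: "val w MP = M (vec_right w)" for w
    by (simp add: MP_def M_def vec_right_nth)
  \<comment> \<open>The divided difference of the power: \<open>(y + u)\<^sup>k - y\<^sup>k = u H(y, u)\<close>.\<close>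
  define H where "H y u = (\<Sum>i<k j. y ^ (k j - Suc i) * (y + u) ^ i)" for y u :: 'k
  have H: "(y + u) ^ k j = y ^ k j + u * H y u" for y u
    using power_diff_sumr2[of "y + u" "k j" y] by (simp add: H_def algebra_simps)
  let ?\<sigma> = "\<lambda>w. val (vec_left w) \<sigma>"
  define C :: "(1 + ('n + 'm), 'k) mpol" where "C = mvar (Inl 1) * ?inr (lift_left \<sigma>)"
  define T :: "(1 + ('n + 'm), 'k) mpol" where
    "T = mvar (Inl 1) * ?inr MP * (\<Sum>i<k j. mvar (Inr (Inr j)) ^ (k j - Suc i) * (mvar (Inr (Inr j)) + C) ^ i)"
  have C: "tval t w C = t * ?\<sigma> w" for t w
    by (simp add: C_def eval_subst vec_left_fun)
  have T: "tval t w T = t * M (vec_right w) * H (vec_right w $ j) (t * ?\<sigma> w)" for t w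
    by (simp add: T_def eval_subst MP C H_def vec_right_nth)
  let ?\<psi> = "shear \<phi> T j C"
  have Mp: "M (vec_right (?\<psi> t w)) = M (vec_right w)" for t w
    unfolding M_def by (rule prod.cong) (auto simp: shear_right)
  have \<sigma>p: "?\<sigma> (?\<psi> t w) = ?\<sigma> w" if "w \<in> S" for t w
    using that by (simp add: shear_left inv mem_S')
  have jp: "vec_right (?\<psi> t w) $ j = vec_right w $ j + t * ?\<sigma> w" for t w by (simp add: shear_right C)
  have mem: "w \<in> S \<longleftrightarrow> vec_left w \<in> X \<and> M (vec_right w) * vec_right w $ j ^ k j = val (vec_left w) f" for w
  proof -
    have "vec_right w $ j1 * Y_at w = (\<Prod>i\<in>UNIV. vec_right w $ i ^ k i)" by (simp add: prod_k)
    also have "\<dots> = vec_right w $ j ^ k j * M (vec_right w)" unfolding M_def by (rule prod.remove) auto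
    finally show ?thesis by (simp add: mem_S' mult.commute)
  qed
  have "flow S ?\<psi>"
  proof (rule flow_shear[OF \<phi>])
    fix w t assume w: "w \<in> S"
    then have x: "vec_left w \<in> X" and eq: "M (vec_right w) * vec_right w $ j ^ k j = val (vec_left w) f"
      by (simp_all add: mem)
    show "?\<psi> t w \<in> S"
      unfolding mem Mp jp H shear_left T f_lin[OF x] eq[symmetric] by (simp add: flow_in[OF \<phi> x] algebra_simps)
    show "tval 0 w T = 0" "tval 0 w C = 0" by (simp_all add: T C)
  next
    fix w s t assume w: "w \<in> S"
    show "tval (s + t) w C = tval s (?\<psi> t w) C + tval t w C"
      unfolding C \<sigma>p[OF w] by (simp add: algebra_simps)
    define c where "c = ?\<sigma> w"
    define y where "y = vec_right w $ j"
    have "(s + t) * H y ((s + t) * c) = s * H (y + t * c) (s * c) + t * H y (t * c)"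
    proof (cases "c = 0")
      case True then show ?thesis by (simp add: algebra_simps)
    next
      case False
      have "c * ((s + t) * H y ((s + t) * c)) = (y + (s + t) * c) ^ k j - y ^ k j"
        by (simp add: H algebra_simps)
      also have "\<dots> = ((y + t * c) + s * c) ^ k j - (y + t * c) ^ k j + ((y + t * c) ^ k j - y ^ k j)"
        by (simp add: algebra_simps)
      also have "\<dots> = c * (s * H (y + t * c) (s * c) + t * H y (t * c))"
        unfolding H[of "y + t * c"] H[of y] by (simp add: algebra_simps)
      finally show ?thesis using False by simp
    qed
    from arg_cong[OF this, of "(*) (M (vec_right w))"]
    show "tval (s + t) w T = tval s (?\<psi> t w) T + tval t w T"
      unfolding T Mp jp \<sigma>p[OF w] c_def[symmetric] y_def[symmetric]
      by (simp add: algebra_simps)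
  qed
  then show ?thesis by (rule that) (simp_all add: \<sigma>p shear_right C)
qed

lemma reach_lift:
  assumes "reach X x x'" "w \<in> S" "vec_left w = x" "Y_at w \<noteq> 0"
  shows "\<exists>w'. reach S w w' \<and> vec_left w' = x' \<and> Y_at w' \<noteq> 0"
  using assms(1)
proof (induction rule: reach.induct)
  case here then show ?case using assms reach.here by blast
next
  case (step q \<psi> a)
  then obtain w' where w': "reach S w w'" "vec_left w' = q" "Y_at w' \<noteq> 0" by blast
  obtain \<psi>' where \<psi>': "flow S \<psi>'"
    "\<And>t w. vec_left (\<psi>' t w) = \<psi> (t * Y_at w) (vec_left w)"
    "\<And>t w i. i \<noteq> j1 \<Longrightarrow> vec_right (\<psi>' t w) $ i = vec_right w $ i"
    using lifted_flow[OF step(2)] by metis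
  let ?w = "\<psi>' (a / Y_at w') w'"
  have "Y_at ?w = Y_at w'"
    unfolding Y_def by (rule prod.cong) (auto simp: \<psi>'(3))
  then show ?case using w' reach.step[OF w'(1) \<psi>'(1)] \<psi>'(2) by (intro exI[of _ ?w]) simp
qed

text \<open>
  The flow for a vanishing coordinate \<open>j\<close> makes it nonzero and preserves the others as well as \<open>\<sigma>\<close>.
\<close>

lemma reach_Y_nonzero:
  assumes \<phi>: "flow X \<phi>"
    and f_lin: "\<And>x t. x \<in> X \<Longrightarrow> val (\<phi> t x) f = val x f + t * val x \<sigma>"
    and inv: "\<And>x t. x \<in> X \<Longrightarrow> val (\<phi> t x) \<sigma> = val x \<sigma>"
    and w: "w \<in> S" "val (vec_left w) \<sigma> \<noteq> 0"
  shows "\<exists>w'. reach S w w' \<and> val (vec_left w') \<sigma> \<noteq> 0 \<and> Y_at w' \<noteq> 0"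
  using w
proof (induction "card {j. j \<noteq> j1 \<and> vec_right w $ j = 0}" arbitrary: w rule: less_induct)
  case less
  show ?case
  proof (cases "Y_at w = 0")
    case False then show ?thesis using less.prems reach.here by blast
  next
    case True
    then obtain j where j: "j \<noteq> j1" "vec_right w $ j = 0" using Y_nonzero[of "($) (vec_right w)"] by blast
    obtain \<psi> where \<psi>: "flow S \<psi>"
      "\<And>t w. w \<in> S \<Longrightarrow> val (vec_left (\<psi> t w)) \<sigma> = val (vec_left w) \<sigma>"
      "\<And>t w i. vec_right (\<psi> t w) $ i = vec_right w $ i + (if i = j then t * val (vec_left w) \<sigma> else 0)"
      using slice_flow[OF \<phi> f_lin inv, where j = j] by metis
    let ?w = "\<psi> 1 w"
    have "{i. i \<noteq> j1 \<and> vec_right ?w $ i = 0} \<subset> {i. i \<noteq> j1 \<and> vec_right w $ i = 0}"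
      using j less.prems(2) by (auto simp: \<psi>(3) split: if_splits)
    then have "card {i. i \<noteq> j1 \<and> vec_right ?w $ i = 0} < card {i. i \<noteq> j1 \<and> vec_right w $ i = 0}"
      by (intro psubset_card_mono) auto
    moreover have "?w \<in> S" by (rule flow_in[OF \<psi>(1) less.prems(1)])
    moreover have "val (vec_left ?w) \<sigma> \<noteq> 0" using \<psi>(2)[OF less.prems(1)] less.prems(2) by simp
    ultimately obtain w' where w': "reach S ?w w'" "val (vec_left w') \<sigma> \<noteq> 0" "Y_at w' \<noteq> 0"
      using less.hyps by blast
    have "reach S w ?w" by (rule reach.step[OF reach.here \<psi>(1)])
    then show ?thesis using w' reach_trans[OF w'(1)] by blast
  qed
qed

lemma lifted_velocity:
  assumes v: "velocity X (vec_left w) v" and w: "w \<in> S"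
  shows "\<exists>u. velocity S w u \<and> vec_left u = Y_at w *s v \<and> (\<forall>i. i \<noteq> j1 \<longrightarrow> vec_right u $ i = 0)"
proof -
  obtain \<phi> \<gamma> where \<phi>: "flow X \<phi>" and \<gamma>: "\<And>t i. \<phi> t (vec_left w) $ i = poly (\<gamma> i) t" "\<And>i. v $ i = coeff (\<gamma> i) 1"
    using v by (auto simp: velocity_def)
  obtain \<psi> where \<psi>: "flow S \<psi>"
    "\<And>t w. vec_left (\<psi> t w) = \<phi> (t * Y_at w) (vec_left w)"
    "\<And>t w i. i \<noteq> j1 \<Longrightarrow> vec_right (\<psi> t w) $ i = vec_right w $ i"
    using lifted_flow[OF \<phi>] by metis
  obtain \<delta> where \<delta>: "\<And>t i. \<psi> t w $ i = poly (\<delta> i) t" using flow_curve[OF \<psi>(1) w] by blast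
  let ?u = "\<chi> i. coeff (\<delta> i) 1"
  have "\<delta> (Inl i) = pcompose (\<gamma> i) [:0, Y_at w:]" for i
  proof (rule poly_eqI_infinite)
    fix t
    have "poly (\<delta> (Inl i)) t = vec_left (\<psi> t w) $ i" by (simp add: \<delta>[symmetric] vec_left_def)
    then show "poly (\<delta> (Inl i)) t = poly (pcompose (\<gamma> i) [:0, Y_at w:]) t"
      by (simp add: \<psi>(2) \<gamma>(1) poly_pcompose)
  qed
  then have "vec_left ?u = Y_at w *s v"
    by (simp add: vec_eq_iff vec_left_def \<gamma>(2) coeff_1_pcompose_scale[unfolded One_nat_def])
  moreover have "vec_right ?u $ i = 0" if "i \<noteq> j1" for i
  proof -
    have "\<delta> (Inr i) = [:vec_right w $ i:]"
      by (rule poly_eqI_infinite) (simp add: \<delta>[symmetric] vec_right_nth \<psi>(3)[OF that])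
    then show ?thesis by (simp add: vec_right_def)
  qed
  ultimately show ?thesis using velocityI[OF \<psi>(1) \<delta>] by blast
qed

lemma slice_velocity:
  assumes \<phi>: "flow X \<phi>"
    and f_lin: "\<And>x t. x \<in> X \<Longrightarrow> val (\<phi> t x) f = val x f + t * val x \<sigma>"
    and inv: "\<And>x t. x \<in> X \<Longrightarrow> val (\<phi> t x) \<sigma> = val x \<sigma>"
    and w: "w \<in> S"
  shows "\<exists>u. velocity S w u \<and> (\<forall>i. vec_right u $ i = (if i = j then val (vec_left w) \<sigma> else 0))"
proof -
  obtain \<psi> where \<psi>: "flow S \<psi>"
    "\<And>t w i. vec_right (\<psi> t w) $ i = vec_right w $ i + (if i = j then t * val (vec_left w) \<sigma> else 0)"
    using slice_flow[OF \<phi> f_lin inv, where j = j] by metis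
  obtain \<delta> where \<delta>: "\<And>t i. \<psi> t w $ i = poly (\<delta> i) t" using flow_curve[OF \<psi>(1) w] by blast
  have "vec_right (\<chi> i. coeff (\<delta> i) 1) $ i = (if i = j then val (vec_left w) \<sigma> else 0)" for i
  proof -
    have "\<delta> (Inr i) = [:vec_right w $ i, if i = j then val (vec_left w) \<sigma> else 0:]"
      by (rule poly_eqI_infinite) (simp add: \<delta>[symmetric] vec_right_nth \<psi>(2))
    then show ?thesis by (simp add: vec_right_def)
  qed
  then show ?thesis using velocityI[OF \<psi>(1) \<delta>] by blast
qed

text \<open>
  The velocities of the flows for the coordinates \<open>j \<noteq> j1\<close> have independent components at these
  coordinates, and the lifted flows reach every tangent direction of \<open>X\<close>. What remains is a multiple of \<open>e1\<close>,
  which is not tangent.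
\<close>

lemma flexible_at_S:
  assumes \<phi>: "flow X \<phi>"
    and f_lin: "\<And>x t. x \<in> X \<Longrightarrow> val (\<phi> t x) f = val x f + t * val x \<sigma>"
    and inv: "\<And>x t. x \<in> X \<Longrightarrow> val (\<phi> t x) \<sigma> = val x \<sigma>"
    and w: "w \<in> S" and Y: "Y_at w \<noteq> 0" and \<sigma>: "val (vec_left w) \<sigma> \<noteq> 0"
    and fl: "flexible_at X (vec_left w)"
  shows "flexible_at S w"
  unfolding flexible_at_def
proof
  fix u assume u: "u \<in> tangent_space S w"
  let ?V = "vec.span {u. velocity S w u}"
  let ?b = "Y_at w" and ?c = "val (vec_left w) \<sigma>"
  have VT: "?V \<subseteq> tangent_space S w"
    by (rule vec.span_minimal[OF _ subspace_tangent_space]) (use velocity_tangent[OF _ w] in blast)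
  obtain D where D: "\<And>j. velocity S w (D j)" "\<And>j i. vec_right (D j) $ i = (if i = j then ?c else 0)"
    using slice_velocity[OF \<phi> f_lin inv w] by metis
  \<comment> \<open>Subtracting \<open>d\<close> removes the components of \<open>u\<close> at all coordinates other than \<open>j1\<close>.\<close>
  define d where "d = (\<Sum>j\<in>UNIV - {j1}. (vec_right u $ j / ?c) *s D j)"
  have dV: "d \<in> ?V" unfolding d_def by (intro vec.span_sum vec.span_scale vec.span_base) (simp add: D)
  have dr: "vec_right d $ i = vec_right u $ i" if "i \<noteq> j1" for i
  proof -
    have "vec_right d $ i = (\<Sum>j\<in>UNIV - {j1}. (vec_right u $ j / ?c) * vec_right (D j) $ i)"
      by (simp add: d_def vec_right_def)
    also have "\<dots> = (\<Sum>j\<in>UNIV - {j1}. if j = i then vec_right u $ j else 0)"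
      by (rule sum.cong) (use \<sigma> in \<open>auto simp: D(2)\<close>)
    also have "\<dots> = vec_right u $ i" using that by simp
    finally show ?thesis .
  qed
  define u1 where "u1 = u - d"
  have u1T: "u1 \<in> tangent_space S w"
    unfolding u1_def using u dV VT by (intro vec.subspace_diff subspace_tangent_space) auto
  have u1r: "vec_right u1 $ i = 0" if "i \<noteq> j1" for i
    using dr[OF that] by (simp add: u1_def vec_right_def)
  \<comment> \<open>Dividing by \<open>Y\<close> undoes the slowing down of the lifted flows.\<close>
  have lift: "\<exists>u'\<in>?V. vec_left u' = x \<and> (\<forall>i. i \<noteq> j1 \<longrightarrow> vec_right u' $ i = 0)"
    if "x \<in> vec.span {v. velocity X (vec_left w) v}" for x
    using that
  proof (induction rule: vec.span_induct_alt)
    case base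
    show ?case by (rule bexI[of _ 0]) (simp_all add: vec_left_def vec_right_def vec_eq_iff vec.span_zero)
  next
    case (step c x y)
    obtain u' where u': "u' \<in> ?V" "vec_left u' = y" "\<forall>i. i \<noteq> j1 \<longrightarrow> vec_right u' $ i = 0" using step(2) by blast
    obtain u'' where u'': "velocity S w u''" "vec_left u'' = ?b *s x" "\<forall>i. i \<noteq> j1 \<longrightarrow> vec_right u'' $ i = 0"
      using lifted_velocity[of w x] step(1) w by blast
    show ?case
    proof (rule bexI[of _ "(c / ?b) *s u'' + u'"])
      show "(c / ?b) *s u'' + u' \<in> ?V"
        using u'(1) u''(1) by (intro vec.span_add vec.span_scale) (auto intro: vec.span_base)
      have "vec_left ((c / ?b) *s u'' + u') = (c / ?b) *s vec_left u'' + vec_left u'"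
        "\<And>i. vec_right ((c / ?b) *s u'' + u') $ i = (c / ?b) * vec_right u'' $ i + vec_right u' $ i"
        by (simp_all add: vec_left_def vec_right_def vec_eq_iff)
      then show "vec_left ((c / ?b) *s u'' + u') = c *s x + y \<and> (\<forall>i. i \<noteq> j1 \<longrightarrow> vec_right ((c / ?b) *s u'' + u') $ i = 0)"
        using Y u'(2,3) u''(2,3) by (simp add: vec_eq_iff)
    qed
  qed
  have "vec_left u1 \<in> tangent_space X (vec_left w)" using u1T by (simp add: tangent_space_S[OF w])
  then obtain u2 where u2: "u2 \<in> ?V" "vec_left u2 = vec_left u1" "\<forall>i. i \<noteq> j1 \<longrightarrow> vec_right u2 $ i = 0"
    using fl lift unfolding flexible_at_def by blast
  define c where "c = vec_right u1 $ j1 - vec_right u2 $ j1"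
  have "u1 - u2 = c *s e1"
  proof -
    have "vec_left u1 $ i = vec_left u2 $ i" for i using u2(2) by simp
    moreover have "vec_right u1 $ i - vec_right u2 $ i = (if i = j1 then c else 0)" for i
      using u1r[of i] u2(3) by (simp add: c_def)
    ultimately have "(u1 - u2) $ i = (c *s e1) $ i" for i
      by (cases i) (auto simp: e1_def axis_def vec_left_def vec_right_def)
    then show ?thesis by (simp add: vec_eq_iff)
  qed
  moreover have "u1 - u2 \<in> tangent_space S w"
    using u1T u2(1) VT by (intro vec.subspace_diff subspace_tangent_space) auto
  then have "dval F w (u1 - u2) = 0" by (simp add: tangent_space_S[OF w])
  ultimately have "c * ?b = 0" by (simp add: dirderiv_vec_scale dirderiv_F_e1)
  then have "c = 0" using Y by simp
  then have "u = d + u2" using \<open>u1 - u2 = c *s e1\<close> by (simp add: u1_def algebra_simps)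
  then show "u \<in> ?V" using dV u2(1) by (simp add: vec.span_add)
qed

end

text \<open>
  The factor \<open>s\<^sup>2\<close> in \<open>f = s\<^sup>2 r\<close> makes \<open>f\<close> and its differential vanish where \<open>s\<close> does, while \<open>f\<close> remains
  a local slice, with slope \<open>s\<^sup>3\<close>.
\<close>

theorem proposition4p2:
  fixes X :: "('k::{alg_closed_field, field_char_0} ^ 'n::finite) set"
    and j1 :: "'m::finite"
  assumes "affine_variety X"
    and "\<And>p. X \<noteq> {p}"
    and "flexible X"
  shows "\<exists>f. regular_fun X f \<and> \<not> f constant_on X \<and>
           (\<forall>k :: 'm \<Rightarrow> nat. k j1 = 1 \<longrightarrow> (\<forall>j. j \<noteq> j1 \<longrightarrow> k j > 1) \<longrightarrow>
              affine_variety (suspension X f k) \<and> flexible (suspension X f k))"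
proof -
  have X: "prime_set X" by (rule affine_variety_prime_set[OF assms(1)])
  have fl: "flexible_at X p" if "smooth_point X p" for p using assms(3) that by (simp add: flexible_iff)
  have "variety_dim X \<noteq> 0" using variety_dim_0[OF X] assms(2) by blast
  obtain h where h: "\<not> vanish X h" "\<And>p. p \<in> X \<Longrightarrow> val p h \<noteq> 0 \<Longrightarrow> vec.dim (tangent_space X p) = variety_dim X"
    using generic_point_dim[OF X] by blast
  then obtain p0 where p0: "p0 \<in> X" "vec.dim (tangent_space X p0) = variety_dim X" by (auto simp: vanish_at_def)
  \<comment> \<open>Flexibility at a smooth point of a variety of positive dimension gives a nontrivial flow.\<close>
  have "\<exists>v. velocity X p0 v \<and> v \<noteq> 0"
  proof (rule ccontr)
    assume "\<not> ?thesis"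
    then have "{v. velocity X p0 v} \<subseteq> {0}" by blast
    then have "vec.span {v. velocity X p0 v} \<subseteq> vec.span {0}" by (rule vec.span_mono)
    then have "tangent_space X p0 \<subseteq> {0}" using fl[of p0] p0 by (auto simp: flexible_at_def smooth_point_def)
    then have "vec.dim (tangent_space X p0) \<le> vec.dim ({0} :: ('k ^ 'n) set)" by (rule vec.dim_subset)
    then show False using p0(2) \<open>variety_dim X \<noteq> 0\<close> by simp
  qed
  then obtain v \<phi> \<gamma> where \<phi>: "flow X \<phi>" and v: "v \<noteq> 0" "\<And>t i. \<phi> t p0 $ i = poly (\<gamma> i) t" "\<And>i. v $ i = coeff (\<gamma> i) 1"
    by (auto simp: velocity_def)
  have "\<exists>a. \<phi> a p0 \<noteq> p0"
  proof (rule ccontr)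
    assume "\<not> ?thesis"
    then have "\<gamma> i = [:p0 $ i:]" for i using v(2)[of _ i] by (intro poly_eqI_infinite) simp
    then show False using v(1,3) by (simp add: vec_eq_iff)
  qed
  then obtain a where a: "\<phi> a p0 \<noteq> p0" by blast
  obtain r s z1 where lin: "\<And>z t. z \<in> X \<Longrightarrow> val (\<phi> t z) r = val z r + t * val z s"
    and inv: "\<And>z t. z \<in> X \<Longrightarrow> val (\<phi> t z) s = val z s"
    and z1: "z1 \<in> X" "val z1 s \<noteq> 0"
    by (rule flow_slice[OF \<phi> p0(1) a]) (rule that, simp_all)
  define f where "f = s ^ 2 * r"
  define \<sigma> where "\<sigma> = s ^ 3"
  have f_lin: "val (\<phi> t x) f = val x f + t * val x \<sigma>" if "x \<in> X" for x t
    by (simp add: f_def \<sigma>_def lin[OF that] inv[OF that] algebra_simps power2_eq_square power3_eq_cube)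
  have \<sigma>_inv: "val (\<phi> t x) \<sigma> = val x \<sigma>" if "x \<in> X" for x t
    by (simp add: \<sigma>_def inv[OF that])
  have crit: "dval f x v = 0" if "val x s = 0" for x v
    by (simp add: f_def power2_eq_square that)
  have sX: "\<not> vanish X s" using z1 by (auto simp: vanish_at_def)
  let ?f = "\<lambda>x. val x f"
  have f01: "?f (\<phi> 1 z1) \<noteq> ?f z1" using f_lin[OF z1(1), of 1] z1(2) by (simp add: \<sigma>_def)
  have nonconst: "\<not> ?f constant_on X"
    using f01 flow_in[OF \<phi> z1(1), of 1] z1(1) unfolding constant_on_def by metis
  have fX: "\<not> vanish X f"
    using f01 flow_in[OF \<phi> z1(1), of 1] z1(1) unfolding vanish_at_def by metis
  have "affine_variety (suspension X ?f k) \<and> flexible (suspension X ?f k)"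
    if k: "k j1 = 1" "\<And>j. j \<noteq> j1 \<Longrightarrow> k j > 1" for k :: "'m \<Rightarrow> nat"
  proof -
    interpret suspension_data X f k j1 by unfold_locales (use X fX k in auto)
    have "zariski_closed X" using assms(1) by (simp add: affine_variety_def)
    then have "affine_variety S" by (intro prime_set_affine_variety prime_S zariski_closed_S)
    moreover have "flexible_at S w" if w: "smooth_point S w" for w
    proof -
      have wS: "w \<in> S" using w by (simp add: smooth_point_def)
      have "\<exists>w'. reach S w w' \<and> val (vec_left w') \<sigma> \<noteq> 0 \<and> Y_at w' \<noteq> 0"
      proof (cases "Y_at w = 0")
        case True
        then obtain j where "j \<noteq> j1" "vec_right w $ j = 0" using Y_nonzero[of "($) (vec_right w)"] by blast
        then have "val (vec_left w) s \<noteq> 0" using not_smooth[OF wS] crit w by blast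
        then show ?thesis by (intro reach_Y_nonzero[OF \<phi> f_lin \<sigma>_inv wS]) (simp_all add: \<sigma>_def)
      next
        case False
        obtain q where q: "reach X (vec_left w) q" "val q s \<noteq> 0"
          using orbit_dense[OF X fl smooth_left[OF w False] sX] by blast
        then show ?thesis using reach_lift[OF q(1) wS refl False] by (auto simp: \<sigma>_def)
      qed
      then obtain w' where w': "reach S w w'" "val (vec_left w') \<sigma> \<noteq> 0" "Y_at w' \<noteq> 0"
        by blast
      have w'S: "w' \<in> S" by (rule reach_in[OF w'(1) wS])
      have "smooth_point S w'"
        using w w'S reach_tangent_dim[OF w'(1) wS] by (simp add: smooth_point_def)
      then have "flexible_at X (vec_left w')" by (intro fl smooth_left w'(3))
      then have "flexible_at S w'" by (intro flexible_at_S[OF \<phi> f_lin \<sigma>_inv w'S w'(3) w'(2)])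
      then show ?thesis by (rule reach_flexible_at[OF w'(1) wS])
    qed
    ultimately show ?thesis by (simp add: flexible_iff)
  qed
  moreover have "regular_fun X ?f" by (auto simp: regular_fun_def)
  ultimately show ?thesis using nonconst by blast
qed

end
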